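(* Let $X$, $\Gamma$, $o$ be as in the context. If a $\Gamma$-invariant $(b,\theta)$-density exists for some $\theta=(\theta_1,\dots,\theta_r)\in E^+$ and $b=(b_1,\dots,b_r)\in\mathbb R^r$, then $$\delta_\theta(\Gamma)\le\sum_{i=1}^r b_i\,\theta_i.$$
   Context: A Hadamard space is a complete CAT(0) geodesic metric space. Let $(X_1,d_1),\dots,(X_r,d_r)$ be locally compact Hadamard spaces and $X=X_1\times\cdots\times X_r$ with $d=\sqrt{d_1^2+\cdots+d_r^2}$, which is again a locally compact Hadamard space. $\partial X$, $\partial X_i$ are the geometric boundaries (classes of asymptotic geodesic rays, with the cone topology). A geodesic line in a Hadamard space is rank one if it does not bound a flat half-plane. An isometry $h$ of a Hadamard space is axial if there are $l(h)>0$ and a geodesic line $\sigma$ (an axis) with $h(\sigma(t))=\sigma(t+l(h))$ for all $t$; $\mathrm{Ax}(h)$ is the set of points $x$ with $d(x,hx)=l(h)$. An axial isometry is rank one if it has a rank one axis; two rank one isometries are independent if their fixed point sets are disjoint. $\Gamma<\mathrm{Is}(X_1)\times\cdots\times\mathrm{Is}(X_r)$ is a group acting properly discontinuously by isometries on $X$ and containing two elements $h=(h_1,\dots,h_r)$, $g=(g_1,\dots,g_r)$ such that for every $i$ the isometries $g_i$ and $h_i$ of $X_i$ are independent rank one isometries. The base point $o=(o_1,\dots,o_r)\in\mathrm{Ax}(h)$ is fixed. $L_\Gamma=\overline{\Gamma\cdot x}\cap\partial X$ ($x\in X$ arbitrary) is the geometric limit set. Slopes: $E=\{\theta\in\mathbb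 R^r_{\ge0}:\|\theta\|=1\}$, $E^+=\{\theta\in\mathbb R^r_{>0}:\|\theta\|=1\}$, $I^+(\theta)=\{i:\theta_i>0\}$. Every geodesic ray $\sigma$ in $X$ can be written $\sigma(t)=(\sigma_1(t\theta_1),\dots,\sigma_r(t\theta_r))$ with $\theta\in E$ and unit speed geodesic rays $\sigma_i$ in $X_i$ (for $\theta_i=0$ the $i$-th component is constant). $\theta$ is the slope of $\sigma$ and depends only on the class of $\sigma$. $\partial X_\theta\subset\partial X$ is the set of points of slope $\theta$; a point $\tilde\eta\in\partial X_\theta$ is determined by its projections $\eta_i=\sigma_i(\infty)\in\partial X_i$, $i\in I^+(\theta)$. Exponent of growth: for $\theta\in E$, $\varepsilon>0$ let $N_\theta^\varepsilon(n)$ be the number of $\gamma=(\gamma_1,\dots,\gamma_r)\in\Gamma$ with $0<d(o,\gamma o)<n$ and $\left|\frac{d_i(o_i,\gamma_io_i)}{d(o,\gamma o)}-\theta_i\right|<\varepsilon$ for all $i$; $\delta_\theta(\Gamma)=\lim_{\varepsilon\to0}\limsup_{n\to\infty}\frac{\ln N_\theta^\varepsilon(n)}{n}$. Busemann function: for $\eta_i\in\partial X_i$, $\beta_{\eta_i}(x_i,y_i)=\lim_{s\to\infty}(d_i(x_i,\sigma(s))-d_i(y_i,\sigma(s)))$ for any geodesic ray $\sigma$ in the class $\eta_i$. $(b,\theta)$-density: for $\theta\in E$ and $b\in\mathbb R^r$ with $b_i=0$ for $i\notin I^+(\theta)$, a $\Gamma$-invariant $(b,\theta)$-density is a map $\mu$,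 $x\mapsto\mu_x$, from $X$ to the positive finite Borel measures on $\partial X$ such that for all $x=(x_1,\dots,x_r)\in X$: (i) $\emptyset\ne\operatorname{supp}(\mu_x)\subset L_\Gamma\cap\partial X_\theta$; (ii) $\gamma_*\mu_x=\mu_{\gamma x}$ for all $\gamma\in\Gamma$ (where $\gamma_*\mu_x(A)=\mu_x(\gamma^{-1}A)$); (iii) for all $\tilde\eta\in\operatorname{supp}(\mu_o)$, $\frac{d\mu_x}{d\mu_o}(\tilde\eta)=\exp\big(\sum_{i\in I^+(\theta)}b_i\beta_{\eta_i}(o_i,x_i)\big)$. *)

theory Defs
  imports "HOL-Analysis.Analysis" "HOL-Algebra.Bij" "HOL-Algebra.Product_Groups"
begin

section \<open>Geodesics and Hadamard spaces\<close>

definition geodesic_segment :: "'a metric \<Rightarrow> 'a \<Rightarrow> 'a \<Rightarrow> (real \<Rightarrow> 'a) \<Rightarrow> bool" where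
  "geodesic_segment m x y g \<longleftrightarrow>
     x \<in> mspace m \<and> y \<in> mspace m \<and> g ` {0..mdist m x y} \<subseteq> mspace m \<and>
     g 0 = x \<and> g (mdist m x y) = y \<and>
     (\<forall>s\<in>{0..mdist m x y}. \<forall>t\<in>{0..mdist m x y}. mdist m (g s) (g t) = \<bar>s - t\<bar>)"

text \<open>Rays are total functions, of which only the values at nonnegative times matter.\<close>

definition geodesic_ray :: "'a metric \<Rightarrow> (real \<Rightarrow> 'a) \<Rightarrow> bool" where
  "geodesic_ray m \<sigma> \<longleftrightarrow>
     \<sigma> ` {0..} \<subseteq> mspace m \<and> (\<forall>s\<ge>0. \<forall>t\<ge>0. mdist m (\<sigma> s) (\<sigma> t) = \<bar>s - t\<bar>)"

definition geodesic_line :: "'a metric \<Rightarrow> (real \<Rightarrow> 'a) \<Rightarrow> bool" where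
  "geodesic_line m \<sigma> \<longleftrightarrow>
     range \<sigma> \<subseteq> mspace m \<and> (\<forall>s t. mdist m (\<sigma> s) (\<sigma> t) = \<bar>s - t\<bar>)"

definition geodesic_space :: "'a metric \<Rightarrow> bool" where
  "geodesic_space m \<longleftrightarrow>
     (\<forall>x\<in>mspace m. \<forall>y\<in>mspace m. \<exists>g. geodesic_segment m x y g)"

text \<open>The CAT(0) inequality compares points on the sides of a geodesic triangle
  with their comparison points in a Euclidean triangle with the same side lengths. Two
  points on the same side satisfy it trivially, and any two different sides share a vertex; up to
  naming the vertices, this vertex is \<open>x\<close>. The third side exists in a geodesic space.\<close>

definition CAT0 :: "'a metric \<Rightarrow> bool" where
  "CAT0 m \<longleftrightarrow> geodesic_space m \<and>
     (\<forall>x y z g h (x'::real^2) y' z'.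
        geodesic_segment m x y g \<and> geodesic_segment m x z h \<and>
        dist x' y' = mdist m x y \<and> dist y' z' = mdist m y z \<and> dist x' z' = mdist m x z
        \<longrightarrow> (\<forall>s\<in>{0..mdist m x y}. \<forall>t\<in>{0..mdist m x z}.
              \<forall>p'\<in>closed_segment x' y'. \<forall>q'\<in>closed_segment x' z'.
                dist x' p' = s \<and> dist x' q' = t \<longrightarrow> mdist m (g s) (h t) \<le> dist p' q'))"

definition hadamard :: "'a metric \<Rightarrow> bool" where
  "hadamard m \<longleftrightarrow> mcomplete_of m \<and> CAT0 m"


section \<open>Geometric boundary and cone topology\<close>

definition asymptotic :: "'a metric \<Rightarrow> ((real \<Rightarrow> 'a) \<times> (real \<Rightarrow> 'a)) set" where
  "asymptotic m = {(\<sigma>, \<tau>). geodesic_ray m \<sigma> \<and> geodesic_ray m \<tau> \<and>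
                            (\<exists>C. \<forall>t\<ge>0. mdist m (\<sigma> t) (\<tau> t) \<le> C)}"

definition boundary :: "'a metric \<Rightarrow> (real \<Rightarrow> 'a) set set" where
  "boundary m = {\<sigma>. geodesic_ray m \<sigma>} // asymptotic m"

text \<open>The bordification of \<open>m\<close> is \<open>Inl ` mspace m \<union> Inr ` boundary m\<close>. The set
  \<open>cone_nbhd m c R \<epsilon>\<close> consists of the points \<open>z\<close> outside the closed ball of radius \<open>R\<close>
  around \<open>c 0\<close> for which the geodesic from \<open>c 0\<close> to \<open>z\<close> passes at time \<open>R\<close> at distance less than
  \<open>\<epsilon>\<close> from \<open>c R\<close>.\<close>

definition cone_nbhd ::
  "'a metric \<Rightarrow> (real \<Rightarrow> 'a) \<Rightarrow> real \<Rightarrow> real \<Rightarrow> ('a + (real \<Rightarrow> 'a) set) set" where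
  "cone_nbhd m c R \<epsilon> =
     Inl ` {x \<in> mspace m. R < mdist m (c 0) x \<and>
              (\<exists>g. geodesic_segment m (c 0) x g \<and> mdist m (g R) (c R) < \<epsilon>)} \<union>
     Inr ` {\<xi> \<in> boundary m. \<exists>\<rho>\<in>\<xi>. \<rho> 0 = c 0 \<and> mdist m (\<rho> R) (c R) < \<epsilon>}"

definition cone_topology :: "'a metric \<Rightarrow> ('a + (real \<Rightarrow> 'a) set) topology" where
  "cone_topology m = topology_generated_by
     ({Inl ` mball_of m x r |x r. x \<in> mspace m \<and> 0 < r} \<union>
      {cone_nbhd m c R \<epsilon> |c R \<epsilon>. geodesic_ray m c \<and> 0 < R \<and> 0 < \<epsilon>})"

definition boundary_topology :: "'a metric \<Rightarrow> (real \<Rightarrow> 'a) set topology" where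
  "boundary_topology m = pullback_topology (boundary m) Inr (cone_topology m)"

definition busemann :: "'a metric \<Rightarrow> (real \<Rightarrow> 'a) set \<Rightarrow> 'a \<Rightarrow> 'a \<Rightarrow> real" where
  "busemann m \<eta> x y =
     (THE c. \<forall>\<sigma>\<in>\<eta>. ((\<lambda>s. mdist m x (\<sigma> s) - mdist m y (\<sigma> s)) \<longlongrightarrow> c) at_top)"


section \<open>Isometries\<close>

definition isometry_group :: "'a metric \<Rightarrow> ('a \<Rightarrow> 'a) monoid" where
  "isometry_group m = (BijGroup (mspace m))
     \<lparr>carrier := {f \<in> Bij (mspace m).
        \<forall>x\<in>mspace m. \<forall>y\<in>mspace m. mdist m (f x) (f y) = mdist m x y}\<rparr>"

text \<open>The composite of an isometry with a ray need not have canonical values at negative times,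
  so the image of a class is completed to a full class.\<close>

definition boundary_action ::
  "'a metric \<Rightarrow> ('a \<Rightarrow> 'a) \<Rightarrow> (real \<Rightarrow> 'a) set \<Rightarrow> (real \<Rightarrow> 'a) set" where
  "boundary_action m f \<xi> = asymptotic m `` ((\<lambda>\<sigma>. f \<circ> \<sigma>) ` \<xi>)"

definition fixed_points :: "'a metric \<Rightarrow> ('a \<Rightarrow> 'a) \<Rightarrow> ('a + (real \<Rightarrow> 'a) set) set" where
  "fixed_points m f =
     Inl ` {x \<in> mspace m. f x = x} \<union> Inr ` {\<xi> \<in> boundary m. boundary_action m f \<xi> = \<xi>}"

definition is_axis :: "'a metric \<Rightarrow> ('a \<Rightarrow> 'a) \<Rightarrow> real \<Rightarrow> (real \<Rightarrow> 'a) \<Rightarrow> bool" where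
  "is_axis m f l \<sigma> \<longleftrightarrow> 0 < l \<and> geodesic_line m \<sigma> \<and> (\<forall>t. f (\<sigma> t) = \<sigma> (t + l))"

definition translation_length :: "'a metric \<Rightarrow> ('a \<Rightarrow> 'a) \<Rightarrow> real" where
  "translation_length m f = (THE l. \<exists>\<sigma>. is_axis m f l \<sigma>)"

definition Ax :: "'a metric \<Rightarrow> ('a \<Rightarrow> 'a) \<Rightarrow> 'a set" where
  "Ax m f = {x \<in> mspace m. mdist m x (f x) = translation_length m f}"

definition bounds_flat_half_plane :: "'a metric \<Rightarrow> (real \<Rightarrow> 'a) \<Rightarrow> bool" where
  "bounds_flat_half_plane m \<sigma> \<longleftrightarrow>
     (\<exists>F :: real \<times> real \<Rightarrow> 'a.
        F ` (UNIV \<times> {0..}) \<subseteq> mspace m \<and> (\<forall>s. F (s, 0) = \<sigma> s) \<and>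
        (\<forall>u\<in>UNIV \<times> {0..}. \<forall>v\<in>UNIV \<times> {0..}. mdist m (F u) (F v) = dist u v))"

definition rank_one_isometry :: "'a metric \<Rightarrow> ('a \<Rightarrow> 'a) \<Rightarrow> bool" where
  "rank_one_isometry m f \<longleftrightarrow> f \<in> carrier (isometry_group m) \<and>
     (\<exists>l \<sigma>. is_axis m f l \<sigma> \<and> \<not> bounds_flat_half_plane m \<sigma>)"

definition independent_rank_one :: "'a metric \<Rightarrow> ('a \<Rightarrow> 'a) \<Rightarrow> ('a \<Rightarrow> 'a) \<Rightarrow> bool" where
  "independent_rank_one m f f' \<longleftrightarrow> rank_one_isometry m f \<and> rank_one_isometry m f' \<and>
     fixed_points m f \<inter> fixed_points m f' = {}"


section \<open>Products\<close>

text \<open>The number of factors is the cardinality of the finite index type. The factors are metrics on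
  arbitrary subsets of a common type, so they may be unrelated spaces.\<close>

definition product_metric :: "('i::finite \<Rightarrow> 'a metric) \<Rightarrow> ('i \<Rightarrow> 'a) metric" where
  "product_metric X = metric (\<Pi>\<^sub>E i\<in>UNIV. mspace (X i),
     \<lambda>x y. sqrt (\<Sum>i\<in>UNIV. (mdist (X i) (x i) (y i))\<^sup>2))"

lemma Metric_space_product:
  fixes X :: "'i::finite \<Rightarrow> 'a metric"
  shows "Metric_space (\<Pi>\<^sub>E i\<in>UNIV. mspace (X i))
           (\<lambda>x y. sqrt (\<Sum>i\<in>UNIV. (mdist (X i) (x i) (y i))\<^sup>2))"
proof
  fix x y z
  show "0 \<le> sqrt (\<Sum>i\<in>UNIV. (mdist (X i) (x i) (y i))\<^sup>2)"
    by (simp add: sum_nonneg)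
  show "sqrt (\<Sum>i\<in>UNIV. (mdist (X i) (x i) (y i))\<^sup>2) =
        sqrt (\<Sum>i\<in>UNIV. (mdist (X i) (y i) (x i))\<^sup>2)"
    by (simp add: mdist_commute)
  assume x: "x \<in> (\<Pi>\<^sub>E i\<in>UNIV. mspace (X i))" and y: "y \<in> (\<Pi>\<^sub>E i\<in>UNIV. mspace (X i))"
  then show "sqrt (\<Sum>i\<in>UNIV. (mdist (X i) (x i) (y i))\<^sup>2) = 0 \<longleftrightarrow> x = y"
    by (auto simp: sum_nonneg_eq_0_iff PiE_iff fun_eq_iff)
  assume z: "z \<in> (\<Pi>\<^sub>E i\<in>UNIV. mspace (X i))"
  have "L2_set (\<lambda>i. mdist (X i) (x i) (z i)) UNIV
      \<le> L2_set (\<lambda>i. mdist (X i) (x i) (y i) + mdist (X i) (y i) (z i)) UNIV"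
    using x y z by (intro L2_set_mono) (auto simp: PiE_iff intro: mdist_triangle)
  also have "\<dots> \<le> L2_set (\<lambda>i. mdist (X i) (x i) (y i)) UNIV
                 + L2_set (\<lambda>i. mdist (X i) (y i) (z i)) UNIV"
    by (rule L2_set_triangle_ineq)
  finally show "sqrt (\<Sum>i\<in>UNIV. (mdist (X i) (x i) (z i))\<^sup>2)
      \<le> sqrt (\<Sum>i\<in>UNIV. (mdist (X i) (x i) (y i))\<^sup>2)
       + sqrt (\<Sum>i\<in>UNIV. (mdist (X i) (y i) (z i))\<^sup>2)"
    by (simp add: L2_set_def)
qed

lemma mspace_product_metric: "mspace (product_metric X) = (\<Pi>\<^sub>E i\<in>UNIV. mspace (X i))"
  and mdist_product_metric:
    "mdist (product_metric X) x y = sqrt (\<Sum>i\<in>UNIV. (mdist (X i) (x i) (y i))\<^sup>2)"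
  by (simp_all add: product_metric_def Metric_space.mspace_metric
      Metric_space.mdist_metric Metric_space_product)

definition act :: "('i \<Rightarrow> 'a \<Rightarrow> 'a) \<Rightarrow> ('i \<Rightarrow> 'a) \<Rightarrow> ('i \<Rightarrow> 'a)" where
  "act \<gamma> x = (\<lambda>i. \<gamma> i (x i))"

definition properly_discontinuous ::
  "('i::finite \<Rightarrow> 'a metric) \<Rightarrow> ('i \<Rightarrow> 'a \<Rightarrow> 'a) set \<Rightarrow> bool" where
  "properly_discontinuous X \<Gamma> \<longleftrightarrow>
     (\<forall>K. compactin (mtopology_of (product_metric X)) K
          \<longrightarrow> finite {\<gamma> \<in> \<Gamma>. act \<gamma> ` K \<inter> K \<noteq> {}})"

definition limit_set ::
  "('i::finite \<Rightarrow> 'a metric) \<Rightarrow> ('i \<Rightarrow> 'a \<Rightarrow> 'a) set \<Rightarrow> ('i \<Rightarrow> 'a) \<Rightarrow> (real \<Rightarrow> 'i \<Rightarrow> 'a) set set"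
  where
  "limit_set X \<Gamma> x =
     {\<xi> \<in> boundary (product_metric X).
        Inr \<xi> \<in> cone_topology (product_metric X) closure_of (Inl ` (\<lambda>\<gamma>. act \<gamma> x) ` \<Gamma>)}"

definition E_slopes :: "(real^'i::finite) set" where
  "E_slopes = {\<theta>. norm \<theta> = 1 \<and> (\<forall>i. 0 \<le> \<theta> $ i)}"

definition E_plus :: "(real^'i::finite) set" where
  "E_plus = {\<theta>. norm \<theta> = 1 \<and> (\<forall>i. 0 < \<theta> $ i)}"

definition I_plus :: "real^'i::finite \<Rightarrow> 'i set" where
  "I_plus \<theta> = {i. 0 < \<theta> $ i}"

definition has_slope ::
  "('i::finite \<Rightarrow> 'a metric) \<Rightarrow> (real \<Rightarrow> 'i \<Rightarrow> 'a) \<Rightarrow> real^'i \<Rightarrow> bool" where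
  "has_slope X \<sigma> \<theta> \<longleftrightarrow> \<theta> \<in> E_slopes \<and>
     (\<forall>i. if i \<in> I_plus \<theta>
          then \<exists>\<rho>. geodesic_ray (X i) \<rho> \<and> (\<forall>t\<ge>0. \<sigma> t i = \<rho> (t * \<theta> $ i))
          else \<exists>x\<in>mspace (X i). \<forall>t\<ge>0. \<sigma> t i = x)"

definition boundary_slope ::
  "('i::finite \<Rightarrow> 'a metric) \<Rightarrow> real^'i \<Rightarrow> (real \<Rightarrow> 'i \<Rightarrow> 'a) set set" where
  "boundary_slope X \<theta> = {\<xi> \<in> boundary (product_metric X). \<exists>\<sigma>\<in>\<xi>. has_slope X \<sigma> \<theta>}"

text \<open>For a boundary point \<open>\<xi>\<close> of slope \<open>\<theta>\<close> and \<open>i \<in> I_plus \<theta>\<close> this is the class in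
  \<open>boundary (X i)\<close> of the unit speed \<open>i\<close>-th component of any ray in \<open>\<xi>\<close>.\<close>

definition boundary_proj ::
  "('i::finite \<Rightarrow> 'a metric) \<Rightarrow> real^'i \<Rightarrow> 'i \<Rightarrow> (real \<Rightarrow> 'i \<Rightarrow> 'a) set \<Rightarrow> (real \<Rightarrow> 'a) set" where
  "boundary_proj X \<theta> i \<xi> =
     {\<rho>. geodesic_ray (X i) \<rho> \<and> (\<exists>\<sigma>\<in>\<xi>. \<forall>t\<ge>0. \<sigma> t i = \<rho> (t * \<theta> $ i))}"


section \<open>Exponent of growth\<close>

definition orbit_count ::
  "('i::finite \<Rightarrow> 'a metric) \<Rightarrow> ('i \<Rightarrow> 'a \<Rightarrow> 'a) set \<Rightarrow> ('i \<Rightarrow> 'a) \<Rightarrow> real^'i \<Rightarrow> real \<Rightarrow> nat \<Rightarrow> nat"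
  where
  "orbit_count X \<Gamma> p \<theta> \<epsilon> n = card {\<gamma> \<in> \<Gamma>.
     0 < mdist (product_metric X) p (act \<gamma> p) \<and>
     mdist (product_metric X) p (act \<gamma> p) < real n \<and>
     (\<forall>i. \<bar>mdist (X i) (p i) (\<gamma> i (p i)) / mdist (product_metric X) p (act \<gamma> p) - \<theta> $ i\<bar> < \<epsilon>)}"

text \<open>The case distinction implements the convention \<open>ln 0 = -\<infinity>\<close>.\<close>

definition growth_exponent ::
  "('i::finite \<Rightarrow> 'a metric) \<Rightarrow> ('i \<Rightarrow> 'a \<Rightarrow> 'a) set \<Rightarrow> ('i \<Rightarrow> 'a) \<Rightarrow> real^'i \<Rightarrow> ereal" where
  "growth_exponent X \<Gamma> p \<theta> = Lim (at_right 0) (\<lambda>\<epsilon>.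
     limsup (\<lambda>n. if orbit_count X \<Gamma> p \<theta> \<epsilon> n = 0 then -\<infinity>
                 else ereal (ln (real (orbit_count X \<Gamma> p \<theta> \<epsilon> n)) / real n)))"


section \<open>Densities\<close>

definition borel_of :: "'b topology \<Rightarrow> 'b measure" where
  "borel_of T = sigma (topspace T) {U. openin T U}"

definition msupport :: "'b topology \<Rightarrow> 'b measure \<Rightarrow> 'b set" where
  "msupport T M = {\<xi> \<in> topspace T. \<forall>U. openin T U \<and> \<xi> \<in> U \<longrightarrow> 0 < emeasure M U}"

text \<open>\<open>p\<close> is the base point. The last condition says that some version \<open>f\<close> of the Radon-Nikodym
  derivative of \<open>\<mu> x\<close> with respect to \<open>\<mu> p\<close> has the prescribed value everywhere on the support
  of \<open>\<mu> p\<close>.\<close>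

definition invariant_density ::
  "('i::finite \<Rightarrow> 'a metric) \<Rightarrow> ('i \<Rightarrow> 'a \<Rightarrow> 'a) set \<Rightarrow> ('i \<Rightarrow> 'a) \<Rightarrow> real^'i \<Rightarrow> real^'i \<Rightarrow>
   (('i \<Rightarrow> 'a) \<Rightarrow> (real \<Rightarrow> 'i \<Rightarrow> 'a) set measure) \<Rightarrow> bool" where
  "invariant_density X \<Gamma> p b \<theta> \<mu> \<longleftrightarrow>
     \<theta> \<in> E_slopes \<and> (\<forall>i. i \<notin> I_plus \<theta> \<longrightarrow> b $ i = 0) \<and>
     (let T = boundary_topology (product_metric X) in
      \<forall>x \<in> mspace (product_metric X).
        sets (\<mu> x) = sets (borel_of T) \<and> finite_measure (\<mu> x) \<and>
        msupport T (\<mu> x) \<noteq> {} \<and>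
        msupport T (\<mu> x) \<subseteq> limit_set X \<Gamma> p \<inter> boundary_slope X \<theta> \<and>
        (\<forall>\<gamma>\<in>\<Gamma>. distr (\<mu> x) (borel_of T) (boundary_action (product_metric X) (act \<gamma>))
                 = \<mu> (act \<gamma> x)) \<and>
        (\<exists>f \<in> borel_measurable (\<mu> p). \<mu> x = density (\<mu> p) f \<and>
           (\<forall>\<xi> \<in> msupport T (\<mu> p). f \<xi> = ennreal (exp
              (\<Sum>i\<in>I_plus \<theta>. b $ i * busemann (X i) (boundary_proj X \<theta> i \<xi>) (p i) (x i))))))"

end

theory Submission
  imports Defs
begin

text \<open>The proof counts orbit points by means of their shadows. To an element \<open>\<gamma>\<close> of
the group belongs a set of boundary points whose rays from \<open>p\<close> pass near
\<open>\<gamma> p\<close> in every factor, and by the transformation rule of the density this set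
has \<open>\<mu> p\<close>-measure at least a constant times \<open>exp (- \<Sum>i. b $ i * d i (p
i) (\<gamma> i (p i)))\<close> (lemma \<open>shadow_lemma\<close>). If the distances in all
factors are prescribed up to \<open>1\<close>, then a boundary point lies in a bounded number of
such shadows, since the elements whose shadows it lies in differ by elements that move
\<open>p\<close> by a bounded amount (\<open>box_count\<close>). As \<open>\<mu> p\<close> is
finite, a box of orbit points with distances about \<open>n * \<theta> $ i\<close> contains at
most a constant times \<open>exp (n * \<Sum>i. b $ i * \<theta> $ i)\<close> elements. The number
of boxes that meet the ball of radius \<open>n\<close> is polynomial in \<open>n\<close>, so that
it does not contribute to the exponent of growth. This argument needs \<open>0 \<le> \<Sum>i. b $
i * \<theta> $ i\<close>, because orbit points much closer than \<open>n\<close> are counted as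
well. The sign comes from the support of the density: it lies in the limit set, hence there are
arbitrarily distant orbit points with slope near \<open>\<theta>\<close>, and the measures of
their shadows are bounded by the total mass (\<open>weight_nonneg\<close>).

The substance is the lower bound for shadows, and there the rank one isometries enter. Along a
rank one axis \<open>\<sigma>\<close> every distance function is steep outside an interval of
bounded length. Otherwise, one finds distance functions that are nearly linear with slope in the
interior of \<open>{-1<..<1}\<close> on longer and longer intervals; a translation along the axis
centres these intervals, and in the limit the geodesics from the axis to the points in question
span a flat half-plane (\<open>half_plane_of_linear_horofunction\<close>,
\<open>steep_distance\<close>). It follows that a geodesic between two points whose projections to
\<open>\<sigma>\<close> lie far apart on either side of \<open>\<sigma> m\<close> passes within
bounded distance of \<open>\<sigma> m\<close> (\<open>axis_contracting\<close>). Consequently, for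
a point \<open>x\<close> behind the axes and a boundary point in front of them, in all factors at
once, the Busemann functions are \<open>- d i (p i) (x i)\<close> up to a constant, and the rays
from \<open>x\<close> pass near the axes (\<open>seen_from_behind\<close>).

To arrange such positions simultaneously in all factors, let \<open>r\<close> be the number of
factors. In each factor at most one of the isometries \<open>g i ^^ 0\<close>, ..., \<open>g i ^^
r\<close> takes a given point sufficiently near the positive end of the axis of \<open>h
i\<close>: two of them would make a power of \<open>g i\<close> fix that end, contrary to
independence. Hence one exponent suits all factors, and a fixed power of the inverse of
\<open>h\<close> then moves the point behind the axes (\<open>push_points\<close>). By the
analogous argument at the negative ends, every boundary point of slope \<open>\<theta>\<close> can
be moved in front of the axes (\<open>push_rays\<close>, \<open>move_to_front\<close>). The first
statement provides finitely many elements that bring any orbit point behind the axes, the second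
an open set of positive measure in front of them.

All geometry rests on the inequality of Bruhat and Tits for squared distances. Summation
transports it from the factors to the product, and neither angles nor comparison triangles appear
after its derivation from the CAT(0) condition.\<close>

section \<open>The inequality of Bruhat and Tits\<close>

text \<open>This is the inequality for midpoints, extended to all proportions \<open>l\<close>. In Euclidean
space it is Stewart's identity. A space with this property is uniquely geodesic and of nonpositive
curvature; the convexity statements below are all consequences. Being linear in squared distances,
the property is inherited by products.\<close>

locale cn_space =
  fixes X :: "'a metric"
  assumes ex_cn_point: "\<lbrakk>x \<in> mspace X; y \<in> mspace X; 0 \<le> l; l \<le> 1\<rbrakk> \<Longrightarrow>
    \<exists>w\<in>mspace X. \<forall>z\<in>mspace X. (mdist X z w)\<^sup>2
      \<le> (1 - l) * (mdist X z x)\<^sup>2 + l * (mdist X z y)\<^sup>2 - l * (1 - l) * (mdist X x y)\<^sup>2"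
begin

sublocale Metric_space "mspace X" "mdist X" by (rule Metric_space_mspace_mdist)

abbreviation (input) M where "M \<equiv> mspace X"
abbreviation (input) d where "d \<equiv> mdist X"

text \<open>The point at proportion \<open>l\<close> on the geodesic from \<open>x\<close> to
\<open>y\<close>; the choice is unique, by the lemma \<open>pt_unique\<close> below.\<close>

definition pt :: "'a \<Rightarrow> 'a \<Rightarrow> real \<Rightarrow> 'a" where
  "pt x y l = (SOME w. w \<in> M \<and> (\<forall>z\<in>M. (d z w)\<^sup>2
      \<le> (1 - l) * (d z x)\<^sup>2 + l * (d z y)\<^sup>2 - l * (1 - l) * (d x y)\<^sup>2))"

lemma pt_props:
  assumes "x \<in> M" "y \<in> M" "0 \<le> l" "l \<le> 1"
  shows pt_in: "pt x y l \<in> M"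
    and pt_cn: "z \<in> M \<Longrightarrow> (d z (pt x y l))\<^sup>2
      \<le> (1 - l) * (d z x)\<^sup>2 + l * (d z y)\<^sup>2 - l * (1 - l) * (d x y)\<^sup>2"
proof -
  have "pt x y l \<in> M \<and> (\<forall>z\<in>M. (d z (pt x y l))\<^sup>2
      \<le> (1 - l) * (d z x)\<^sup>2 + l * (d z y)\<^sup>2 - l * (1 - l) * (d x y)\<^sup>2)"
    unfolding pt_def by (rule someI_ex) (use ex_cn_point[OF assms] in blast)
  then show "pt x y l \<in> M" "z \<in> M \<Longrightarrow> (d z (pt x y l))\<^sup>2
      \<le> (1 - l) * (d z x)\<^sup>2 + l * (d z y)\<^sup>2 - l * (1 - l) * (d x y)\<^sup>2" by auto
qed

lemma pt_unique:
  assumes "x \<in> M" "y \<in> M" "0 \<le> l" "l \<le> 1" "w \<in> M"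
    and "d x w = l * d x y" "d w y = (1 - l) * d x y"
  shows "w = pt x y l"
proof -
  have "(d w (pt x y l))\<^sup>2 \<le> (1 - l) * (l * d x y)\<^sup>2 + l * ((1 - l) * d x y)\<^sup>2 - l * (1 - l) * (d x y)\<^sup>2"
    using pt_cn[OF assms(1-5)] assms(6,7) by (simp add: mdist_commute)
  also have "\<dots> = 0" by algebra
  finally show ?thesis using assms pt_in by simp
qed

lemma pt_dist:
  assumes "x \<in> M" "y \<in> M" "0 \<le> l" "l \<le> 1"
  shows pt_dist1: "d x (pt x y l) = l * d x y" and pt_dist2: "d (pt x y l) y = (1 - l) * d x y"
proof -
  let ?w = "pt x y l"
  have w: "?w \<in> M" using assms by (rule pt_in)
  have "(d x ?w)\<^sup>2 \<le> (l * d x y)\<^sup>2"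
    using pt_cn[OF assms assms(1)] assms by (simp add: power2_eq_square algebra_simps)
  then have 1: "d x ?w \<le> l * d x y" using assms by (auto elim: power2_le_imp_le)
  have "(d y ?w)\<^sup>2 \<le> ((1 - l) * d x y)\<^sup>2"
    using pt_cn[OF assms assms(2)] assms by (simp add: mdist_commute power2_eq_square algebra_simps)
  then have 2: "d y ?w \<le> (1 - l) * d x y" using assms by (auto elim: power2_le_imp_le)
  have "d x y \<le> d x ?w + d ?w y" using assms w by (intro mdist_triangle)
  with 1 2 show "d x ?w = l * d x y" "d ?w y = (1 - l) * d x y"
    by (simp_all add: mdist_commute algebra_simps)
qed

lemma pt_at_dist:
  assumes "x \<in> M" "y \<in> M" "0 \<le> v" "v \<le> d x y"
  shows "0 \<le> v / d x y" "v / d x y \<le> 1" "pt x y (v / d x y) \<in> M"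
    "d x (pt x y (v / d x y)) = v" "d (pt x y (v / d x y)) y = d x y - v"
proof -
  show l: "0 \<le> v / d x y" "v / d x y \<le> 1" using assms by (auto simp: divide_le_eq)
  show "pt x y (v / d x y) \<in> M" by (rule pt_in[OF assms(1,2) l])
  have *: "v / d x y * d x y = v" using assms by auto
  show "d x (pt x y (v / d x y)) = v" unfolding pt_dist1[OF assms(1,2) l] by (rule *)
  show "d (pt x y (v / d x y)) y = d x y - v"
    unfolding pt_dist2[OF assms(1,2) l] left_diff_distrib * by simp
qed

lemma pt_0 [simp]: "x \<in> M \<Longrightarrow> y \<in> M \<Longrightarrow> pt x y 0 = x"
  by (rule pt_unique[symmetric]) auto

lemma pt_swap: "\<lbrakk>x \<in> M; y \<in> M; 0 \<le> l; l \<le> 1\<rbrakk> \<Longrightarrow> pt x y l = pt y x (1 - l)"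
  using pt_dist1[of x y l] pt_dist2[of x y l]
  by (intro pt_unique) (simp_all add: pt_in mdist_commute)

text \<open>Two applications of the inequality at the midpoint of one diagonal, combined by the triangle
inequality, bound the other diagonal. This replaces arguments with angles, e.g. for the Lipschitz
property of projections and for Busemann functions.\<close>

lemma quadrilateral_ineq:
  assumes "x \<in> M" "y \<in> M" "z \<in> M" "w \<in> M"
  shows "(d x z)\<^sup>2 + (d y w)\<^sup>2 \<le> (d x y)\<^sup>2 + (d y z)\<^sup>2 + (d z w)\<^sup>2 + (d w x)\<^sup>2"
proof -
  let ?m = "pt x z (1/2)"
  have m: "?m \<in> M" using assms by (intro pt_in) auto
  have 1: "(d y ?m)\<^sup>2 \<le> (d y x)\<^sup>2/2 + (d y z)\<^sup>2/2 - (d x z)\<^sup>2/4"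
    using pt_cn[of x z "1/2" y] assms by simp
  have 2: "(d w ?m)\<^sup>2 \<le> (d w x)\<^sup>2/2 + (d w z)\<^sup>2/2 - (d x z)\<^sup>2/4"
    using pt_cn[of x z "1/2" w] assms by simp
  have "d y w \<le> d y ?m + d w ?m" using mdist_triangle[of y X ?m w] assms m by (simp add: mdist_commute)
  then have "(d y w)\<^sup>2 \<le> (d y ?m + d w ?m)\<^sup>2" by (intro power_mono) auto
  also have "\<dots> \<le> 2 * (d y ?m)\<^sup>2 + 2 * (d w ?m)\<^sup>2"
    using zero_le_power2[of "d y ?m - d w ?m"] by (simp add: power2_eq_square algebra_simps)
  finally show ?thesis using 1 2 by (simp add: mdist_commute)
qed

text \<open>Geodesics from a common point spread at least linearly. The distance between the two points at
proportion \<open>l\<close> is estimated by first comparing one of them with the ends of the other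
geodesic.\<close>

lemma dist_pt_common_start:
  assumes "x \<in> M" "y \<in> M" "z \<in> M" "0 \<le> l" "l \<le> 1"
  shows "d (pt x y l) (pt x z l) \<le> l * d y z"
proof -
  let ?c = "pt x y l" and ?A = "d x y" and ?B = "d x z" and ?e = "d y z"
  have c: "?c \<in> M" using assms by (intro pt_in)
  have "(d ?c (pt x z l))\<^sup>2 \<le> (1-l) * (d ?c x)\<^sup>2 + l * (d ?c z)\<^sup>2 - l*(1-l)* ?B\<^sup>2"
    using pt_cn[of x z l ?c] assms c by simp
  also have "d ?c x = l * ?A" using pt_dist1[of x y l] assms by (simp add: mdist_commute)
  also have "(1-l) * (l * ?A)\<^sup>2 + l * (d ?c z)\<^sup>2 - l*(1-l)* ?B\<^sup>2 \<le>
     (1-l) * (l * ?A)\<^sup>2 + l * ((1-l) * ?B\<^sup>2 + l * ?e\<^sup>2 - l*(1-l)* ?A\<^sup>2) - l*(1-l)* ?B\<^sup>2"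
    using pt_cn[of x y l z] assms by (intro diff_right_mono add_left_mono mult_left_mono)
      (auto simp: mdist_commute)
  also have "\<dots> = (l * ?e)\<^sup>2" by algebra
  finally show ?thesis using assms by (auto elim: power2_le_imp_le)
qed

lemma dist_pt_common_end:
  assumes "x \<in> M" "y \<in> M" "z \<in> M" "0 \<le> l" "l \<le> 1"
  shows "d (pt y x l) (pt z x l) \<le> (1 - l) * d y z"
  using dist_pt_common_start[of x y z "1 - l"] assms by (simp add: pt_swap[of _ x l])

lemma dist_pt_pt:
  assumes "x \<in> M" "y \<in> M" "x' \<in> M" "y' \<in> M" "0 \<le> l" "l \<le> 1"
  shows "d (pt x y l) (pt x' y' l) \<le> (1 - l) * d x x' + l * d y y'"
proof -
  have "d (pt x y l) (pt x' y' l) \<le> d (pt x y l) (pt x y' l) + d (pt x y' l) (pt x' y' l)"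
    using assms by (intro mdist_triangle pt_in)
  with dist_pt_common_start[of x y y' l] dist_pt_common_end[of y' x x' l] assms show ?thesis by simp
qed

lemma dist_same_segment:
  assumes "x \<in> M" "y \<in> M" "0 \<le> l" "l \<le> 1" "0 \<le> k" "k \<le> 1"
  shows "d (pt x y l) (pt x y k) = \<bar>l - k\<bar> * d x y"
proof -
  have *: "d (pt x y l) (pt x y k) = (k - l) * d x y"
    if "0 \<le> l" "l \<le> k" "k \<le> 1" for l k
  proof (cases "k = 0")
    case True with that assms show ?thesis by simp
  next
    case False
    let ?p = "pt x y l" and ?q = "pt x (pt x y k) (l / k)"
    have k: "pt x y k \<in> M" using assms that by (intro pt_in) auto
    have r: "0 \<le> l / k" "l / k \<le> 1" using that False by auto
    have q: "?q \<in> M" using assms that k r by (intro pt_in) auto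
    have d1: "d x ?q = l * d x y" using pt_dist1[OF assms(1) k r] that False assms
      by (simp add: pt_dist1)
    have d2: "d ?q (pt x y k) = (k - l) * d x y"
    proof -
      have "(1 - l / k) * (k * d x y) = (k - l) * d x y" using False by (simp add: field_simps)
      then show ?thesis using pt_dist2[OF assms(1) k r] that assms by (simp add: pt_dist1)
    qed
    have "d ?q y \<le> (1 - l) * d x y"
      using mdist_triangle[of ?q X "pt x y k" y] d2 pt_dist2[of x y k] assms that q k
      by (simp add: algebra_simps)
    moreover have "d x y \<le> d x ?q + d ?q y" using assms q by (intro mdist_triangle)
    ultimately have "d ?q y = (1 - l) * d x y" using d1 by (simp add: algebra_simps)
    then have "?q = ?p" using d1 assms that q by (intro pt_unique) auto
    then show ?thesis using d2 by simp
  qed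
  show ?thesis
  proof (cases "l \<le> k")
    case True with *[of l k] assms show ?thesis by simp
  next
    case False with *[of k l] assms show ?thesis by (simp add: mdist_commute)
  qed
qed

text \<open>Segments, rays and lines are given as isometric maps; this translates them into the points
\<open>pt x y l\<close>, to which the inequality applies.\<close>

lemma geodesic_point:
  assumes "\<And>s t. s \<in> {a..b} \<Longrightarrow> t \<in> {a..b} \<Longrightarrow> d (\<sigma> s) (\<sigma> t) = \<bar>s - t\<bar>"
    and "\<sigma> ` {a..b} \<subseteq> M" and "0 \<le> l" "l \<le> 1" "a \<le> b"
  shows "\<sigma> ((1-l) * a + l * b) = pt (\<sigma> a) (\<sigma> b) l"
proof -
  define t where "t = (1-l) * a + l * b"
  have e: "t - a = l * (b - a)" "b - t = (1-l) * (b-a)" by (simp_all add: t_def algebra_simps)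
  have "0 \<le> t - a" "0 \<le> b - t" unfolding e using assms by simp_all
  then have t: "a \<le> t" "t \<le> b" by simp_all
  have "\<sigma> t = pt (\<sigma> a) (\<sigma> b) l"
  proof (rule pt_unique)
    have "a \<in> {a..b}" "b \<in> {a..b}" "t \<in> {a..b}" using t by simp_all
    then have "d (\<sigma> a) (\<sigma> b) = b - a" "d (\<sigma> a) (\<sigma> t) = t - a" "d (\<sigma> t) (\<sigma> b) = b - t"
      using assms(1)[of a b] assms(1)[of a t] assms(1)[of t b] t by simp_all
    then show "d (\<sigma> a) (\<sigma> t) = l * d (\<sigma> a) (\<sigma> b)" "d (\<sigma> t) (\<sigma> b) = (1-l) * d (\<sigma> a) (\<sigma> b)"
      by (simp_all only: e)
  qed (use assms t in auto)
  then show ?thesis by (simp add: t_def)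
qed

lemma pt_convex:
  assumes "x \<in> M" "y \<in> M" "0 \<le> l" "l \<le> 1" "z \<in> M"
  shows "d z (pt x y l) \<le> (1 - l) * d z x + l * d z y"
  using dist_pt_pt[of z z x y l] assms pt_unique[of z z l z] by simp

lemma geodesic_rayD:
  assumes "geodesic_ray X \<rho>"
  shows "0 \<le> t \<Longrightarrow> \<rho> t \<in> M" "0 \<le> s \<Longrightarrow> 0 \<le> t \<Longrightarrow> d (\<rho> s) (\<rho> t) = \<bar>s - t\<bar>"
  using assms by (auto simp: geodesic_ray_def)

lemma ray_point:
  assumes "geodesic_ray X \<rho>" "0 \<le> s" "s \<le> t" "0 < t"
  shows "\<rho> s = pt (\<rho> 0) (\<rho> t) (s / t)"
  using geodesic_point[of 0 t \<rho> "s / t"] assms geodesic_rayD[OF assms(1)]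
  by (auto simp: image_subset_iff)

text \<open>Convexity of \<open>t \<mapsto> d (\<rho> t) (\<rho>' t)\<close> turns boundedness into the bound
by the initial distance, which is uniform over all asymptotic pairs with given starting points.\<close>

lemma asymptoticD:
  assumes "(\<rho>, \<rho>') \<in> asymptotic X"
  shows "geodesic_ray X \<rho>" "geodesic_ray X \<rho>'"
    "0 \<le> t \<Longrightarrow> d (\<rho> t) (\<rho>' t) \<le> d (\<rho> 0) (\<rho>' 0)"
proof -
  show r: "geodesic_ray X \<rho>" "geodesic_ray X \<rho>'" using assms by (auto simp: asymptotic_def)
  from assms obtain C where C: "\<And>t. t \<ge> 0 \<Longrightarrow> d (\<rho> t) (\<rho>' t) \<le> C" by (auto simp: asymptotic_def)
  assume t: "0 \<le> t"
  \<comment> \<open>A bounded convex function cannot grow: compare \<open>t\<close> with a time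
    \<open>s\<close> that tends to infinity.\<close>
  have "\<forall>\<^sub>F s in at_top. d (\<rho> t) (\<rho>' t) \<le> (1 - t / s) * d (\<rho> 0) (\<rho>' 0) + (t / s) * C"
    using eventually_ge_at_top[of "t + 1"]
  proof eventually_elim
    case (elim s)
    have "d (\<rho> t) (\<rho>' t) \<le> (1 - t / s) * d (\<rho> 0) (\<rho>' 0) + (t / s) * d (\<rho> s) (\<rho>' s)"
      using ray_point[OF r(1), of t s] ray_point[OF r(2), of t s] elim t
        dist_pt_pt[of "\<rho> 0" "\<rho> s" "\<rho>' 0" "\<rho>' s" "t / s"] geodesic_rayD[OF r(1)] geodesic_rayD[OF r(2)]
      by simp
    also have "\<dots> \<le> (1 - t / s) * d (\<rho> 0) (\<rho>' 0) + (t / s) * C"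
      using C[of s] elim t by (intro add_left_mono mult_left_mono) auto
    finally show ?case .
  qed
  moreover have "((\<lambda>s. (1 - t / s) * d (\<rho> 0) (\<rho>' 0) + (t / s) * C) \<longlongrightarrow> (1 - 0) * d (\<rho> 0) (\<rho>' 0) + 0 * C) at_top"
    by (intro tendsto_intros tendsto_divide_0[OF tendsto_const] filterlim_at_top_imp_at_infinity filterlim_ident)
  ultimately show "d (\<rho> t) (\<rho>' t) \<le> d (\<rho> 0) (\<rho>' 0)"
    by (intro tendsto_lowerbound[where a = "d (\<rho> t) (\<rho>' t)" and x = "d (\<rho> 0) (\<rho>' 0)"
          and f = "\<lambda>s. (1 - t / s) * d (\<rho> 0) (\<rho>' 0) + (t / s) * C" and F = at_top]) simp_all
qed

lemma asymptotic_same_start: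
  assumes "(\<rho>, \<rho>') \<in> asymptotic X" "\<rho> 0 = \<rho>' 0" "0 \<le> t"
  shows "\<rho> t = \<rho>' t"
proof -
  have "d (\<rho> t) (\<rho>' t) = 0"
    using asymptoticD(3)[OF assms(1,3)] assms(2) geodesic_rayD(2)[OF asymptoticD(2)[OF assms(1)], of 0 0]
    by (simp add: order_antisym)
  then show ?thesis using Metric_space.zero[OF Metric_space_axioms, of "\<rho> t" "\<rho>' t"] asymptoticD(1,2)[OF assms(1)] assms(3)
    by (simp add: geodesic_rayD(1))
qed

lemma equiv_asymptotic: "equiv {\<rho>. geodesic_ray X \<rho>} (asymptotic X)"
proof (rule equivI)
  show "asymptotic X \<subseteq> {\<rho>. geodesic_ray X \<rho>} \<times> {\<rho>. geodesic_ray X \<rho>}"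
    by (auto simp: asymptotic_def)
  show "refl_on {\<rho>. geodesic_ray X \<rho>} (asymptotic X)"
    by (auto simp: refl_on_def asymptotic_def geodesic_ray_def intro: exI[of _ 0])
  show "sym (asymptotic X)" by (auto simp: sym_def asymptotic_def mdist_commute)
  show "trans (asymptotic X)"
  proof (rule transI)
    fix a b c assume ab: "(a, b) \<in> asymptotic X" and bc: "(b, c) \<in> asymptotic X"
    have "d (a t) (c t) \<le> d (a 0) (b 0) + d (b 0) (c 0)" if "t \<ge> 0" for t
      using asymptoticD(3)[OF ab that] asymptoticD(3)[OF bc that]
        mdist_triangle[of "a t" X "b t" "c t"] geodesic_rayD(1)[OF asymptoticD(1)[OF ab] that]
        geodesic_rayD(1)[OF asymptoticD(2)[OF ab] that] geodesic_rayD(1)[OF asymptoticD(2)[OF bc] that]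
      by linarith
    then show "(a, c) \<in> asymptotic X" using asymptoticD[OF ab] asymptoticD[OF bc]
      by (auto simp: asymptotic_def)
  qed
qed

end

text \<open>The comparison of a vertex \<open>z\<close> with a point on the opposite side suffices: in the
Euclidean comparison triangle the squared distance is given by Stewart's identity. The triangle is
placed in the plane with \<open>x\<close> at the origin and \<open>y\<close> on the first
coordinate axis.\<close>

lemma CAT0_imp_cn:
  assumes "CAT0 X" shows "cn_space X"
proof
  fix x y l assume xy: "x \<in> mspace X" "y \<in> mspace X" and l: "0 \<le> l" "l \<le> (1::real)"
  let ?d = "mdist X"
  from assms have geo: "geodesic_space X" by (simp add: CAT0_def)
  then obtain g where g: "geodesic_segment X x y g" using xy by (auto simp: geodesic_space_def)
  let ?D = "?d x y"
  define w where "w = g (l * ?D)"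
  have lD: "l * ?D \<in> {0..?D}" using l by (auto simp: mult_left_le_one_le)
  have w: "w \<in> mspace X" using g lD by (auto simp: geodesic_segment_def w_def)
  show "\<exists>w\<in>mspace X. \<forall>z\<in>mspace X. (?d z w)\<^sup>2
      \<le> (1 - l) * (?d z x)\<^sup>2 + l * (?d z y)\<^sup>2 - l * (1 - l) * (?d x y)\<^sup>2"
  proof (intro bexI[OF _ w] ballI)
    fix z assume z: "z \<in> mspace X"
    obtain h where h: "geodesic_segment X x z h" using xy z geo by (auto simp: geodesic_space_def)
    let ?A = "?d x z" and ?B = "?d y z"
    have tri: "?D \<le> ?A + ?B" "?A \<le> ?D + ?B" "?B \<le> ?D + ?A"
      using mdist_triangle[of x X z y] mdist_triangle[of x X y z] mdist_triangle[of y X x z] xy z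
      by (simp_all add: mdist_commute)
    \<comment> \<open>First coordinate of the comparison point for \<open>z\<close>, by the law of
      cosines. For \<open>x = y\<close> the triangle is degenerate, and \<open>z\<close> is put on
      the coordinate axis.\<close>
    define a where "a = (if ?D = 0 then ?A else (?A\<^sup>2 + ?D\<^sup>2 - ?B\<^sup>2) / (2 * ?D))"
    have aD: "2 * a * ?D = ?A\<^sup>2 + ?D\<^sup>2 - ?B\<^sup>2"
      using tri by (auto simp: a_def)
    have "a\<^sup>2 \<le> ?A\<^sup>2"
    proof (cases "?D = 0")
      case False
      have "(2 * a * ?D)\<^sup>2 \<le> (2 * ?A * ?D)\<^sup>2"
      proof (rule abs_le_square_iff[THEN iffD1])
        have "2 * a * ?D \<le> 2 * ?A * ?D"
        proof -
          have "(?A - ?D)\<^sup>2 \<le> ?B\<^sup>2" using tri by (intro abs_le_square_iff[THEN iffD1]) auto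
          then show ?thesis unfolding aD by (simp add: power2_eq_square algebra_simps)
        qed
        moreover have "- (2 * a * ?D) \<le> 2 * ?A * ?D"
        proof -
          have "?B\<^sup>2 \<le> (?D + ?A)\<^sup>2" using tri by (intro power_mono) auto
          then show ?thesis unfolding aD by (simp add: power2_eq_square algebra_simps)
        qed
        moreover have "0 \<le> 2 * ?A * ?D" by simp
        ultimately show "\<bar>2 * a * ?D\<bar> \<le> \<bar>2 * ?A * ?D\<bar>" by linarith
      qed
      then show ?thesis using False by (simp add: power_mult_distrib)
    qed (simp add: a_def)
    define b where "b = sqrt (?A\<^sup>2 - a\<^sup>2)"
    have b2: "b\<^sup>2 = ?A\<^sup>2 - a\<^sup>2" using \<open>a\<^sup>2 \<le> ?A\<^sup>2\<close> by (simp add: b_def)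
    define V :: "real \<Rightarrow> real \<Rightarrow> real^2" where "V u v = vector [u, v]" for u v
    have dV: "dist (V u v) (V u' v') = sqrt ((u - u')\<^sup>2 + (v - v')\<^sup>2)" for u v u' v'
      by (simp add: V_def dist_vec_def L2_set_def UNIV_2 dist_real_def)
    let ?x = "V 0 0" and ?y = "V ?D 0" and ?z = "V a b" and ?p = "V (l * ?D) 0"
    have 1: "dist ?x ?y = ?D" by (simp add: dV)
    have 2: "dist ?x ?z = ?A" using b2 by (simp add: dV)
    have "(?D - a)\<^sup>2 + b\<^sup>2 = ?B\<^sup>2" using b2 aD by (simp add: power2_eq_square algebra_simps)
    then have 3: "dist ?y ?z = ?B" by (simp add: dV)
    have p: "?p \<in> closed_segment ?x ?y"
      unfolding closed_segment_def using l
      by (auto intro!: exI[of _ l] simp: V_def vec_eq_iff forall_2)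
    have 4: "dist ?x ?p = l * ?D" using l by (simp add: dV)
    have "mdist X (g (l * ?D)) (h ?A) \<le> dist ?p ?z"
    proof -
      have *: "\<And>s t p' q'. \<lbrakk>s\<in>{0..?D}; t\<in>{0..?A}; p'\<in>closed_segment ?x ?y; q'\<in>closed_segment ?x ?z;
          dist ?x p' = s; dist ?x q' = t\<rbrakk> \<Longrightarrow> mdist X (g s) (h t) \<le> dist p' q'"
        using assms[unfolded CAT0_def] g h 1 2 3 by blast
      show ?thesis by (rule *) (use lD p 4 2 in auto)
    qed
    moreover have "h ?A = z" using h by (simp add: geodesic_segment_def)
    ultimately have "?d z w \<le> dist ?p ?z" by (simp add: w_def mdist_commute)
    then have "(?d z w)\<^sup>2 \<le> (dist ?p ?z)\<^sup>2" by (intro power_mono) auto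
    also have "\<dots> = (l * ?D - a)\<^sup>2 + b\<^sup>2" by (simp add: dV)
    also have "\<dots> = l * l * ?D\<^sup>2 - l * (2 * a * ?D) + ?A\<^sup>2"
      using b2 by (simp add: power2_eq_square algebra_simps)
    also have "\<dots> = (1 - l) * (?d z x)\<^sup>2 + l * (?d z y)\<^sup>2 - l * (1 - l) * (?d x y)\<^sup>2"
      unfolding aD by (simp add: mdist_commute algebra_simps power2_eq_square)
    finally show "(?d z w)\<^sup>2 \<le> (1 - l) * (?d z x)\<^sup>2 + l * (?d z y)\<^sup>2 - l * (1 - l) * (?d x y)\<^sup>2" .
  qed
qed

lemma cn_space_product:
  fixes X :: "'i::finite \<Rightarrow> 'a metric"
  assumes "\<And>i. cn_space (X i)"
  shows "cn_space (product_metric X)"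
proof
  fix x y l assume xy: "x \<in> mspace (product_metric X)" "y \<in> mspace (product_metric X)"
    and l: "0 \<le> l" "l \<le> (1::real)"
  define w where "w i = cn_space.pt (X i) (x i) (y i) l" for i
  have xyi: "x i \<in> mspace (X i)" "y i \<in> mspace (X i)" for i
    using xy by (auto simp: mspace_product_metric PiE_iff)
  have w: "w \<in> mspace (product_metric X)"
    unfolding mspace_product_metric PiE_UNIV_domain w_def
    using cn_space.pt_in[OF assms] xyi l by auto
  show "\<exists>w\<in>mspace (product_metric X). \<forall>z\<in>mspace (product_metric X). (mdist (product_metric X) z w)\<^sup>2
      \<le> (1 - l) * (mdist (product_metric X) z x)\<^sup>2 + l * (mdist (product_metric X) z y)\<^sup>2
        - l * (1 - l) * (mdist (product_metric X) x y)\<^sup>2"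
  proof (intro bexI[OF _ w] ballI)
    fix z assume z: "z \<in> mspace (product_metric X)"
    have "(\<Sum>i\<in>UNIV. (mdist (X i) (z i) (w i))\<^sup>2) \<le> (\<Sum>i\<in>UNIV. (1 - l) * (mdist (X i) (z i) (x i))\<^sup>2
        + l * (mdist (X i) (z i) (y i))\<^sup>2 - l * (1 - l) * (mdist (X i) (x i) (y i))\<^sup>2)"
      using z xyi l by (intro sum_mono) (auto simp: w_def mspace_product_metric PiE_iff cn_space.pt_cn[OF assms])
    then show "(mdist (product_metric X) z w)\<^sup>2
      \<le> (1 - l) * (mdist (product_metric X) z x)\<^sup>2 + l * (mdist (product_metric X) z y)\<^sup>2
        - l * (1 - l) * (mdist (product_metric X) x y)\<^sup>2"
      by (simp add: mdist_product_metric sum_nonneg sum.distrib sum_subtractf sum_distrib_left)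
  qed
qed

section \<open>Proper spaces and limits of configurations\<close>

lemma (in Metric_space) eq_of_dist_le_0: "x \<in> M \<Longrightarrow> y \<in> M \<Longrightarrow> d x y \<le> 0 \<Longrightarrow> y = x"
  using zero[of x y] nonneg[of x y] by simp

text \<open>The theorem of Hopf and Rinow. The radii of compact balls about \<open>x\<close> form an interval.
Geodesics show that the ball of the supremal radius \<open>r0\<close> is totally bounded, because
its points are close to a smaller ball, and finitely many compact neighbourhoods of its points
cover a ball of radius larger than \<open>r0\<close>.\<close>

lemma (in cn_space) compactin_mcball:
  assumes complete: "mcomplete" and loc: "locally_compact_space mtopology" and x: "x \<in> M"
  shows "compactin mtopology (mcball x r)"
proof (rule ccontr)
  assume not_compact: "\<not> compactin mtopology (mcball x r)"
  define S where "S = {r. compactin mtopology (mcball x r)}"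
  have mono: "r \<in> S" if "r' \<in> S" "r \<le> r'" for r r'
  proof -
    have "mcball x r \<subseteq> mcball x r'" using that by auto
    with that show ?thesis unfolding S_def using closed_compactin[OF _ _ closedin_mcball] by blast
  qed
  have bd: "s \<le> r" if "s \<in> S" for s using that not_compact mono[of s r] by (force simp: S_def)
  have "mcball x 0 = {x}" using x eq_of_dist_le_0 by auto
  then have S0: "0 \<in> S" using x by (simp add: S_def)
  define r0 where "r0 = Sup S"
  have bdd: "bdd_above S" by (rule bdd_aboveI[of _ r]) (rule bd)
  have r0: "0 \<le> r0" unfolding r0_def using S0 bdd by (rule cSup_upper)
  have lt: "s \<in> S" if "s < r0" for s
    using less_cSup_iff[of S s] S0 bdd that mono unfolding r0_def by (auto intro: less_imp_le)
  have "mtotally_bounded (mcball x r0)" unfolding mtotally_bounded_def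
  proof (intro allI impI)
    fix e :: real assume e: "0 < e"
    show "\<exists>K. finite K \<and> K \<subseteq> mcball x r0 \<and> mcball x r0 \<subseteq> (\<Union>k\<in>K. mball k e)"
    proof (cases "r0 < e/2")
      case True
      then have "mcball x r0 \<subseteq> mball x e" using e by auto
      then show ?thesis using x r0 by (intro exI[of _ "{x}"]) auto
    next
      case False
      define s where "s = r0 - e/2"
      have s: "0 \<le> s" "s < r0" using False e by (auto simp: s_def)
      then have "mtotally_bounded (mcball x s)"
        using lt[of s] compactin_imp_mtotally_bounded by (simp add: S_def)
      then obtain K where K: "finite K" "K \<subseteq> mcball x s" "mcball x s \<subseteq> (\<Union>k\<in>K. mball k (e/2))"
        using e unfolding mtotally_bounded_def by (meson half_gt_zero)
      have "mcball x r0 \<subseteq> (\<Union>k\<in>K. mball k e)"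
      proof
        fix y assume y: "y \<in> mcball x r0"
        obtain y' where y': "y' \<in> mcball x s" "d y' y \<le> e/2"
        proof (cases "d x y \<le> s")
          case True then show thesis using y e by (intro that[of y]) auto
        next
          case False
          then show thesis using y s pt_at_dist[of x y s]
            by (intro that[of "pt x y (s / d x y)"]) (auto simp: s_def)
        qed
        then obtain k where k: "k \<in> K" "y' \<in> mball k (e/2)" using K by blast
        have "d k y \<le> d k y' + d y' y" using k y y' by (intro triangle) auto
        then have "y \<in> mball k e" using k y y' by auto
        then show "y \<in> (\<Union>k\<in>K. mball k e)" using k by blast
      qed
      moreover have "K \<subseteq> mcball x r0" using K s by force
      ultimately show ?thesis using K by blast
    qed
  qed
  then have cpt: "compactin mtopology (mcball x r0)"
    using mtotally_bounded_eq_compact_closure_of[OF complete] closure_of_closedin[OF closedin_mcball] by simp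
  have ex: "\<exists>s>0. compactin mtopology (mcball a s)" if "a \<in> M" for a
  proof -
    obtain U C where U: "openin mtopology U" "compactin mtopology C" "a \<in> U" "U \<subseteq> C"
      using loc \<open>a \<in> M\<close> by (auto simp: locally_compact_space_def)
    then obtain s where "s > 0" "mcball a s \<subseteq> U" unfolding openin_mtopology_mcball by blast
    then show ?thesis using U closed_compactin[OF U(2) _ closedin_mcball] by blast
  qed
  obtain s where s: "s a > 0" "compactin mtopology (mcball a (s a))" if "a \<in> M" for a
    using ex by metis
  define \<U> where "\<U> = (\<lambda>a. mball a (s a / 2)) ` mcball x r0"
  have "mcball x r0 \<subseteq> \<Union>\<U>" using s by (force simp: \<U>_def)
  moreover have "\<forall>U\<in>\<U>. openin mtopology U" by (auto simp: \<U>_def)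
  ultimately obtain \<F> where \<F>: "finite \<F>" "\<F> \<subseteq> \<U>" "mcball x r0 \<subseteq> \<Union>\<F>"
    using cpt unfolding compactin_def by meson
  obtain A where "A \<subseteq> mcball x r0" "finite A" "\<F> = (\<lambda>a. mball a (s a / 2)) ` A"
    using finite_subset_image[OF \<F>(1) \<F>(2)[unfolded \<U>_def]] by blast
  with \<F>(3) have A: "finite A" "A \<subseteq> mcball x r0" "mcball x r0 \<subseteq> (\<Union>a\<in>A. mball a (s a / 2))"
    by auto
  have "x \<in> mcball x r0" using x r0 by auto
  then have Ane: "A \<noteq> {}" using A by blast
  define \<delta> where "\<delta> = Min (s ` A) / 2"
  have AM: "A \<subseteq> M" using A(2) by auto
  have d1: "\<delta> > 0" using A(1) Ane AM s by (auto simp: \<delta>_def)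
  have d2: "\<delta> \<le> s a / 2" if "a \<in> A" for a using that A(1) by (simp add: \<delta>_def)
  have "mcball x (r0 + \<delta>) \<subseteq> (\<Union>a\<in>A. mcball a (s a))"
  proof
    fix y assume y: "y \<in> mcball x (r0 + \<delta>)"
    obtain y' where y': "y' \<in> mcball x r0" "d y' y \<le> \<delta>"
    proof (cases "d x y \<le> r0")
      case True then show thesis using y d1 by (intro that[of y]) auto
    next
      case False
      then show thesis using y r0 pt_at_dist[of x y r0]
        by (intro that[of "pt x y (r0 / d x y)"]) auto
    qed
    then obtain a where a: "a \<in> A" "y' \<in> mball a (s a / 2)" using A by blast
    have "d a y \<le> d a y' + d y' y" using a y y' by (intro triangle) auto
    then have "y \<in> mcball a (s a)" using a y y' d2[of a] by auto
    then show "y \<in> (\<Union>a\<in>A. mcball a (s a))" using a by blast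
  qed
  moreover have "compactin mtopology (\<Union>a\<in>A. mcball a (s a))"
    using A(1) AM s by (intro compactin_Union) auto
  ultimately have "r0 + \<delta> \<in> S" unfolding S_def
    using closed_compactin[OF _ _ closedin_mcball] by blast
  then have "r0 + \<delta> \<le> r0" unfolding r0_def using bdd by (rule cSup_upper)
  then show False using d1 by simp
qed

locale proper_cn_space = cn_space X for X :: "'a metric" +
  assumes proper: "x \<in> mspace X \<Longrightarrow> compactin (mtopology_of X) (mcball_of X x r)"

lemma (in proper_cn_space) compact_mcball: "x \<in> M \<Longrightarrow> compactin mtopology (mcball x r)"
  using proper by (simp add: mtopology_of_def mcball_of_def)

lemma proper_cn_space_hadamard:
  assumes "hadamard X" "locally_compact_space (mtopology_of X)"
  shows "proper_cn_space X"
proof -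
  interpret cn_space X using assms(1) by (intro CAT0_imp_cn) (simp add: hadamard_def)
  show ?thesis
    by unfold_locales
      (use compactin_mcball assms in \<open>auto simp: mtopology_of_def mcball_of_def mcomplete_of_def hadamard_def\<close>)
qed

lemma mspace_product_iff: "x \<in> mspace (product_metric X) \<longleftrightarrow> (\<forall>i. x i \<in> mspace (X i))"
  by (auto simp: mspace_product_metric PiE_UNIV_domain)

lemma mdist_component_le:
  fixes X :: "'i::finite \<Rightarrow> 'a metric"
  shows "mdist (X i) (x i) (y i) \<le> mdist (product_metric X) x y"
  unfolding mdist_product_metric by (intro real_le_rsqrt member_le_sum) auto

text \<open>A ball of the product lies in a product of balls, which is compact by Tychonoff's theorem,
provided that the product topology is fine enough; this is the content of the continuity of
\<open>id\<close>.\<close>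

lemma proper_cn_space_product:
  fixes X :: "'i::finite \<Rightarrow> 'a metric"
  assumes "\<And>i. proper_cn_space (X i)"
  shows "proper_cn_space (product_metric X)"
proof -
  interpret P: cn_space "product_metric X"
    using assms by (intro cn_space_product) (auto simp: proper_cn_space_def)
  let ?T = "product_topology (\<lambda>i. mtopology_of (X i)) UNIV"
  show ?thesis
  proof
    fix x r assume x: "x \<in> mspace (product_metric X)"
    then have xi: "x i \<in> mspace (X i)" for i by (auto simp: mspace_product_metric PiE_iff)
    have "compactin ?T (\<Pi>\<^sub>E i\<in>UNIV. mcball_of (X i) (x i) r)"
      unfolding compactin_PiE using proper_cn_space.proper[OF assms] xi by blast
    moreover have "continuous_map ?T P.mtopology id"
      unfolding P.continuous_map_to_metric
    proof (intro ballI allI impI)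
      fix y e assume y: "y \<in> topspace ?T" and e: "(e::real) > 0"
      \<comment> \<open>With distances below \<open>c\<close> in every factor the distance in the
        product is at most \<open>e / 2\<close>.\<close>
      define c where "c = e / (2 * sqrt (real CARD('i)))"
      have n: "real CARD('i) > 0" by simp
      then have c: "c > 0" using e by (simp add: c_def)
      have yi: "y i \<in> mspace (X i)" for i using y by (auto simp: PiE_iff)
      show "\<exists>U. openin ?T U \<and> y \<in> U \<and> (\<forall>z\<in>U. id z \<in> P.mball (id y) e)"
      proof (intro exI[of _ "\<Pi>\<^sub>E i\<in>UNIV. mball_of (X i) (y i) c"] conjI ballI)
        have "openin (mtopology_of (X i)) (mball_of (X i) (y i) c)" for i
          using Metric_space.openin_mball[OF Metric_space_mspace_mdist]
          by (simp add: mtopology_of_def mball_of_def)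
        then show "openin ?T (\<Pi>\<^sub>E i\<in>UNIV. mball_of (X i) (y i) c)"
          by (intro product_topology_basis) auto
        have "y i \<in> mball_of (X i) (y i) c" for i
          unfolding mball_of_def Metric_space.centre_in_mball_iff[OF Metric_space_mspace_mdist]
          using yi[of i] c by blast
        then show "y \<in> (\<Pi>\<^sub>E i\<in>UNIV. mball_of (X i) (y i) c)" by (simp add: PiE_UNIV_domain)
        fix z assume "z \<in> (\<Pi>\<^sub>E i\<in>UNIV. mball_of (X i) (y i) c)"
        then have z: "z i \<in> mspace (X i)" "mdist (X i) (y i) (z i) < c" for i by (auto simp: PiE_iff)
        have "(\<Sum>i\<in>UNIV. (mdist (X i) (y i) (z i))\<^sup>2) \<le> (\<Sum>i\<in>(UNIV::'i set). c\<^sup>2)"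
          using z by (intro sum_mono power_mono) (auto intro: less_imp_le)
        also have "\<dots> = (e/2)\<^sup>2" using n e by (simp add: c_def power_divide power_mult_distrib)
        finally have "mdist (product_metric X) y z \<le> e/2"
          unfolding mdist_product_metric using e by (intro real_le_lsqrt) (auto intro: sum_nonneg)
        moreover have "y \<in> mspace (product_metric X)" "z \<in> mspace (product_metric X)"
          using yi z(1) by (auto simp: mspace_product_iff)
        ultimately show "id z \<in> P.mball (id y) e" using e by simp
      qed
    qed
    ultimately have *: "compactin P.mtopology (\<Pi>\<^sub>E i\<in>UNIV. mcball_of (X i) (x i) r)"
      using image_compactin by fastforce
    have "P.mcball x r \<subseteq> (\<Pi>\<^sub>E i\<in>UNIV. mcball_of (X i) (x i) r)"
    proof
      fix z assume z: "z \<in> P.mcball x r"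
      have "mdist (X i) (x i) (z i) \<le> r" for i
        using mdist_component_le[of X i x z] z by simp
      moreover have "z i \<in> mspace (X i)" for i using z by (simp add: mspace_product_iff)
      ultimately show "z \<in> (\<Pi>\<^sub>E i\<in>UNIV. mcball_of (X i) (x i) r)"
        using xi by (simp add: PiE_UNIV_domain)
    qed
    then show "compactin (mtopology_of (product_metric X)) (mcball_of (product_metric X) x r)"
      using closed_compactin[OF * _ P.closedin_mcball] by (simp add: mtopology_of_def mcball_of_def)
  qed
qed

text \<open>Limits of sequences of configurations, where a configuration assigns points to all indices in the
possibly uncountable set \<open>J\<close>. By Tychonoff's theorem the sequence has a cluster point
in the product; it is approximated on finitely many indices at a time, at arbitrarily late stages.
As every statement about limits of distances concerns two indices only, no diagonal subsequences
are required.\<close>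

lemma (in Metric_space) cluster_family:
  fixes F :: "nat \<Rightarrow> 'j \<Rightarrow> 'a"
  assumes cpt: "\<And>j. j \<in> J \<Longrightarrow> compactin mtopology (K j)" and F: "\<And>n j. j \<in> J \<Longrightarrow> F n j \<in> K j"
  obtains f where "\<And>j. j \<in> J \<Longrightarrow> f j \<in> K j"
    "\<And>A e N. \<lbrakk>finite A; A \<subseteq> J; e > 0\<rbrakk> \<Longrightarrow> \<exists>n\<ge>N. \<forall>j\<in>A. d (f j) (F n j) < e"
proof -
  let ?T = "product_topology (\<lambda>_. mtopology) J" and ?P = "PiE J K"
  have KM: "K j \<subseteq> M" if "j \<in> J" for j using compactin_subset_topspace[OF cpt[OF that]] by simp
  have P: "compactin ?T ?P" using cpt by (simp add: compactin_PiE)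
  define near where "near f A e N \<longleftrightarrow> (\<exists>n\<ge>N. \<forall>j\<in>A. d (f j) (F n j) < e)" for f A N and e :: real
  have "\<exists>f\<in>?P. \<forall>A e N. finite A \<and> A \<subseteq> J \<and> e > 0 \<longrightarrow> near f A e N"
  proof (rule ccontr)
    assume "\<not> ?thesis"
    then have "\<exists>A e N. finite A \<and> A \<subseteq> J \<and> e > 0 \<and> \<not> near f A e N" if "f \<in> ?P" for f
      using that by metis
    then obtain A e N where *: "\<And>f. f \<in> ?P \<Longrightarrow> finite (A f) \<and> A f \<subseteq> J \<and> e f > 0
        \<and> \<not> near f (A f) (e f) (N f)" by metis
    \<comment> \<open>If no configuration were a cluster point, these neighbourhoods would cover
      the compact product, and finitely many of them would exclude all late members of the
      sequence.\<close>
    define U where "U f = (\<Pi>\<^sub>E j\<in>J. if j \<in> A f then mball (f j) (e f) else M)" for f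
    have "\<forall>V\<in>U ` ?P. openin ?T V"
    proof
      fix V assume "V \<in> U ` ?P"
      then obtain f where f: "f \<in> ?P" "V = U f" by auto
      show "openin ?T V" unfolding f(2) U_def
        using *[OF f(1)] by (intro product_topology_basis) (auto elim!: rev_finite_subset)
    qed
    moreover have "f \<in> U f" if f: "f \<in> ?P" for f
      using f *[OF f] KM by (fastforce simp: U_def PiE_iff)
    then have "?P \<subseteq> \<Union>(U ` ?P)" by auto
    ultimately obtain \<F> where \<F>: "finite \<F>" "\<F> \<subseteq> U ` ?P" "?P \<subseteq> \<Union>\<F>"
      using P unfolding compactin_def by meson
    obtain Q where "Q \<subseteq> ?P" "finite Q" "\<F> = U ` Q"
      using finite_subset_image[OF \<F>(1,2)] by blast
    with \<F>(3) have Q: "finite Q" "Q \<subseteq> ?P" "?P \<subseteq> (\<Union>f\<in>Q. U f)" by auto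
    define n where "n = Max (insert 0 (N ` Q))"
    have n: "N f \<le> n" if "f \<in> Q" for f using that Q by (simp add: n_def)
    have "restrict (F n) J \<in> ?P" using F by auto
    then obtain f where f: "f \<in> Q" "restrict (F n) J \<in> U f" using Q(3) by blast
    have "f \<in> ?P" using f Q by blast
    then obtain j where "j \<in> A f" "\<not> d (f j) (F n j) < e f"
      using *[of f] n[OF f(1)] unfolding near_def by blast
    moreover have "j \<in> J" using \<open>j \<in> A f\<close> *[OF \<open>f \<in> ?P\<close>] by blast
    ultimately show False using f by (auto simp: U_def PiE_iff split: if_splits)
  qed
  then obtain f where f: "f \<in> ?P" and cl: "\<And>A e N. \<lbrakk>finite A; A \<subseteq> J; e > 0\<rbrakk> \<Longrightarrow> near f A e N" by metis
  show thesis
  proof (rule that)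
    show "f j \<in> K j" if "j \<in> J" for j using f that by auto
    show "\<exists>n\<ge>N. \<forall>j\<in>A. d (f j) (F n j) < e" if "finite A" "A \<subseteq> J" "e > 0" for A e N
      using cl[OF that] by (simp add: near_def)
  qed
qed

lemma (in Metric_space) cluster_dist_le:
  assumes approx: "\<And>A e N. \<lbrakk>finite A; A \<subseteq> J; e > 0\<rbrakk> \<Longrightarrow> \<exists>n\<ge>N. \<forall>j\<in>A. d (f j) (F n j) < e"
    and in_M: "\<And>j. j \<in> J \<Longrightarrow> f j \<in> M" "\<And>n j. j \<in> J \<Longrightarrow> F n j \<in> M"
    and "j \<in> J" "k \<in> J" and ev: "\<forall>\<^sub>F n in sequentially. d (F n j) (F n k) \<le> B n" and lim: "B \<longlonglongrightarrow> b"
  shows "d (f j) (f k) \<le> b"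
proof (rule field_le_epsilon)
  fix e :: real assume e: "e > 0"
  have "\<forall>\<^sub>F n in sequentially. B n < b + e/2" using order_tendstoD(2)[OF lim, of "b + e/2"] e by simp
  with ev have "\<forall>\<^sub>F n in sequentially. d (F n j) (F n k) \<le> b + e/2" by eventually_elim simp
  then obtain N where N: "\<And>n. n \<ge> N \<Longrightarrow> d (F n j) (F n k) \<le> b + e/2" by (auto simp: eventually_sequentially)
  obtain n where n: "n \<ge> N" and "d (f j) (F n j) < e/4" "d (f k) (F n k) < e/4"
    using approx[of "{j, k}" "e/4" N] assms(4,5) e by auto
  moreover have "d (f j) (f k) \<le> d (f j) (F n j) + d (F n j) (F n k) + d (F n k) (f k)"
    using triangle[of "f j" "F n j" "f k"] triangle[of "F n j" "F n k" "f k"] in_M assms(4,5) by force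
  ultimately show "d (f j) (f k) \<le> b + e" using N[OF n] commute[of "F n k" "f k"] by linarith
qed

lemma (in Metric_space) cluster_dist_eq:
  assumes approx: "\<And>A e N. \<lbrakk>finite A; A \<subseteq> J; e > 0\<rbrakk> \<Longrightarrow> \<exists>n\<ge>N. \<forall>j\<in>A. d (f j) (F n j) < e"
    and in_M: "\<And>j. j \<in> J \<Longrightarrow> f j \<in> M" "\<And>n j. j \<in> J \<Longrightarrow> F n j \<in> M"
    and "j \<in> J" "k \<in> J" and ev: "\<forall>\<^sub>F n in sequentially. d (F n j) (F n k) = b"
  shows "d (f j) (f k) = b"
proof (rule antisym)
  show "d (f j) (f k) \<le> b"
    by (rule cluster_dist_le[OF approx in_M assms(4,5) _ tendsto_const])
      (use ev in \<open>auto elim: eventually_mono\<close>)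
  show "b \<le> d (f j) (f k)"
  proof (rule field_le_epsilon)
    fix e :: real assume e: "e > 0"
    from ev obtain N where N: "\<And>n. n \<ge> N \<Longrightarrow> d (F n j) (F n k) = b" by (auto simp: eventually_sequentially)
    obtain n where n: "n \<ge> N" and "d (f j) (F n j) < e/4" "d (f k) (F n k) < e/4"
      using approx[of "{j, k}" "e/4" N] assms(4,5) e by auto
    moreover have "d (F n j) (F n k) \<le> d (F n j) (f j) + d (f j) (f k) + d (f k) (F n k)"
      using triangle[of "F n j" "f j" "F n k"] triangle[of "f j" "f k" "F n k"] in_M assms(4,5) by force
    ultimately show "b \<le> d (f j) (f k) + e" using N[OF n] commute[of "F n j" "f j"] e by linarith
  qed
qed

text \<open>The geodesics from \<open>x\<close> to the points \<open>\<rho> n\<close> stay within bounded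
distance of \<open>\<rho>\<close>, and a limit of them is a ray.\<close>

lemma (in proper_cn_space) asymptotic_ray_from:
  assumes \<rho>: "geodesic_ray X \<rho>" and x: "x \<in> M"
  obtains \<rho>' where "(\<rho>', \<rho>) \<in> asymptotic X" "\<rho>' 0 = x"
proof -
  define C where "C = d x (\<rho> 0)"
  define D where "D n = d x (\<rho> (real n))" for n
  \<comment> \<open>The geodesic from \<open>x\<close> to \<open>\<rho> n\<close> by arc length;
    after its end, the value \<open>x\<close> keeps \<open>F n t\<close> in the compact ball of
    radius \<open>t\<close>.\<close>
  define F where "F n t = (if t \<le> D n then pt x (\<rho> (real n)) (t / D n) else x)" for n t
  have \<rho>in: "\<rho> t \<in> M" if "t \<ge> 0" for t using geodesic_rayD(1)[OF \<rho> that] .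
  have D0: "0 \<le> D n" for n by (simp add: D_def)
  have Dn: "\<bar>D n - real n\<bar> \<le> C" for n
    using mdist_reverse_triangle[of x "\<rho> (real n)" "\<rho> 0"] geodesic_rayD(2)[OF \<rho>, of n 0] x \<rho>in
    by (simp add: D_def C_def)
  have F: "F n t \<in> mcball x t" if t: "t \<in> {0..}" for n t
  proof (cases "t \<le> D n")
    case True
    have l: "0 \<le> t / D n" "t / D n \<le> 1" using t True D0[of n] by (auto simp: divide_le_eq)
    have "d x (F n t) = t / D n * D n"
      using True pt_dist1[OF x \<rho>in l, of n] by (simp add: F_def D_def)
    also have "\<dots> \<le> t" using t by auto
    finally show ?thesis using True pt_in[OF x \<rho>in l, of n] x by (simp add: F_def)
  qed (use x t in \<open>simp add: F_def\<close>)
  obtain f where f: "\<And>t. t \<in> {0..} \<Longrightarrow> f t \<in> mcball x t"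
    and approx: "\<And>A e N. \<lbrakk>finite A; A \<subseteq> {0..}; e > 0\<rbrakk> \<Longrightarrow> \<exists>n\<ge>N. \<forall>j\<in>A. d (f j) (F n j) < e"
    by (rule cluster_family[of "{0..}" "mcball x" F]) (use compact_mcball[OF x] F in auto)
  have fM: "f t \<in> M" if "t \<in> {0..}" for t using f[OF that] by simp
  have FM: "F n t \<in> M" if "t \<in> {0..}" for n t using F[OF that] by simp
  have large: "\<forall>\<^sub>F n in sequentially. t \<le> D n \<and> 0 < D n \<and> t \<le> real n \<and> 0 < n" for t
    using eventually_ge_at_top[of "nat \<lceil>C + \<bar>t\<bar> + 1\<rceil>"]
  proof eventually_elim
    case (elim n)
    then have n: "C + \<bar>t\<bar> + 1 \<le> real n" by linarith
    moreover have C: "0 \<le> C" by (simp add: C_def)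
    ultimately have "0 < real n" by linarith
    moreover have "t \<le> D n" "0 < D n" "t \<le> real n" using n C Dn[of n] by linarith+
    ultimately show ?case by simp
  qed
  have "d (f s) (f t) = \<bar>s - t\<bar>" if st: "s \<ge> 0" "t \<ge> 0" for s t
  proof (rule cluster_dist_eq[OF approx fM FM])
    show "\<forall>\<^sub>F n in sequentially. d (F n s) (F n t) = \<bar>s - t\<bar>"
      using large[of s] large[of t]
    proof eventually_elim
      case (elim n)
      then have "d (F n s) (F n t) = \<bar>s / D n - t / D n\<bar> * D n"
        using dist_same_segment[of x "\<rho> (real n)" "s / D n" "t / D n"] st x \<rho>in
        by (simp add: F_def D_def)
      also have "\<dots> = \<bar>s - t\<bar>" using elim
        by (simp add: diff_divide_distrib[symmetric] abs_divide)
      finally show ?case .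
    qed
  qed (use st in auto)
  then have ray: "geodesic_ray X f" unfolding geodesic_ray_def using fM by auto
  have "d (f t) (\<rho> t) \<le> 2 * C + 1" if t: "t \<ge> 0" for t
  proof -
    obtain N where N: "\<And>n. n \<ge> N \<Longrightarrow> t \<le> D n \<and> 0 < D n \<and> t \<le> real n \<and> 0 < n"
      using large[of t] by (auto simp: eventually_sequentially)
    obtain n where n: "n \<ge> N" "d (f t) (F n t) < 1" using approx[of "{t}" 1 N] t by auto
    note N = N[OF n(1)]
    \<comment> \<open>Proportional and unit speed parametrisation differ by a bounded amount,
      since \<open>D n\<close> differs from \<open>n\<close> by at most \<open>C\<close>.\<close>
    let ?u = "pt x (\<rho> (real n)) (t / real n)"
    have u: "?u \<in> M" using t N x \<rho>in by (intro pt_in) auto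
    have "d (F n t) ?u = \<bar>t / D n - t / n\<bar> * D n"
      using dist_same_segment[of x "\<rho> (real n)" "t / D n" "t / n"] t N x \<rho>in by (simp add: F_def D_def)
    also have "\<dots> = (t / n) * \<bar>D n - n\<bar>"
    proof -
      have "(t / D n - t / n) * D n = (t / n) * (n - D n)" using N by (simp add: field_simps)
      then have "\<bar>(t / D n - t / n) * D n\<bar> = \<bar>(t / n) * (n - D n)\<bar>" by simp
      then show ?thesis using t N by (simp add: abs_mult abs_minus_commute)
    qed
    also have "\<dots> \<le> 1 * C" using t N Dn[of n] by (intro mult_mono) auto
    finally have 1: "d (F n t) ?u \<le> C" by simp
    have "d ?u (\<rho> t) \<le> (1 - t/n) * C"
      using dist_pt_common_end[of "\<rho> (real n)" x "\<rho> 0" "t / n"] ray_point[OF \<rho>, of t n] t N x \<rho>in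
      by (simp add: C_def)
    also have "\<dots> \<le> C" using t N by (simp add: C_def mult_left_le_one_le)
    finally have "d ?u (\<rho> t) \<le> C" .
    moreover have "d (f t) (\<rho> t) \<le> d (f t) (F n t) + d (F n t) ?u + d ?u (\<rho> t)"
      using triangle[of "f t" "F n t" "\<rho> t"] triangle[of "F n t" ?u "\<rho> t"] fM[of t] FM[of t n] t u \<rho>in by force
    ultimately show ?thesis using 1 n by linarith
  qed
  then have "(f, \<rho>) \<in> asymptotic X" using ray \<rho> by (auto simp: asymptotic_def)
  moreover have "f 0 = x" using f[of 0] eq_of_dist_le_0[of x "f 0"] by simp
  ultimately show thesis by (rule that)
qed

section \<open>Flat half-planes\<close>

lemma convex_three_points:
  fixes f :: "real \<Rightarrow> real"
  assumes "convex_on UNIV f" "x \<le> y" "y \<le> z"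
  shows "(z - x) * f y \<le> (z - y) * f x + (y - x) * f z"
proof (cases "x = z")
  case False
  define t where "t = (y - x) / (z - x)"
  have pos: "z - x > 0" using False assms by simp
  have t: "0 \<le> t" "t \<le> 1" using assms pos by (auto simp: t_def)
  have tz: "t * (z - x) = y - x" using pos by (simp add: t_def)
  have "(1 - t) * x + t * z = x + t * (z - x)" by (simp add: algebra_simps)
  then have "(1 - t) * x + t * z = y" unfolding tz by simp
  then have "f y \<le> (1 - t) * f x + t * f z"
    using convex_onD[OF assms(1) t, of x z] by simp
  then have "(z - x) * f y \<le> (z - x) * ((1 - t) * f x + t * f z)" using pos by simp
  also have "\<dots> = ((z - x) - t * (z - x)) * f x + t * (z - x) * f z" by (simp add: algebra_simps)
  finally show ?thesis unfolding tz by simp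
qed (use assms in simp)

lemma convex_slope_mono:
  fixes f :: "real \<Rightarrow> real"
  assumes "convex_on UNIV f" "a < b" "b \<le> c" "c < e"
  shows "(f b - f a) / (b - a) \<le> (f e - f c) / (e - c)"
proof -
  have *: "(f y - f x) / (y - x) \<le> (f z - f y) / (z - y)" if "x < y" "y < z" for x y z
  proof -
    have "(f y - f x) * (z - y) \<le> (f z - f y) * (y - x)"
      using convex_three_points[OF assms(1), of x y z] that by (simp add: algebra_simps)
    then show ?thesis using that by (simp add: pos_divide_le_eq pos_le_divide_eq)
  qed
  show ?thesis
  proof (cases "b = c")
    case False
    then show ?thesis using *[of a b c] *[of b c e] assms by linarith
  qed (use * assms in auto)
qed

text \<open>Slopes of a convex function increase. If the slope between \<open>s\<close> and \<open>e\<close>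
were larger than \<open>- \<kappa>\<close>, then all slopes between \<open>e\<close> and the
minimum \<open>m\<close> would lie between \<open>- \<kappa>\<close> and \<open>0\<close>,
contrary to the assumption on \<open>{e..m}\<close>.\<close>

lemma convex_steep_before:
  fixes f :: "real \<Rightarrow> real"
  assumes cvx: "convex_on UNIV f" and min: "\<And>t. f m \<le> f t"
    and steep: "\<not> (\<forall>s\<in>{e..m}. \<forall>t\<in>{e..m}. \<bar>f s - f t\<bar> \<le> \<kappa> * \<bar>s - t\<bar>)"
    and "s \<le> e" "0 \<le> \<kappa>"
  shows "f e + \<kappa> * (e - s) \<le> f s"
proof (rule ccontr)
  assume not: "\<not> ?thesis"
  then have se: "s < e" using assms(4) by (cases "s = e") auto
  have lip: "\<bar>f u - f w\<bar> \<le> \<kappa> * \<bar>u - w\<bar>" if "e \<le> u" "u < w" "w \<le> m" for u w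
  proof -
    have "f w \<le> f u"
    proof (cases "w = m")
      case False
      have "(f w - f u) / (w - u) \<le> (f m - f w) / (m - w)"
        using False that by (intro convex_slope_mono[OF cvx]) auto
      also have "\<dots> \<le> 0" using min[of w] that False by (intro divide_nonpos_pos) auto
      finally show ?thesis using that by (simp add: divide_le_0_iff)
    qed (use min in auto)
    moreover have "(f e - f s) / (e - s) \<le> (f w - f u) / (w - u)"
      using se that by (intro convex_slope_mono[OF cvx]) auto
    moreover have "- \<kappa> \<le> (f e - f s) / (e - s)"
      using not se by (simp add: pos_le_divide_eq algebra_simps)
    ultimately have "- \<kappa> \<le> (f w - f u) / (w - u)" "f w \<le> f u" by linarith+
    then have "- \<kappa> * (w - u) \<le> f w - f u" using that by (simp add: pos_le_divide_eq)
    then show ?thesis using \<open>f w \<le> f u\<close> that by (simp add: algebra_simps)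
  qed
  have "\<bar>f u - f w\<bar> \<le> \<kappa> * \<bar>u - w\<bar>" if "u \<in> {e..m}" "w \<in> {e..m}" for u w
    using lip[of u w] lip[of w u] that
    by (cases u w rule: linorder_cases) (auto simp: abs_minus_commute)
  with steep show False by blast
qed

lemma (in cn_space) geodesic_lineD:
  assumes "geodesic_line X \<sigma>" shows "\<sigma> t \<in> M" "d (\<sigma> s) (\<sigma> t) = \<bar>s - t\<bar>"
  using assms by (auto simp: geodesic_line_def)

lemma (in cn_space) line_point:
  assumes "geodesic_line X \<sigma>" "0 \<le> l" "l \<le> 1"
  shows "\<sigma> ((1-l) * a + l * b) = pt (\<sigma> a) (\<sigma> b) l"
proof -
  have "(1-l) * a + l * b - a = l * (b - a)" "b - ((1-l) * a + l * b) = (1-l) * (b-a)"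
    by (simp_all add: algebra_simps)
  then have "\<bar>(1-l) * a + l * b - a\<bar> = l * \<bar>b - a\<bar>" "\<bar>b - ((1-l) * a + l * b)\<bar> = (1-l) * \<bar>b-a\<bar>"
    using assms(2,3) by (simp_all only: abs_mult)
  then show ?thesis
    using geodesic_lineD[OF assms(1)] assms(2,3)
    by (intro pt_unique) (simp_all add: abs_minus_commute)
qed

lemma (in cn_space) convex_dist_line:
  assumes "geodesic_line X \<sigma>" "z \<in> M"
  shows "convex_on UNIV (\<lambda>t. d z (\<sigma> t))"
proof (rule convex_onI)
  fix t x y :: real assume "0 < t" "t < 1"
  then show "d z (\<sigma> ((1 - t) *\<^sub>R x + t *\<^sub>R y)) \<le> (1 - t) * d z (\<sigma> x) + t * d z (\<sigma> y)"
    using line_point[OF assms(1), of t x y] pt_convex[of "\<sigma> x" "\<sigma> y" t z] geodesic_lineD[OF assms(1)] assms(2)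
    by simp
qed simp

text \<open>If the points \<open>y n\<close> diverge and their normalised distance functions converge on the
line \<open>\<sigma>\<close> to a linear function of slope \<open>\<kappa>\<close>, then the
geodesics from \<open>\<sigma> s\<close> to \<open>y n\<close> converge to rays that should be
parallel and meet \<open>\<sigma>\<close> at the angle with cosine \<open>- \<kappa>\<close>. Let
\<open>f (s, v)\<close> be the point at height \<open>v\<close> on the limit ray from
\<open>\<sigma> s\<close>. In the Euclidean model the squared distance of two such points is the
quadratic form \<open>Q\<close> of the differences of their coordinates. That it is at most this
is a limit of the Bruhat-Tits inequality. On the line itself equality holds: the points at
parameters \<open>s'\<close> and \<open>2 * s - s'\<close> have the midpoint \<open>\<sigma>
s\<close>, whose distance from \<open>f (s, v)\<close> is \<open>v\<close> by construction, and
the inequality for this midpoint makes both upper bounds sharp. For two points of different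
heights, the Euclidean line through them hits \<open>\<sigma>\<close>, and the known distances to
the point of intersection give the lower bound by the triangle inequality. Equal heights follow by
continuity, and a linear change of coordinates turns \<open>Q\<close> into the Euclidean form.\<close>

lemma (in proper_cn_space) half_plane_of_linear_horofunction:
  assumes \<sigma>: "geodesic_line X \<sigma>" and y: "\<And>n. y n \<in> M"
    and lim: "\<And>s. (\<lambda>n. d (\<sigma> s) (y n) - d (\<sigma> 0) (y n)) \<longlonglongrightarrow> \<kappa> * s"
    and inf: "filterlim (\<lambda>n. d (\<sigma> 0) (y n)) at_top sequentially" and \<kappa>: "\<bar>\<kappa>\<bar> < 1"
  shows "bounds_flat_half_plane X \<sigma>"
proof -
  note \<sigma>in = geodesic_lineD(1)[OF \<sigma>] and \<sigma>d = geodesic_lineD(2)[OF \<sigma>]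
  define A where "A s n = d (\<sigma> s) (y n)" for s n
  define Q where "Q a b = a\<^sup>2 - 2 * \<kappa> * a * b + b\<^sup>2" for a b :: real
  have \<kappa>2: "\<kappa>\<^sup>2 < 1" using \<kappa> by (simp add: abs_square_less_1)
  have Q0: "0 \<le> Q a b" for a b
  proof -
    have "Q a b = (a - \<kappa> * b)\<^sup>2 + (1 - \<kappa>\<^sup>2) * b\<^sup>2" by (simp add: Q_def power2_eq_square algebra_simps)
    then show ?thesis using \<kappa>2 by simp
  qed
  have Qscale: "Q (c * a) (c * b) = c\<^sup>2 * Q a b" for a b c
    by (simp add: Q_def power2_eq_square algebra_simps)
  have Qsym: "Q (a - a') (b - b') = Q (a' - a) (b' - b)" for a b a' b'
    by (simp add: Q_def power2_eq_square algebra_simps)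
  \<comment> \<open>The point at distance \<open>v\<close> from \<open>\<sigma> s\<close> on the
    geodesic to \<open>y n\<close>, for \<open>p = (s, v)\<close>; beyond \<open>y n\<close> the
    value \<open>\<sigma> s\<close> keeps it in the compact ball of radius \<open>v\<close> about
    \<open>\<sigma> s\<close>.\<close>
  define F where "F n p = (if snd p \<le> A (fst p) n then pt (\<sigma> (fst p)) (y n) (snd p / A (fst p) n) else \<sigma> (fst p))"
    for n p
  let ?J = "UNIV \<times> {0..} :: (real \<times> real) set"
  have Alim: "(\<lambda>n. A s n - A s' n) \<longlonglongrightarrow> \<kappa> * (s - s')" for s s'
    using tendsto_diff[OF lim[of s] lim[of s']] by (simp add: A_def right_diff_distrib)
  have Ainf: "filterlim (A s) at_top sequentially" for s
    using filterlim_tendsto_add_at_top[OF lim[of s] inf] by (simp add: A_def[abs_def])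
  have quot: "(\<lambda>n. v n / A s n) \<longlonglongrightarrow> 0" if "v \<longlonglongrightarrow> c" for v :: "nat \<Rightarrow> real" and c s
    using that by (rule tendsto_divide_0) (rule filterlim_at_top_imp_at_infinity[OF Ainf])
  have ev: "\<forall>\<^sub>F n in sequentially. v \<le> A s n \<and> 0 < A s n" for v s
    using Ainf[of s, unfolded filterlim_at_top_dense, rule_format, of "max v 0"]
    by (auto elim: eventually_mono)
  have Fv: "F n (s, v) = pt (\<sigma> s) (y n) (v / A s n)" "F n (s, v) \<in> M"
    "d (\<sigma> s) (F n (s, v)) = v" "d (F n (s, v)) (y n) = A s n - v" if "0 \<le> v" "v \<le> A s n" for n s v
    using pt_at_dist[OF \<sigma>in[of s] y[of n] that(1) that(2)[unfolded A_def]] that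
    by (auto simp: F_def A_def)
  have Fball: "F n j \<in> mcball (\<sigma> (fst j)) (snd j)" if "j \<in> ?J" for n j
    using that Fv[of "snd j" "fst j" n] \<sigma>in[of "fst j"] by (cases "snd j \<le> A (fst j) n") (auto simp: F_def)
  obtain f where f: "\<And>j. j \<in> ?J \<Longrightarrow> f j \<in> mcball (\<sigma> (fst j)) (snd j)"
    and approx: "\<And>B e N. \<lbrakk>finite B; B \<subseteq> ?J; e > 0\<rbrakk> \<Longrightarrow> \<exists>n\<ge>N. \<forall>j\<in>B. d (f j) (F n j) < e"
    by (rule cluster_family[of ?J "\<lambda>j. mcball (\<sigma> (fst j)) (snd j)" F]) (use compact_mcball \<sigma>in Fball in auto)
  have fM: "f j \<in> M" if "j \<in> ?J" for j using f[OF that] by simp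
  have FM: "F n j \<in> M" if "j \<in> ?J" for n j using Fball[OF that, of n] by simp
  note cl_le = cluster_dist_le[where F = F and J = ?J and f = f, OF approx fM FM]
    and cl_eq = cluster_dist_eq[where F = F and J = ?J and f = f, OF approx fM FM]
  have F0: "F n (s, 0) = \<sigma> s" for n s
    using Fv(1)[of 0 s n] \<sigma>in y by (simp add: A_def)
  have f0: "f (s, 0) = \<sigma> s" for s using f[of "(s, 0)"] eq_of_dist_le_0[of "\<sigma> s" "f (s, 0)"] by simp
  \<comment> \<open>Upper bound for the squared distance from a point of the configuration to
    \<open>\<sigma> s'\<close>, arranged so that its limit can be read off although \<open>A s
    n\<close> diverges.\<close>
  define B where "B s v s' n = (1 - v / A s n) * (s - s')\<^sup>2
      + v * (A s' n - A s n) * (2 + (A s' n - A s n) / A s n) + v\<^sup>2" for s v s' n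
  have FB: "(d (F n (s, v)) (\<sigma> s'))\<^sup>2 \<le> B s v s' n" if v: "0 \<le> v" "v \<le> A s n \<and> 0 < A s n" for s v s' n
  proof -
    let ?a = "A s n" and ?a' = "A s' n"
    have "(d (\<sigma> s') (F n (s, v)))\<^sup>2 \<le> (1 - v/?a) * (d (\<sigma> s') (\<sigma> s))\<^sup>2 + v/?a * ?a'\<^sup>2 - v/?a * (1 - v/?a) * ?a\<^sup>2"
      unfolding Fv(1)[OF v(1) conjunct1[OF v(2)]]
      using pt_cn[of "\<sigma> s" "y n" "v/?a" "\<sigma> s'"] v \<sigma>in y by (auto simp: A_def divide_le_eq)
    also have "(d (\<sigma> s') (\<sigma> s))\<^sup>2 = (s - s')\<^sup>2" by (simp add: \<sigma>d power2_commute)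
    also have "(1 - v/?a) * (s - s')\<^sup>2 + v/?a * ?a'\<^sup>2 - v/?a * (1 - v/?a) * ?a\<^sup>2 = B s v s' n"
    proof -
      have "v/?a * ?a'\<^sup>2 - v/?a * (1 - v/?a) * ?a\<^sup>2 = v * (?a' - ?a) * (2 + (?a' - ?a) / ?a) + v\<^sup>2"
        using v by (simp add: field_simps power2_eq_square)
      then show ?thesis by (simp add: B_def)
    qed
    finally show ?thesis by (simp add: mdist_commute)
  qed
  have Blim: "B s v s' \<longlonglongrightarrow> Q (s' - s) (0 - v)" if "0 \<le> v" for s v s'
  proof -
    have "B s v s' \<longlonglongrightarrow> (1 - 0) * (s - s')\<^sup>2 + v * (\<kappa> * (s' - s)) * (2 + 0) + v\<^sup>2"
      unfolding B_def by (intro tendsto_intros quot[OF tendsto_const] quot[OF Alim] Alim)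
    also have "(1 - 0) * (s - s')\<^sup>2 + v * (\<kappa> * (s' - s)) * (2 + 0) + v\<^sup>2 = Q (s' - s) (0 - v)"
      by (simp add: Q_def power2_eq_square algebra_simps)
    finally show ?thesis .
  qed
  have base_le: "d (f (s, v)) (\<sigma> s') \<le> sqrt (Q (s' - s) (0 - v))" if v: "0 \<le> v" for s v s'
  proof -
    have "d (f (s, v)) (f (s', 0)) \<le> sqrt (Q (s' - s) (0 - v))"
    proof (rule cl_le)
      show "\<forall>\<^sub>F n in sequentially. d (F n (s, v)) (F n (s', 0)) \<le> sqrt (B s v s' n)"
        using ev[of v s] by eventually_elim (use FB v F0 in \<open>auto intro!: real_le_rsqrt\<close>)
      show "(\<lambda>n. sqrt (B s v s' n)) \<longlonglongrightarrow> sqrt (Q (s' - s) (0 - v))"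
        by (intro tendsto_real_sqrt Blim v)
    qed (use v in auto)
    then show ?thesis by (simp add: f0)
  qed
  have own: "d (f (s, v)) (\<sigma> s) = v" if v: "0 \<le> v" for s v
  proof -
    have "d (f (s, v)) (f (s, 0)) = v"
    proof (rule cl_eq)
      show "\<forall>\<^sub>F n in sequentially. d (F n (s, v)) (F n (s, 0)) = v"
        using ev[of v s] by eventually_elim (use Fv(3) F0 v in \<open>auto simp: mdist_commute\<close>)
    qed (use v in auto)
    then show ?thesis by (simp add: f0)
  qed
  have base: "d (f (s, v)) (\<sigma> s') = sqrt (Q (s' - s) (0 - v))" if v: "0 \<le> v" for s v s'
  proof (rule antisym[OF base_le[OF v]])
    \<comment> \<open>\<open>\<sigma> s\<close> is the midpoint of \<open>\<sigma> s'\<close> and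
      its reflection in \<open>s\<close>.\<close>
    let ?w = "f (s, v)" and ?s'' = "2 * s - s'"
    have w: "?w \<in> M" using fM v by auto
    have "(1 - 1/2) * s' + 1/2 * ?s'' = s" by (simp add: field_simps)
    then have mid: "pt (\<sigma> s') (\<sigma> ?s'') (1/2) = \<sigma> s" using line_point[OF \<sigma>, of "1/2" s' ?s''] by simp
    have "v\<^sup>2 \<le> (d ?w (\<sigma> s'))\<^sup>2 / 2 + (d ?w (\<sigma> ?s''))\<^sup>2 / 2 - (d (\<sigma> s') (\<sigma> ?s''))\<^sup>2 / 4"
      using pt_cn[of "\<sigma> s'" "\<sigma> ?s''" "1/2" ?w, unfolded mid] \<sigma>in w own[OF v, of s] by simp
    moreover have "(d (\<sigma> s') (\<sigma> ?s''))\<^sup>2 = 4 * (s - s')\<^sup>2"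
      unfolding \<sigma>d by (simp add: power2_eq_square algebra_simps)
    moreover have "(d ?w (\<sigma> ?s''))\<^sup>2 \<le> Q (s - s') (0 - v)"
    proof -
      have "(d ?w (\<sigma> ?s''))\<^sup>2 \<le> (sqrt (Q (?s'' - s) (0 - v)))\<^sup>2"
        using base_le[OF v, of s ?s''] by (intro power_mono) auto
      then show ?thesis using Q0 by simp
    qed
    ultimately have "Q (s' - s) (0 - v) \<le> (d ?w (\<sigma> s'))\<^sup>2"
      by (simp add: Q_def power2_eq_square algebra_simps)
    then show "sqrt (Q (s' - s) (0 - v)) \<le> d ?w (\<sigma> s')" by (intro real_le_lsqrt) auto
  qed
  have upper: "d (f (s, v)) (f (s', v')) \<le> sqrt (Q (s' - s) (v' - v))" if v: "0 \<le> v" "0 \<le> v'" for s v s' v'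
  proof (rule cl_le)
    define C where "C n = (1 - v' / A s' n) * B s v s' n
      + v' * (A s n - A s' n - v) * (2 + (A s n - A s' n - v) / A s' n) + v'\<^sup>2" for n
    have "C \<longlonglongrightarrow> (1 - 0) * Q (s' - s) (0 - v) + v' * (\<kappa> * (s - s') - v) * (2 + 0) + v'\<^sup>2"
      unfolding C_def by (intro tendsto_intros quot[OF tendsto_const] quot[OF tendsto_diff[OF Alim tendsto_const]] Alim Blim v)
    also have "(1 - 0) * Q (s' - s) (0 - v) + v' * (\<kappa> * (s - s') - v) * (2 + 0) + v'\<^sup>2 = Q (s' - s) (v' - v)"
      by (simp add: Q_def power2_eq_square algebra_simps)
    finally show "(\<lambda>n. sqrt (C n)) \<longlonglongrightarrow> sqrt (Q (s' - s) (v' - v))" by (rule tendsto_real_sqrt)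
    show "\<forall>\<^sub>F n in sequentially. d (F n (s, v)) (F n (s', v')) \<le> sqrt (C n)"
      using ev[of v s] ev[of v' s']
    proof eventually_elim
      case (elim n)
      let ?a = "A s n" and ?a' = "A s' n" and ?w = "F n (s, v)" and ?l = "v' / A s' n"
      have l: "0 \<le> ?l" "?l \<le> 1" using elim v by (auto simp: divide_le_eq)
      have "(d ?w (F n (s', v')))\<^sup>2 \<le> (1 - ?l) * (d ?w (\<sigma> s'))\<^sup>2 + ?l * (?a - v)\<^sup>2 - ?l * (1 - ?l) * ?a'\<^sup>2"
        unfolding Fv(1)[OF v(2) conjunct1[OF elim(2)]]
        using pt_cn[of "\<sigma> s'" "y n" ?l ?w] l \<sigma>in y Fv(2,4)[of v s n] v elim by (simp add: A_def)
      also have "\<dots> \<le> (1 - ?l) * B s v s' n + ?l * (?a - v)\<^sup>2 - ?l * (1 - ?l) * ?a'\<^sup>2"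
        using FB[of v s n s'] v elim l by (intro diff_right_mono add_right_mono mult_left_mono) auto
      also have "\<dots> = C n"
      proof -
        have "?l * (?a - v)\<^sup>2 - ?l * (1 - ?l) * ?a'\<^sup>2 = v' * (?a - ?a' - v) * (2 + (?a - ?a' - v) / ?a') + v'\<^sup>2"
          using elim by (simp add: field_simps power2_eq_square)
        then show ?thesis by (simp add: C_def)
      qed
      finally show ?case by (rule real_le_rsqrt)
    qed
  qed (use v in auto)
  have eq_less: "d (f (s, v)) (f (s', v')) = sqrt (Q (s' - s) (v' - v))" if v: "0 \<le> v" "v < v'" for s v s' v'
  proof (rule antisym[OF upper])
    define t where "t = v / (v' - v)"
    \<comment> \<open>In coordinates, the line through \<open>(s, v)\<close> and \<open>(s',
      v')\<close> meets height \<open>0\<close> at \<open>s0\<close>.\<close>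
    define s0 where "s0 = s - t * (s' - s)"
    have t: "0 \<le> t" "t * (v' - v) = v" using v by (auto simp: t_def)
    have "s0 - s' = - (1 + t) * (s' - s)" "0 - v' = - (1 + t) * (v' - v)"
      using t(2) by (auto simp: s0_def algebra_simps)
    then have 1: "Q (s0 - s') (0 - v') = (1 + t)\<^sup>2 * Q (s' - s) (v' - v)" by (simp only: Qscale power2_minus)
    have "s0 - s = - t * (s' - s)" "0 - v = - t * (v' - v)"
      using t(2) by (auto simp: s0_def algebra_simps)
    then have 2: "Q (s0 - s) (0 - v) = t\<^sup>2 * Q (s' - s) (v' - v)" by (simp only: Qscale power2_minus)
    have "d (f (s', v')) (\<sigma> s0) \<le> d (f (s', v')) (f (s, v)) + d (f (s, v)) (\<sigma> s0)"
      using v fM \<sigma>in by (intro triangle) auto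
    moreover have "d (f (s', v')) (\<sigma> s0) = (1 + t) * sqrt (Q (s' - s) (v' - v))"
      using base[of v' s' s0] v t unfolding 1 by (simp add: real_sqrt_mult)
    moreover have "d (f (s, v)) (\<sigma> s0) = t * sqrt (Q (s' - s) (v' - v))"
      using base[of v s s0] v t unfolding 2 by (simp add: real_sqrt_mult)
    ultimately show "sqrt (Q (s' - s) (v' - v)) \<le> d (f (s, v)) (f (s', v'))"
      by (simp add: mdist_commute algebra_simps)
  qed (use v in auto)
  have eq_same: "d (f (s, v)) (f (s', v)) = sqrt (Q (s' - s) (v - v))" if v: "0 \<le> v" for s v s'
  proof (rule antisym[OF upper[OF v v]])
    have "sqrt (Q (s' - s) e) - e \<le> d (f (s, v)) (f (s', v))" if e: "e > 0" for e
    proof -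
      have "d (f (s, v)) (f (s', v + e)) \<le> d (f (s, v)) (f (s', v)) + d (f (s', v)) (f (s', v + e))"
        using v e fM by (intro triangle) auto
      moreover have "Q 0 e = e\<^sup>2" by (simp add: Q_def)
      ultimately show ?thesis using eq_less[of v "v + e" s s'] eq_less[of v "v + e" s' s'] v e by simp
    qed
    then have "\<forall>\<^sub>F e in at_right 0. sqrt (Q (s' - s) e) - e \<le> d (f (s, v)) (f (s', v))"
      by (auto simp: eventually_at_filter)
    moreover have "((\<lambda>e. sqrt (Q (s' - s) e) - e) \<longlongrightarrow> sqrt (Q (s' - s) 0) - 0) (at_right 0)"
      unfolding Q_def by (intro tendsto_intros)
    ultimately show "sqrt (Q (s' - s) (v - v)) \<le> d (f (s, v)) (f (s', v))"
      using tendsto_upperbound[of _ _ "at_right (0::real)"] by fastforce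
  qed
  have eq: "d (f (s, v)) (f (s', v')) = sqrt (Q (s' - s) (v' - v))" if v: "0 \<le> v" "0 \<le> v'" for s v s' v'
  proof (cases v v' rule: linorder_cases)
    case less then show ?thesis using eq_less v by simp
  next
    case equal then show ?thesis using eq_same v by simp
  next
    case greater
    then show ?thesis using eq_less[of v' v s' s] v Qsym by (simp add: mdist_commute)
  qed
  define c where "c = sqrt (1 - \<kappa>\<^sup>2)"
  have c: "c > 0" "c\<^sup>2 = 1 - \<kappa>\<^sup>2" using \<kappa>2 by (auto simp: c_def)
  have Qdiag: "Q (x + \<kappa> * v) v = x\<^sup>2 + (1 - \<kappa>\<^sup>2) * v\<^sup>2" for x v
    by (simp add: Q_def power2_eq_square algebra_simps)
  \<comment> \<open>Rectangular coordinates: the slanted ray at \<open>\<sigma> s\<close> reaches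
    height \<open>c * v\<close> at time \<open>v\<close>, above the point of \<open>\<sigma>\<close>
    with parameter \<open>s - \<kappa> * v\<close>.\<close>
  define G where "G u = f (fst u + \<kappa> * (snd u / c), snd u / c)" for u
  have "d (G u) (G w) = dist u w" if "snd u \<ge> 0" "snd w \<ge> 0" for u w
  proof -
    let ?x = "fst w - fst u" and ?v = "(snd w - snd u) / c"
    have "d (G u) (G w) = sqrt (Q (?x + \<kappa> * ?v) ?v)"
      unfolding G_def using that c by (subst eq) (auto simp: algebra_simps diff_divide_distrib)
    also have "Q (?x + \<kappa> * ?v) ?v = ?x\<^sup>2 + c\<^sup>2 * ?v\<^sup>2"
      unfolding c(2) by (rule Qdiag)
    also have "c\<^sup>2 * ?v\<^sup>2 = (snd w - snd u)\<^sup>2" using c(1) by (simp add: power_divide)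
    finally show ?thesis
      by (cases u; cases w) (simp add: dist_prod_def dist_real_def power2_commute)
  qed
  moreover have "G (s, 0) = \<sigma> s" for s by (simp add: G_def f0)
  moreover have "G u \<in> M" if "snd u \<ge> 0" for u using that c fM by (auto simp: G_def)
  ultimately show ?thesis unfolding bounds_flat_half_plane_def by (intro exI[of _ G]) auto
qed

section \<open>Contraction towards rank one axes\<close>

lemma isometryD:
  assumes "f \<in> carrier (isometry_group X)"
  shows "bij_betw f (mspace X) (mspace X)" "x \<in> mspace X \<Longrightarrow> f x \<in> mspace X"
    "x \<in> mspace X \<Longrightarrow> y \<in> mspace X \<Longrightarrow> mdist X (f x) (f y) = mdist X x y"
proof -
  have "f \<in> Bij (mspace X)" using assms by (simp add: isometry_group_def)
  then show b: "bij_betw f (mspace X) (mspace X)" by (simp add: Bij_def)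
  then show "x \<in> mspace X \<Longrightarrow> f x \<in> mspace X" by (auto dest: bij_betwE)
  show "x \<in> mspace X \<Longrightarrow> y \<in> mspace X \<Longrightarrow> mdist X (f x) (f y) = mdist X x y"
    using assms by (simp add: isometry_group_def)
qed

locale rank_one_axis = proper_cn_space X for X :: "'a metric" +
  fixes f :: "'a \<Rightarrow> 'a" and l :: real and \<sigma> :: "real \<Rightarrow> 'a"
  assumes isometry: "f \<in> carrier (isometry_group X)" and axis: "is_axis X f l \<sigma>"
    and no_half_plane: "\<not> bounds_flat_half_plane X \<sigma>"
begin

lemma l_pos: "0 < l" and line: "geodesic_line X \<sigma>" and shift: "f (\<sigma> t) = \<sigma> (t + l)"
  using axis by (auto simp: is_axis_def)

lemmas \<sigma>_in [simp] = geodesic_lineD(1)[OF line]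
lemmas \<sigma>_dist [simp] = geodesic_lineD(2)[OF line]
lemmas f_in [simp] = isometryD(2)[OF isometry]
lemmas f_dist = isometryD(3)[OF isometry]
lemmas convex_dist = convex_dist_line[OF line]

lemma dist_shift: "x \<in> M \<Longrightarrow> d (f x) (\<sigma> (t + l)) = d x (\<sigma> t)"
  using f_dist[of x "\<sigma> t"] shift[of t] by simp

text \<open>The image of \<open>x\<close> under a power of the isometry, described by its distance function
along the axis, which is that of \<open>x\<close> shifted by a multiple of \<open>l\<close>.\<close>

lemma translate_nat:
  assumes "x \<in> M"
  shows "\<exists>y\<in>M. \<forall>t. d y (\<sigma> t) = d x (\<sigma> (t - real n * l))"
    "\<exists>y\<in>M. \<forall>t. d y (\<sigma> t) = d x (\<sigma> (t + real n * l))"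
proof (induction n)
  case 0
  { case 1 show ?case using assms by auto }
  { case 2 show ?case using assms by auto }
next
  case (Suc n)
  { case 1
    obtain y where y: "y \<in> M" "\<And>t. d y (\<sigma> t) = d x (\<sigma> (t - real n * l))" using Suc.IH(1) by blast
    have "d (f y) (\<sigma> t) = d x (\<sigma> (t - real (Suc n) * l))" for t
      using dist_shift[OF y(1), of "t - l"] y(2)[of "t - l"] by (simp add: algebra_simps)
    then show ?case using y(1) f_in by blast }
  { case 2
    obtain y where y: "y \<in> M" "\<And>t. d y (\<sigma> t) = d x (\<sigma> (t + real n * l))" using Suc.IH(2) by blast
    obtain z where z: "z \<in> M" "f z = y"
      using y(1) isometryD(1)[OF isometry] by (metis bij_betw_iff_bijections)
    have "d z (\<sigma> t) = d x (\<sigma> (t + real (Suc n) * l))" for t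
      using dist_shift[OF z(1), of t] y(2)[of "t + l"] z(2) by (simp add: algebra_simps)
    then show ?case using z(1) by blast }
qed

lemma translate:
  assumes "x \<in> M"
  shows "\<exists>y\<in>M. \<forall>t. d y (\<sigma> t) = d x (\<sigma> (t - of_int k * l))"
proof (cases "0 \<le> k")
  case True
  then show ?thesis using translate_nat(1)[OF assms, of "nat k"] by simp
next
  case False
  then show ?thesis using translate_nat(2)[OF assms, of "nat (- k)"] by simp
qed

text \<open>Subdivide \<open>{a..b}\<close> into pieces of length \<open>N + l\<close>. The increments of the
convex function \<open>t \<mapsto> d x (\<sigma> t)\<close> over consecutive pieces increase, but
they remain between \<open>- \<kappa> * (N + l)\<close> and \<open>\<kappa> * (N + l)\<close>. If
there are many pieces, two neighbouring increments differ by at most \<open>\<delta>\<close>, and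
the function is nearly linear on their union. A power of the isometry moves the middle of this
union into \<open>{0..<l}\<close>, whence the extra length \<open>l\<close> of the pieces.\<close>

lemma nearly_linear_distance:
  assumes x: "x \<in> M" and lip: "\<And>s t. s \<in> {a..b} \<Longrightarrow> t \<in> {a..b} \<Longrightarrow> \<bar>d x (\<sigma> s) - d x (\<sigma> t)\<bar> \<le> \<kappa> * \<bar>s - t\<bar>"
    and N: "0 < N" and \<delta>: "0 < \<delta>" and J: "2 * \<kappa> * (N + l) \<le> real J * \<delta>"
    and long: "real (J + 2) * (N + l) \<le> b - a"
  shows "\<exists>y\<in>M. \<exists>k. \<bar>k\<bar> \<le> \<kappa> \<and> (\<forall>s. \<bar>s\<bar> \<le> N \<longrightarrow> \<bar>d y (\<sigma> s) - d y (\<sigma> 0) - k * s\<bar> \<le> \<delta>)"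
proof -
  define L where "L = N + l"
  have L: "L > 0" using N l_pos by (simp add: L_def)
  define \<phi> where "\<phi> t = d x (\<sigma> t)" for t
  note cvx = convex_three_points[OF convex_dist[OF x, folded \<phi>_def]]
  define g where "g j = \<phi> (a + real (Suc j) * L) - \<phi> (a + real j * L)" for j
  have inab: "a + real j * L \<in> {a..b}" if "j \<le> J + 2" for j
  proof -
    have "real j * L \<le> real (J + 2) * L" using that L by (intro mult_right_mono) auto
    also have "\<dots> \<le> b - a" using long by (simp only: L_def)
    finally have "real j * L \<le> b - a" .
    moreover have "0 \<le> real j * L" using L by simp
    ultimately show ?thesis by simp
  qed
  have g: "\<bar>g j\<bar> \<le> \<kappa> * L" if "j \<le> J + 1" for j
    using lip[OF inab[of "Suc j"] inab[of j]] that L by (simp add: g_def \<phi>_def algebra_simps)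
  have "\<exists>j\<le>J. g (Suc j) - g j \<le> \<delta>"
  proof (rule ccontr)
    assume "\<not> ?thesis"
    then have "\<And>j. j \<in> {..J} \<Longrightarrow> \<delta> < g (Suc j) - g j" by force
    then have "(\<Sum>j\<in>{..J}. \<delta>) < (\<Sum>j\<in>{..J}. g (Suc j) - g j)" by (intro sum_strict_mono) auto
    also have "\<dots> = g (Suc J) - g 0" by (simp add: lessThan_Suc_atMost[symmetric] sum_lessThan_telescope)
    also have "\<dots> \<le> 2 * \<kappa> * L" using g[of "Suc J"] g[of 0] by (simp add: abs_le_iff)
    also have "\<dots> \<le> real J * \<delta>" using J by (simp add: L_def)
    finally show False using \<delta> by (simp add: algebra_simps)
  qed
  then obtain j where j: "j \<le> J" "g (Suc j) - g j \<le> \<delta>" by blast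
  define c where "c = a + real (Suc j) * L"
  define g1 where "g1 = \<phi> c - \<phi> (c - L)"
  define g2 where "g2 = \<phi> (c + L) - \<phi> c"
  have cm: "c - L = a + real j * L" and cp: "c + L = a + real (Suc (Suc j)) * L"
    by (simp_all add: c_def algebra_simps)
  have gg: "g1 = g j" "g2 = g (Suc j)" unfolding g1_def g2_def cm cp by (simp_all add: g_def c_def)
  have bnd: "\<bar>g1\<bar> \<le> \<kappa> * L" "\<bar>g2\<bar> \<le> \<kappa> * L" "g2 - g1 \<le> \<delta>" using g j by (auto simp: gg)
  define k where "k = (g1 + g2) / (2 * L)"
  have kL: "2 * L * k = g1 + g2" using L by (simp add: k_def)
  have "2 * L * k \<le> 2 * L * \<kappa>" "2 * L * (- k) \<le> 2 * L * \<kappa>"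
    using bnd kL by (simp_all add: abs_le_iff algebra_simps)
  moreover have "0 < 2 * L" using L by simp
  ultimately have "k \<le> \<kappa>" "- k \<le> \<kappa>" by (simp_all only: mult_le_cancel_left_pos)
  then have k: "\<bar>k\<bar> \<le> \<kappa>" by (simp add: abs_le_iff)
  have lin: "\<bar>\<phi> (c + u) - \<phi> c - k * u\<bar> \<le> \<delta> / 2" if u: "\<bar>u\<bar> \<le> L" for u
  proof -
    define e where "e = L * (\<phi> (c + u) - \<phi> c)"
    have "L * g1 \<le> L * g2" using cvx[of "c - L" c "c + L"] L by (simp add: g1_def g2_def algebra_simps)
    then have g12: "g1 \<le> g2" using L by (simp only: mult_le_cancel_left_pos)
    \<comment> \<open>By convexity the chord from \<open>c\<close> to \<open>c + u\<close> has
      slope between the slopes of the two neighbouring pieces.\<close>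
    have "min (u * g1) (u * g2) \<le> e \<and> e \<le> max (u * g1) (u * g2)"
    proof (cases "0 \<le> u")
      case True
      have "u * g1 \<le> e" using cvx[of "c - L" c "c + u"] True L
        by (simp add: e_def g1_def algebra_simps)
      moreover have "e \<le> u * g2" using cvx[of c "c + u" "c + L"] True u
        by (simp add: e_def g2_def algebra_simps)
      ultimately show ?thesis by simp
    next
      case False
      have "u * g2 \<le> e" using cvx[of "c + u" c "c + L"] False L
        by (simp add: e_def g2_def algebra_simps)
      moreover have "e \<le> u * g1" using cvx[of "c - L" "c + u" c] False u
        by (simp add: e_def g1_def algebra_simps)
      ultimately show ?thesis by simp
    qed
    moreover have "\<bar>e - (p + q) / 2\<bar> \<le> \<bar>q - p\<bar> / 2" if "min p q \<le> e \<and> e \<le> max p q" for p q :: real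
      using that unfolding min_def max_def by (auto simp: abs_if field_simps split: if_splits)
    ultimately have "\<bar>e - u * (g1 + g2) / 2\<bar> \<le> \<bar>u * (g2 - g1)\<bar> / 2"
      unfolding right_diff_distrib distrib_left by blast
    also have "\<dots> \<le> L * \<delta> / 2"
      using u bnd(3) g12 \<delta> by (auto simp: abs_mult intro!: mult_mono)
    finally have "\<bar>e - u * (2 * L * k) / 2\<bar> \<le> L * \<delta> / 2" unfolding kL .
    also have "e - u * (2 * L * k) / 2 = L * (\<phi> (c + u) - \<phi> c - k * u)" by (simp add: e_def algebra_simps)
    also have "\<bar>\<dots>\<bar> = L * \<bar>\<phi> (c + u) - \<phi> c - k * u\<bar>" using L by (simp add: abs_mult)
    finally have "L * \<bar>\<phi> (c + u) - \<phi> c - k * u\<bar> \<le> L * (\<delta> / 2)" by simp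
    then show ?thesis using L by (simp only: mult_le_cancel_left_pos)
  qed
  define q where "q = - \<lfloor>c / l\<rfloor>"
  define r where "r = c + of_int q * l"
  have "r = frac (c / l) * l" using l_pos by (simp add: r_def q_def frac_def algebra_simps)
  then have r: "0 \<le> r" "r < l" using l_pos frac_lt_1[of "c / l"] by (auto simp: frac_ge_0)
  obtain y where y: "y \<in> M" "\<And>t. d y (\<sigma> t) = \<phi> (t - of_int q * l)"
    using translate[OF x, of q] by (auto simp: \<phi>_def)
  have yr: "d y (\<sigma> s) = \<phi> (c + (s - r))" for s by (simp add: y(2) r_def algebra_simps)
  have "\<bar>d y (\<sigma> s) - d y (\<sigma> 0) - k * s\<bar> \<le> \<delta>" if s: "\<bar>s\<bar> \<le> N" for s
  proof -
    have "\<bar>s - r\<bar> \<le> L" "\<bar>0 - r\<bar> \<le> L" using s r N by (auto simp: L_def)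
    from lin[OF this(1)] lin[OF this(2)] show ?thesis
      unfolding yr right_diff_distrib by linarith
  qed
  then show ?thesis using y(1) k by blast
qed

text \<open>Here the assumption that the axis bounds no flat half-plane is used. If intervals with slopes at
most \<open>\<kappa>\<close> were unbounded in length, the preceding lemma would produce points
whose distance functions are linear up to \<open>1 / n\<close> on intervals of radius
\<open>n\<close>. A subsequence of their slopes converges, and the points diverge because the
slopes stay away from \<open>1\<close>; so their limit spans a half-plane.\<close>

lemma steep_distance:
  assumes \<kappa>: "0 \<le> \<kappa>" "\<kappa> < 1"
  obtains L where "\<And>x a b. \<lbrakk>x \<in> M; \<And>s t. s \<in> {a..b} \<Longrightarrow> t \<in> {a..b} \<Longrightarrow>
      \<bar>d x (\<sigma> s) - d x (\<sigma> t)\<bar> \<le> \<kappa> * \<bar>s - t\<bar>\<rbrakk> \<Longrightarrow> b - a \<le> L"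
proof (rule ccontr)
  assume no: "\<not> thesis"
  have ex: "\<exists>x a b. x \<in> M \<and> (\<forall>s\<in>{a..b}. \<forall>t\<in>{a..b}. \<bar>d x (\<sigma> s) - d x (\<sigma> t)\<bar> \<le> \<kappa> * \<bar>s - t\<bar>) \<and> L < b - a" for L
  proof (rule ccontr)
    assume "\<not> ?thesis"
    then have "b - a \<le> L" if "x \<in> M" "\<And>s t. s \<in> {a..b} \<Longrightarrow> t \<in> {a..b} \<Longrightarrow>
      \<bar>d x (\<sigma> s) - d x (\<sigma> t)\<bar> \<le> \<kappa> * \<bar>s - t\<bar>" for x a b using that by (meson not_le)
    then show False using no that by metis
  qed
  have "\<exists>y\<in>M. \<exists>k. \<bar>k\<bar> \<le> \<kappa> \<and> (\<forall>s. \<bar>s\<bar> \<le> real (Suc n) \<longrightarrow> \<bar>d y (\<sigma> s) - d y (\<sigma> 0) - k * s\<bar> \<le> 1 / real (Suc n))" for n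
  proof -
    define J where "J = nat \<lceil>2 * \<kappa> * (real (Suc n) + l) * real (Suc n)\<rceil>"
    have "2 * \<kappa> * (real (Suc n) + l) * real (Suc n) \<le> real J" unfolding J_def by linarith
    then have J: "2 * \<kappa> * (real (Suc n) + l) \<le> real J * (1 / real (Suc n))" by (simp add: pos_le_divide_eq)
    obtain x a b where "x \<in> M" "real (J + 2) * (real (Suc n) + l) < b - a"
      "\<forall>s\<in>{a..b}. \<forall>t\<in>{a..b}. \<bar>d x (\<sigma> s) - d x (\<sigma> t)\<bar> \<le> \<kappa> * \<bar>s - t\<bar>" using ex by meson
    then show ?thesis using J by (intro nearly_linear_distance[of x a b \<kappa> "real (Suc n)" "1 / real (Suc n)" J]) auto
  qed
  then obtain y k where y: "\<And>n. y n \<in> M" and k: "\<And>n. \<bar>k n\<bar> \<le> \<kappa>"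
    and lin: "\<And>n s. \<bar>s\<bar> \<le> real (Suc n) \<Longrightarrow> \<bar>d (y n) (\<sigma> s) - d (y n) (\<sigma> 0) - k n * s\<bar> \<le> 1 / real (Suc n)"
    by metis
  have "\<forall>n. k n \<in> {-\<kappa>..\<kappa>}" using k by (simp add: abs_le_iff minus_le_iff)
  then obtain k0 r where k0: "k0 \<in> {-\<kappa>..\<kappa>}" and r: "strict_mono r" and klim: "(k \<circ> r) \<longlonglongrightarrow> k0"
    using compact_Icc[of "-\<kappa>" \<kappa>] unfolding compact_def by metis
  have inv: "(\<lambda>n. 1 / real (Suc (r n))) \<longlonglongrightarrow> 0"
    using LIMSEQ_subseq_LIMSEQ[OF LIMSEQ_inverse_real_of_nat r] by (simp add: o_def inverse_eq_divide)
  have rn: "n \<le> r n" for n using r by (rule seq_suble)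
  have "bounds_flat_half_plane X \<sigma>"
  proof (rule half_plane_of_linear_horofunction[OF line, of "y \<circ> r" k0])
    fix s
    have "\<forall>\<^sub>F n in sequentially. norm ((d (\<sigma> s) (y (r n)) - d (\<sigma> 0) (y (r n))) - k (r n) * s) \<le> 1 / real (Suc (r n))"
      using eventually_ge_at_top[of "nat \<lceil>\<bar>s\<bar>\<rceil>"]
    proof eventually_elim
      case (elim n)
      then have "\<bar>s\<bar> \<le> real (Suc (r n))" using rn[of n] by linarith
      then show ?case using lin[of s "r n"] by (simp add: mdist_commute)
    qed
    then have "(\<lambda>n. (d (\<sigma> s) (y (r n)) - d (\<sigma> 0) (y (r n))) - k (r n) * s) \<longlonglongrightarrow> 0"
      using inv by (rule Lim_null_comparison)
    from tendsto_add[OF this tendsto_mult_right[OF klim, of s]]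
    show "(\<lambda>n. d (\<sigma> s) ((y \<circ> r) n) - d (\<sigma> 0) ((y \<circ> r) n)) \<longlonglongrightarrow> k0 * s" by simp
  next
    show "filterlim (\<lambda>n. d (\<sigma> 0) ((y \<circ> r) n)) at_top sequentially" unfolding filterlim_at_top
    proof
      fix Z
      show "\<forall>\<^sub>F n in sequentially. Z \<le> d (\<sigma> 0) ((y \<circ> r) n)"
        using eventually_ge_at_top[of "nat \<lceil>(2 * \<bar>Z\<bar> + 1) / (1 - \<kappa>)\<rceil>"]
      proof eventually_elim
        case (elim n)
        define N where "N = real (Suc (r n))"
        \<comment> \<open>The triangle inequality for \<open>\<sigma> 0\<close>, \<open>\<sigma>
          N\<close> and the point, whose distance changes at most by \<open>\<kappa> * N + 1 /
          N\<close> between them.\<close>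
        have "(2 * \<bar>Z\<bar> + 1) / (1 - \<kappa>) \<le> N" using elim rn[of n] unfolding N_def by linarith
        then have "2 * \<bar>Z\<bar> + 1 \<le> (1 - \<kappa>) * N" using \<kappa> by (simp add: pos_divide_le_eq algebra_simps)
        moreover have "N \<le> d (y (r n)) (\<sigma> N) + d (y (r n)) (\<sigma> 0)"
          using triangle[of "\<sigma> N" "y (r n)" "\<sigma> 0"] y by (simp add: mdist_commute N_def)
        moreover have "d (y (r n)) (\<sigma> N) \<le> d (y (r n)) (\<sigma> 0) + k (r n) * N + 1 / N"
          using lin[of N "r n"] by (simp add: N_def abs_le_iff)
        moreover have "k (r n) * N \<le> \<kappa> * N" using k[of "r n"] by (intro mult_right_mono) (auto simp: N_def abs_le_iff)
        moreover have "1 / N \<le> 1" by (simp add: N_def)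
        ultimately show ?case by (simp add: mdist_commute algebra_simps)
      qed
    qed
  qed (use y k0 \<kappa> in auto)
  then show False using no_half_plane by simp
qed

definition foot :: "'a \<Rightarrow> real" where
  "foot x = (SOME t. \<forall>s. d x (\<sigma> t) \<le> d x (\<sigma> s))"

lemma foot_min:
  assumes "x \<in> M" shows "d x (\<sigma> (foot x)) \<le> d x (\<sigma> s)"
proof -
  let ?D = "d x (\<sigma> 0)"
  have "\<bar>d x (\<sigma> t) - d x (\<sigma> s)\<bar> \<le> 1 * \<bar>t - s\<bar>" for s t
    using mdist_reverse_triangle[of "\<sigma> t" x "\<sigma> s"] assms by (simp add: mdist_commute)
  then have "continuous_on {- 2 * ?D..2 * ?D} (\<lambda>t. d x (\<sigma> t))"
    by (intro lipschitz_on_continuous_on[of 1] lipschitz_onI) (auto simp: dist_real_def)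
  then have "\<exists>t\<in>{- 2 * ?D..2 * ?D}. \<forall>s\<in>{- 2 * ?D..2 * ?D}. d x (\<sigma> t) \<le> d x (\<sigma> s)"
    by (intro continuous_attains_inf) auto
  then obtain t where t: "\<And>s. s \<in> {- 2 * ?D..2 * ?D} \<Longrightarrow> d x (\<sigma> t) \<le> d x (\<sigma> s)" by blast
  have "d x (\<sigma> t) \<le> d x (\<sigma> s)" for s
  proof (cases "s \<in> {- 2 * ?D..2 * ?D}")
    case False
    then have "2 * ?D \<le> \<bar>s\<bar>" by (auto simp: abs_if)
    also have "\<bar>s\<bar> \<le> d x (\<sigma> s) + ?D"
      using triangle[of "\<sigma> s" x "\<sigma> 0"] assms by (simp add: mdist_commute)
    finally show ?thesis using t[of 0] by simp
  qed (use t in blast)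
  then have "\<exists>t. \<forall>s. d x (\<sigma> t) \<le> d x (\<sigma> s)" by blast
  then show ?thesis unfolding foot_def by (rule someI2_ex) blast
qed

text \<open>The Bruhat-Tits inequality on the geodesic from \<open>\<sigma> m\<close> to \<open>\<sigma>
s\<close> near its start, where the minimality of \<open>m\<close> applies.\<close>

lemma foot_pythagoras:
  assumes x: "x \<in> M" and min: "\<And>s. d x (\<sigma> m) \<le> d x (\<sigma> s)"
  shows "(d x (\<sigma> m))\<^sup>2 + (s - m)\<^sup>2 \<le> (d x (\<sigma> s))\<^sup>2"
proof -
  let ?q = "(d x (\<sigma> m))\<^sup>2"
  have "?q + (1 - l) * (s - m)\<^sup>2 \<le> (d x (\<sigma> s))\<^sup>2" if l: "0 < l" "l < 1" for l
  proof -
    have "?q \<le> (d x (\<sigma> ((1 - l) * m + l * s)))\<^sup>2" by (intro power_mono min) auto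
    also have "\<dots> \<le> (1 - l) * ?q + l * (d x (\<sigma> s))\<^sup>2 - l * (1 - l) * (s - m)\<^sup>2"
      using line_point[OF line, of l m s] pt_cn[of "\<sigma> m" "\<sigma> s" l x] x l by (simp add: power2_commute)
    finally have "l * (?q + (1 - l) * (s - m)\<^sup>2) \<le> l * (d x (\<sigma> s))\<^sup>2" by (simp add: algebra_simps)
    then show ?thesis using l by (simp only: mult_le_cancel_left_pos)
  qed
  then have "\<forall>\<^sub>F l in at_right 0. ?q + (1 - l) * (s - m)\<^sup>2 \<le> (d x (\<sigma> s))\<^sup>2"
    by (auto simp: eventually_at_right_field intro!: exI[of _ 1])
  moreover have "((\<lambda>l. ?q + (1 - l) * (s - m)\<^sup>2) \<longlongrightarrow> ?q + (1 - 0) * (s - m)\<^sup>2) (at_right 0)"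
    by (intro tendsto_intros)
  ultimately show ?thesis using tendsto_upperbound[of _ _ "at_right (0::real)"] by fastforce
qed

lemma foot_unique:
  assumes "x \<in> M" "\<And>s. d x (\<sigma> m) \<le> d x (\<sigma> s)" shows "foot x = m"
proof -
  have "(d x (\<sigma> (foot x)))\<^sup>2 \<le> (d x (\<sigma> m))\<^sup>2" using foot_min[OF assms(1)] by (intro power_mono) auto
  with foot_pythagoras[OF assms, of "foot x"] have "(foot x - m)\<^sup>2 \<le> 0" by linarith
  then show ?thesis by simp
qed

lemma foot_shift: "x \<in> M \<Longrightarrow> foot (f x) = foot x + l"
proof (rule foot_unique)
  fix s assume x: "x \<in> M"
  show "d (f x) (\<sigma> (foot x + l)) \<le> d (f x) (\<sigma> s)"
    using foot_min[OF x, of "s - l"] dist_shift[OF x, of "foot x"] dist_shift[OF x, of "s - l"] by simp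
qed simp

lemma foot_\<sigma> [simp]: "foot (\<sigma> t) = t"
  by (rule foot_unique) auto

text \<open>The quadrilateral with two opposite sides \<open>x y\<close> and \<open>foot x foot y\<close> has
diagonals that are bounded below by the Pythagorean inequality.\<close>

lemma foot_lipschitz:
  assumes x: "x \<in> M" and y: "y \<in> M" shows "\<bar>foot x - foot y\<bar> \<le> d x y"
proof -
  let ?a = "foot x" and ?b = "foot y"
  have "(d x (\<sigma> ?b))\<^sup>2 + (d (\<sigma> ?a) y)\<^sup>2 \<le> (d x (\<sigma> ?a))\<^sup>2 + (d (\<sigma> ?a) (\<sigma> ?b))\<^sup>2 + (d (\<sigma> ?b) y)\<^sup>2 + (d y x)\<^sup>2"
    using x y by (intro quadrilateral_ineq) auto
  moreover have "(d (\<sigma> ?a) (\<sigma> ?b))\<^sup>2 = (?b - ?a)\<^sup>2" by (simp add: power2_commute)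
  moreover have "(d x (\<sigma> ?a))\<^sup>2 + (?b - ?a)\<^sup>2 \<le> (d x (\<sigma> ?b))\<^sup>2"
    by (rule foot_pythagoras[OF x foot_min[OF x]])
  moreover have "(d y (\<sigma> ?b))\<^sup>2 + (?b - ?a)\<^sup>2 \<le> (d y (\<sigma> ?a))\<^sup>2"
    using foot_pythagoras[OF y foot_min[OF y], of ?a] by (simp add: power2_commute)
  ultimately have "(?a - ?b)\<^sup>2 \<le> (d x y)\<^sup>2" by (simp add: mdist_commute power2_commute)
  then show ?thesis using abs_le_square_iff[of "?a - ?b" "d x y"] by simp
qed

lemma foot_near: "x \<in> M \<Longrightarrow> \<bar>foot x - t\<bar> \<le> d x (\<sigma> t)"
  using foot_lipschitz[of x "\<sigma> t"] by simp

end

text \<open>The point \<open>y\<close> is far away in the positive direction of \<open>\<tau>\<close>, and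
\<open>z\<close> is not farther from \<open>y\<close> than \<open>\<tau> 0\<close>. Then moving
from \<open>\<tau> 0\<close> by \<open>t\<close> increases the distance to \<open>z\<close> hardly
faster than moving perpendicularly in the plane. Indeed, by steepness the geodesic from
\<open>\<tau> 0\<close> to \<open>y\<close> follows \<open>\<tau>\<close> up to the error \<open>t
/ 100\<close>, which is where \<open>1 / 20000\<close> comes from: \<open>2 * (1 / 20000) = (1 /
100)\<^sup>2\<close>. On this geodesic the Bruhat-Tits inequality for \<open>z\<close> has a
linear term with factor \<open>\<beta> \<le> 0\<close>.\<close>

lemma (in cn_space) balanced_point_bound:
  assumes line: "geodesic_line X \<tau>" and y: "y \<in> M" and z: "z \<in> M" and R: "0 < R"
    and steep: "d y (\<tau> (2 * R)) \<le> d y (\<tau> 0) - 2 * R * (1 - 1/20000)"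
    and \<beta>: "d z y = d y (\<tau> 0) + \<beta>" "\<beta> \<le> 0"
    and t: "0 \<le> t" "t \<le> R" and far: "R \<le> d z (\<tau> 0)"
  shows "d z (\<tau> t) \<le> d z (\<tau> 0) + t\<^sup>2 / (2 * R) + R / 100"
proof -
  note \<tau>in = geodesic_lineD(1)[OF line] and \<tau>d = geodesic_lineD(2)[OF line]
  let ?\<rho> = "d z (\<tau> 0)"
  define \<kappa> :: real where "\<kappa> = 1 - 1/20000"
  define B where "B = d y (\<tau> 0)"
  have "0 \<le> d y (\<tau> (2 * R))" by simp
  then have B: "R \<le> B" using steep R unfolding B_def by (simp only: right_diff_distrib)
  have "2 * R * d y (\<tau> t) \<le> (2 * R - t) * B + t * d y (\<tau> (2 * R))"
    using convex_three_points[OF convex_dist_line[OF line y], of 0 t "2 * R"] t by (simp add: B_def)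
  also have "\<dots> \<le> (2 * R - t) * B + t * (B - 2 * R * \<kappa>)"
    using steep t by (intro add_left_mono mult_left_mono) (auto simp: B_def \<kappa>_def)
  also have "\<dots> = 2 * R * (B - \<kappa> * t)" by (simp add: algebra_simps)
  finally have \<phi>t: "d y (\<tau> t) \<le> B - \<kappa> * t" using R by (simp only: mult_le_cancel_left_pos)
  let ?l = "t / B"
  have l: "0 \<le> ?l" "?l \<le> 1" using t B R by (auto simp: divide_le_eq)
  have lB: "?l * B = t" using B R by simp
  let ?w = "pt (\<tau> 0) y ?l"
  have w: "?w \<in> M" using \<tau>in y l by (intro pt_in)
  have "(d (\<tau> t) ?w)\<^sup>2 \<le> (1 - ?l) * (d (\<tau> t) (\<tau> 0))\<^sup>2 + ?l * (d (\<tau> t) y)\<^sup>2 - ?l * (1 - ?l) * (d (\<tau> 0) y)\<^sup>2"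
    using \<tau>in y l by (intro pt_cn)
  also have "\<dots> = (1 - ?l) * t\<^sup>2 + ?l * (d y (\<tau> t))\<^sup>2 - ?l * (1 - ?l) * B\<^sup>2"
    using \<tau>d[of t 0] by (simp add: mdist_commute B_def)
  also have "\<dots> \<le> (1 - ?l) * t\<^sup>2 + ?l * (B - \<kappa> * t)\<^sup>2 - ?l * (1 - ?l) * B\<^sup>2"
    using \<phi>t l by (intro diff_right_mono add_left_mono mult_left_mono power_mono) auto
  also have "\<dots> = (1 - ?l) * t\<^sup>2 + (?l * B) * B - 2 * \<kappa> * t * (?l * B) + ?l * \<kappa>\<^sup>2 * t\<^sup>2 - (?l * B) * B + (?l * B)\<^sup>2"
    by (simp add: power2_eq_square algebra_simps)
  also have "\<dots> = 2 * (1 - \<kappa>) * t\<^sup>2 - ?l * (1 - \<kappa>\<^sup>2) * t\<^sup>2"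
    unfolding lB by (simp add: power2_eq_square algebra_simps)
  also have "\<dots> \<le> (t / 100)\<^sup>2"
  proof -
    have "0 \<le> ?l * (1 - \<kappa>\<^sup>2) * t\<^sup>2" using l by (intro mult_nonneg_nonneg) (auto simp: \<kappa>_def power2_eq_square)
    then show ?thesis by (simp add: \<kappa>_def power_divide)
  qed
  finally have "d (\<tau> t) ?w \<le> t / 100" by (rule power2_le_imp_le) (use t in auto)
  then have 1: "d ?w (\<tau> t) \<le> R / 100" using t by (simp add: mdist_commute)
  \<comment> \<open>By \<open>\<bar>\<beta>\<bar> \<le> d z (\<tau> 0)\<close> the contribution of
    the proportion \<open>t / B\<close> to the squared distance is nonpositive.\<close>
  have \<beta>\<rho>: "\<bar>\<beta>\<bar> \<le> ?\<rho>" using mdist_reverse_triangle[of z y "\<tau> 0"] z y \<tau>in \<beta> by (simp add: B_def)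
  then have "\<bar>\<beta>\<bar>\<^sup>2 \<le> ?\<rho>\<^sup>2" by (intro power_mono) auto
  then have \<beta>2: "\<beta>\<^sup>2 \<le> ?\<rho>\<^sup>2" by simp
  have "(d z ?w)\<^sup>2 \<le> (1 - ?l) * ?\<rho>\<^sup>2 + ?l * (d z y)\<^sup>2 - ?l * (1 - ?l) * (d (\<tau> 0) y)\<^sup>2"
    using \<tau>in y z l by (intro pt_cn)
  also have "\<dots> = (1 - ?l) * ?\<rho>\<^sup>2 + ?l * (B + \<beta>)\<^sup>2 - ?l * (1 - ?l) * B\<^sup>2"
    using \<beta>(1) mdist_commute[of X "\<tau> 0" y] by (simp only: B_def)
  also have "\<dots> = ?\<rho>\<^sup>2 - ?l * (?\<rho>\<^sup>2 - \<beta>\<^sup>2) + 2 * \<beta> * (?l * B) + (?l * B)\<^sup>2"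
    by (simp add: power2_eq_square algebra_simps)
  also have "\<dots> \<le> ?\<rho>\<^sup>2 + t\<^sup>2"
  proof -
    have "0 \<le> ?l * (?\<rho>\<^sup>2 - \<beta>\<^sup>2)" using l \<beta>2 by (intro mult_nonneg_nonneg) simp_all
    moreover have "2 * \<beta> * t \<le> 0" using \<beta>(2) t by (simp add: mult_nonpos_nonneg)
    ultimately show ?thesis unfolding lB by linarith
  qed
  also have "\<dots> \<le> (?\<rho> + t\<^sup>2 / (2 * R))\<^sup>2"
  proof -
    have "2 * R * (t\<^sup>2 / (2 * R)) \<le> 2 * ?\<rho> * (t\<^sup>2 / (2 * R))"
      using far R by (intro mult_right_mono) auto
    then have "t\<^sup>2 \<le> 2 * ?\<rho> * (t\<^sup>2 / (2 * R))" using R by simp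
    moreover have "0 \<le> (t\<^sup>2 / (2 * R))\<^sup>2" by simp
    ultimately show ?thesis unfolding power2_sum by linarith
  qed
  finally have "d z ?w \<le> ?\<rho> + t\<^sup>2 / (2 * R)" by (rule power2_le_imp_le) (use R in auto)
  then show ?thesis using triangle[of z ?w "\<tau> t"] z w \<tau>in 1 by force
qed

context rank_one_axis
begin

text \<open>Let \<open>z\<close> divide the geodesic from \<open>x\<close> to \<open>y\<close> such that its
distances to \<open>x\<close> and \<open>y\<close> fall short of those of \<open>\<sigma>
m\<close> by the same amount \<open>- \<beta>\<close>. If \<open>z\<close> were far from
\<open>\<sigma> m\<close>, then by \<open>balanced_point_bound\<close>, applied in both directions
of the axis, the distance from \<open>z\<close> would have slope at most \<open>3 / 4\<close> on a
long interval about \<open>m\<close>, contrary to \<open>steep_distance\<close>. The second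
application of \<open>steep_distance\<close>, with slope near \<open>1\<close>, ensures the
steepness of the distances from \<open>x\<close> and \<open>y\<close> that
\<open>balanced_point_bound\<close> requires.\<close>

lemma axis_contracting:
  obtains T c where "0 < T" "0 < c" "\<And>x y m. \<lbrakk>x \<in> M; y \<in> M; foot x \<le> m - T; m + T \<le> foot y\<rbrakk> \<Longrightarrow>
    \<exists>k\<in>{0..1}. d (\<sigma> m) (pt x y k) \<le> c"
proof -
  define \<kappa> :: real where "\<kappa> = 1 - 1/20000"
  obtain L1 where L1: "\<And>x a b. \<lbrakk>x \<in> M; \<And>s t. s \<in> {a..b} \<Longrightarrow> t \<in> {a..b} \<Longrightarrow>
      \<bar>d x (\<sigma> s) - d x (\<sigma> t)\<bar> \<le> 3/4 * \<bar>s - t\<bar>\<rbrakk> \<Longrightarrow> b - a \<le> L1"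
    by (rule steep_distance[of "3/4"]) auto
  obtain L2 where L2: "\<And>x a b. \<lbrakk>x \<in> M; \<And>s t. s \<in> {a..b} \<Longrightarrow> t \<in> {a..b} \<Longrightarrow>
      \<bar>d x (\<sigma> s) - d x (\<sigma> t)\<bar> \<le> \<kappa> * \<bar>s - t\<bar>\<rbrakk> \<Longrightarrow> b - a \<le> L2"
    by (rule steep_distance[of \<kappa>]) (auto simp: \<kappa>_def)
  \<comment> \<open>The interval \<open>{m - R / 4..m + R / 4}\<close> on which the slope is
    estimated is longer than \<open>L1\<close>.\<close>
  define R where "R = 2 * \<bar>L1\<bar> + 1"
  have R: "R > 0" by (simp add: R_def)
  define T where "T = 2 * R + \<bar>L2\<bar> + 1"
  have right: "d y (\<sigma> (m + 2 * R)) \<le> d y (\<sigma> m) - 2 * R * \<kappa>" if y: "y \<in> M" "m + T \<le> foot y" for y m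
  proof -
    have "\<not> (\<forall>s\<in>{m + 2 * R..foot y}. \<forall>t\<in>{m + 2 * R..foot y}. \<bar>d y (\<sigma> s) - d y (\<sigma> t)\<bar> \<le> \<kappa> * \<bar>s - t\<bar>)"
      (is "\<not> ?lip")
    proof
      assume ?lip
      then have "foot y - (m + 2 * R) \<le> L2" by (intro L2[OF y(1)]) blast
      then show False using y(2) by (simp add: T_def)
    qed
    from convex_steep_before[OF convex_dist[OF y(1)] foot_min[OF y(1)] this, of m]
    show ?thesis using R by (simp add: \<kappa>_def)
  qed
  have left: "d x (\<sigma> (m - 2 * R)) \<le> d x (\<sigma> m) - 2 * R * \<kappa>" if x: "x \<in> M" "foot x \<le> m - T" for x m
  proof -
    have line': "geodesic_line X (\<lambda>t. \<sigma> (- t))" by (auto simp: geodesic_line_def)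
    have "\<not> (\<forall>s\<in>{- m + 2 * R..- foot x}. \<forall>t\<in>{- m + 2 * R..- foot x}.
        \<bar>d x (\<sigma> (- s)) - d x (\<sigma> (- t))\<bar> \<le> \<kappa> * \<bar>s - t\<bar>)" (is "\<not> ?lip")
    proof
      assume lip: ?lip
      have "\<bar>d x (\<sigma> s) - d x (\<sigma> t)\<bar> \<le> \<kappa> * \<bar>s - t\<bar>" if "s \<in> {foot x..m - 2 * R}" "t \<in> {foot x..m - 2 * R}" for s t
        using lip[rule_format, of "- s" "- t"] that by (simp add: abs_minus_commute)
      then have "(m - 2 * R) - foot x \<le> L2" by (intro L2[OF x(1)]) blast
      then show False using x(2) by (simp add: T_def)
    qed
    from convex_steep_before[OF convex_dist_line[OF line' x(1)] _ this, of "- m"] foot_min[OF x(1)]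
    show ?thesis using R by (simp add: \<kappa>_def)
  qed
  have "\<exists>k\<in>{0..1}. d (\<sigma> m) (pt x y k) \<le> R"
    if xy: "x \<in> M" "y \<in> M" "foot x \<le> m - T" "m + T \<le> foot y" for x y m
  proof -
    let ?A = "d x (\<sigma> m)" and ?B = "d y (\<sigma> m)" and ?D = "d x y"
    have tri: "?D \<le> ?A + ?B" "?A \<le> ?D + ?B" "?B \<le> ?D + ?A"
      using triangle[of x "\<sigma> m" y] triangle[of x y "\<sigma> m"] triangle[of y x "\<sigma> m"] xy
      by (simp_all add: mdist_commute)
    obtain k where k: "0 \<le> k" "k \<le> 1" and bal: "k * ?D - ?A = (1 - k) * ?D - ?B"
    proof (cases "?D = 0")
      case True
      then show thesis using that[of 0] tri by simp
    next
      case False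
      then have D: "?D > 0" using nonneg[of x y] by linarith
      show thesis
      proof (rule that[of "(?D + ?A - ?B) / (2 * ?D)"])
        show "0 \<le> (?D + ?A - ?B) / (2 * ?D)" "(?D + ?A - ?B) / (2 * ?D) \<le> 1"
          using D tri by (auto simp: divide_le_eq)
        show "(?D + ?A - ?B) / (2 * ?D) * ?D - ?A = (1 - (?D + ?A - ?B) / (2 * ?D)) * ?D - ?B"
          using D by (simp add: field_simps)
      qed
    qed
    let ?z = "pt x y k"
    have z: "?z \<in> M" using xy k by (intro pt_in)
    define \<beta> where "\<beta> = k * ?D - ?A"
    have zx: "d ?z x = ?A + \<beta>" and zy: "d ?z y = ?B + \<beta>"
      using pt_dist[OF xy(1,2) k] bal by (simp_all add: \<beta>_def mdist_commute)
    have \<beta>: "\<beta> \<le> 0" using bal tri by (simp add: \<beta>_def algebra_simps)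
    have "d ?z (\<sigma> m) \<le> R"
    proof (rule ccontr)
      assume "\<not> ?thesis"
      then have far: "R \<le> d ?z (\<sigma> m)" by simp
      let ?\<psi> = "\<lambda>t. d ?z (\<sigma> t)" and ?\<rho> = "d ?z (\<sigma> m)"
      have lp: "geodesic_line X (\<lambda>t. \<sigma> (m + t))" and lm: "geodesic_line X (\<lambda>t. \<sigma> (m - t))"
        by (auto simp: geodesic_line_def)
      have up: "?\<psi> (m + t) \<le> ?\<rho> + t\<^sup>2 / (2 * R) + R / 100" if "0 \<le> t" "t \<le> R" for t
        using balanced_point_bound[OF lp xy(2) z R _ _ \<beta> that] right[OF xy(2,4)] zy far by (simp add: \<kappa>_def)
      have um: "?\<psi> (m - t) \<le> ?\<rho> + t\<^sup>2 / (2 * R) + R / 100" if "0 \<le> t" "t \<le> R" for t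
        using balanced_point_bound[OF lm xy(1) z R _ _ \<beta> that] left[OF xy(1,3)] zx far by (simp add: \<kappa>_def)
      have sq: "R\<^sup>2 / (2 * R) = R / 2" "(R / 4)\<^sup>2 / (2 * R) = R / 32" using R by (simp_all add: power2_eq_square)
      have u1: "?\<psi> (m + R) \<le> ?\<rho> + R / 2 + R / 100" "?\<psi> (m - R) \<le> ?\<rho> + R / 2 + R / 100"
        "?\<psi> (m + R / 4) \<le> ?\<rho> + R / 32 + R / 100" "?\<psi> (m - R / 4) \<le> ?\<rho> + R / 32 + R / 100"
        using up[of R] um[of R] up[of "R / 4"] um[of "R / 4"] R unfolding sq by simp_all
      \<comment> \<open>Convexity gives lower bounds at \<open>m - R / 4\<close> and \<open>m + R
        / 4\<close>. Over the remaining length \<open>3 * R / 4\<close> up to \<open>m + R\<close>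
        the increase is at most \<open>(1/2 + 1/32 + 2/100) * R\<close>, hence the slope is less
        than \<open>3 / 4\<close>.\<close>
      have "(R / 2) * ?\<rho> \<le> (R / 4) * ?\<psi> (m - R / 4) + (R / 4) * ?\<psi> (m + R / 4)"
        using convex_three_points[OF convex_dist[OF z], of "m - R / 4" m "m + R / 4"] R by simp
      then have "(R / 4) * (2 * ?\<rho>) \<le> (R / 4) * (?\<psi> (m - R / 4) + ?\<psi> (m + R / 4))" by (simp add: algebra_simps)
      then have mid: "2 * ?\<rho> \<le> ?\<psi> (m - R / 4) + ?\<psi> (m + R / 4)" using R by (simp only: mult_le_cancel_left_pos)
      have slope: "\<bar>?\<psi> s - ?\<psi> t\<bar> \<le> 3/4 * \<bar>s - t\<bar>" if st: "m - R / 4 \<le> s" "s < t" "t \<le> m + R / 4" for s t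
      proof -
        have "(?\<psi> t - ?\<psi> s) / (t - s) \<le> (?\<psi> (m + R) - ?\<psi> (m + R / 4)) / (m + R - (m + R / 4))"
          using st R by (intro convex_slope_mono[OF convex_dist[OF z]]) auto
        also have "\<dots> \<le> 3 / 4" using u1 mid R by (simp add: divide_le_eq)
        finally have 1: "?\<psi> t - ?\<psi> s \<le> 3/4 * (t - s)" using st by (simp add: pos_divide_le_eq)
        have "- (3/4) \<le> (?\<psi> (m - R / 4) - ?\<psi> (m - R)) / (m - R / 4 - (m - R))"
          using u1 mid R by (simp add: le_divide_eq)
        also have "\<dots> \<le> (?\<psi> t - ?\<psi> s) / (t - s)"
          using st R by (intro convex_slope_mono[OF convex_dist[OF z]]) auto
        finally have "- (3/4) * (t - s) \<le> ?\<psi> t - ?\<psi> s" using st by (simp add: pos_le_divide_eq)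
        moreover have "\<bar>s - t\<bar> = t - s" using st by simp
        ultimately show ?thesis using 1 by (simp only: abs_le_iff) linarith
      qed
      have "\<bar>?\<psi> s - ?\<psi> t\<bar> \<le> 3/4 * \<bar>s - t\<bar>" if "s \<in> {m - R / 4..m + R / 4}" "t \<in> {m - R / 4..m + R / 4}" for s t
        using slope[of s t] slope[of t s] that
        by (cases s t rule: linorder_cases) (auto simp: abs_minus_commute)
      then have "(m + R / 4) - (m - R / 4) \<le> L1" by (intro L1[OF z]) blast
      then show False by (simp add: R_def)
    qed
    then show ?thesis using k by (intro bexI[of _ k]) (auto simp: mdist_commute)
  qed
  moreover have "0 < T" using R by (simp add: T_def)
  ultimately show thesis using R by (intro that[of T R]) auto
qed

end

section \<open>Independent rank one isometries\<close>

lemma funpow_isometry: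
  assumes "f \<in> carrier (isometry_group X)"
  shows "x \<in> mspace X \<Longrightarrow> (f ^^ n) x \<in> mspace X"
    "x \<in> mspace X \<Longrightarrow> y \<in> mspace X \<Longrightarrow> mdist X ((f ^^ n) x) ((f ^^ n) y) = mdist X x y"
proof -
  show *: "(f ^^ n) x \<in> mspace X" if "x \<in> mspace X" for x
    by (induction n) (use isometryD(2)[OF assms] that in auto)
  show "mdist X ((f ^^ n) x) ((f ^^ n) y) = mdist X x y" if "x \<in> mspace X" "y \<in> mspace X"
  proof (induction n)
    case (Suc n)
    have "(f ^^ n) x \<in> mspace X" "(f ^^ n) y \<in> mspace X"
      by (induction n) (use isometryD(2)[OF assms] that in auto)
    then show ?case using Suc isometryD(3)[OF assms] by simp
  qed simp
qed

lemma (in cn_space) isometry_pt: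
  assumes iso: "\<And>x. x \<in> M \<Longrightarrow> f x \<in> M" "\<And>x y. x \<in> M \<Longrightarrow> y \<in> M \<Longrightarrow> d (f x) (f y) = d x y"
    and "x \<in> M" "y \<in> M" "0 \<le> k" "k \<le> 1"
  shows "f (pt x y k) = pt (f x) (f y) k"
  using assms pt_in[OF assms(3-6)] pt_dist[OF assms(3-6)] by (intro pt_unique) auto

lemma (in cn_space) isometry_ray:
  assumes "\<And>x. x \<in> M \<Longrightarrow> f x \<in> M" "\<And>x y. x \<in> M \<Longrightarrow> y \<in> M \<Longrightarrow> d (f x) (f y) = d x y"
    and "geodesic_ray X \<rho>"
  shows "geodesic_ray X (f \<circ> \<rho>)"
  using assms by (auto simp: geodesic_ray_def image_subset_iff)

lemma (in cn_space) ray_pt: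
  assumes "geodesic_ray X \<rho>" "0 \<le> s" "s \<le> t" "0 \<le> k" "k \<le> 1"
  shows "pt (\<rho> s) (\<rho> t) k = \<rho> ((1 - k) * s + k * t)"
  using geodesic_point[of s t \<rho> k] assms geodesic_rayD[OF assms(1)] by (auto simp: image_subset_iff)

text \<open>If the geodesic from the start of \<open>\<rho>0\<close> to a far point of the asymptotic ray
\<open>\<rho>\<close> passes near \<open>q\<close>, then so does \<open>\<rho>0\<close>. At the
far end the geodesic and \<open>\<rho>0\<close> are separated by at most the constant
\<open>?C\<close>, and at the place near \<open>q\<close> this has shrunk below \<open>1\<close>.\<close>

lemma (in cn_space) asymptotic_ray_passes:
  assumes as: "(\<rho>0, \<rho>) \<in> asymptotic X" and q: "q \<in> M" and k: "0 \<le> k" "k \<le> 1"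
    and near: "d q (pt (\<rho>0 0) (\<rho> t) k) \<le> c"
    and t: "d (\<rho>0 0) (\<rho> 0) * (d (\<rho>0 0) q + c + 1) \<le> t" "0 \<le> t" and c: "0 < c"
  shows "\<exists>s\<ge>0. d q (\<rho>0 s) \<le> c + 1"
proof -
  note ray = asymptoticD(1,2)[OF as]
  let ?C = "d (\<rho>0 0) (\<rho> 0)" and ?x = "\<rho>0 0" and ?w = "pt (\<rho>0 0) (\<rho> t) k" and ?S = "d (\<rho>0 0) q + c"
  have in0: "?x \<in> M" "\<rho> t \<in> M" "\<rho>0 t \<in> M" "\<rho> 0 \<in> M"
    using geodesic_rayD(1)[OF ray(1)] geodesic_rayD(1)[OF ray(2)] t by auto
  have w: "?w \<in> M" using in0 k by (intro pt_in)
  have "pt ?x (\<rho>0 t) k = \<rho>0 (k * t)" using ray_pt[OF ray(1), of 0 t k] k t by simp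
  then have "d ?w (\<rho>0 (k * t)) \<le> k * d (\<rho> t) (\<rho>0 t)"
    using dist_pt_common_start[of ?x "\<rho> t" "\<rho>0 t" k] in0 k by simp
  also have "\<dots> \<le> k * ?C" using asymptoticD(3)[OF as t(2)] k by (simp add: mdist_commute mult_left_mono)
  also have "k * ?C \<le> 1"
  proof -
    have "t \<le> d ?x (\<rho> t) + ?C"
      using triangle[of "\<rho> 0" ?x "\<rho> t"] in0 geodesic_rayD(2)[OF ray(2), of 0 t] t by (simp add: mdist_commute)
    then have "k * t \<le> k * (d ?x (\<rho> t) + ?C)" using k by (intro mult_left_mono)
    also have "\<dots> = d ?x ?w + k * ?C" using pt_dist1[of ?x "\<rho> t" k] in0 k by (simp add: distrib_left)
    also have "\<dots> \<le> ?S + k * ?C" using triangle[of ?x q ?w] in0 q w near by simp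
    finally have "k * (?C * (?S + 1)) \<le> ?S + k * ?C"
      using mult_left_mono[OF t(1) k(1)] by (simp add: add.assoc)
    then have "(k * ?C) * ?S \<le> 1 * ?S" by (simp add: algebra_simps)
    moreover have "0 < ?S" using c nonneg[of ?x q] by linarith
    ultimately show ?thesis by (simp only: mult_le_cancel_right_pos)
  qed
  finally have "d q (\<rho>0 (k * t)) \<le> c + 1"
    using triangle[of q ?w "\<rho>0 (k * t)"] near q w geodesic_rayD(1)[OF ray(1), of "k * t"] k t by simp
  then show ?thesis using k t by (intro exI[of _ "k * t"]) auto
qed

lemma (in cn_space) asymptotic_isometry:
  assumes iso: "\<And>x. x \<in> M \<Longrightarrow> f x \<in> M" "\<And>x y. x \<in> M \<Longrightarrow> y \<in> M \<Longrightarrow> d (f x) (f y) = d x y"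
    and as: "(\<rho>, \<rho>') \<in> asymptotic X"
  shows "(f \<circ> \<rho>, f \<circ> \<rho>') \<in> asymptotic X"
proof -
  note ray = asymptoticD(1,2)[OF as]
  have "d ((f \<circ> \<rho>) t) ((f \<circ> \<rho>') t) \<le> d (\<rho> 0) (\<rho>' 0)" if "t \<ge> 0" for t
    using asymptoticD(3)[OF as that] iso(2) geodesic_rayD(1)[OF ray(1) that] geodesic_rayD(1)[OF ray(2) that]
    by simp
  then show ?thesis using isometry_ray[of f] iso ray by (auto simp: asymptotic_def)
qed

text \<open>Bounded displacement along a ray means that the image ray is asymptotic to it. This is how
independence, a condition on fixed points, is contradicted.\<close>

lemma (in cn_space) fixed_point_of_bounded_displacement:
  assumes f: "f \<in> carrier (isometry_group X)" and \<rho>: "geodesic_ray X \<rho>"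
    and bd: "\<And>t. 0 \<le> t \<Longrightarrow> d (f (\<rho> t)) (\<rho> t) \<le> C"
  shows "Inr (asymptotic X `` {\<rho>}) \<in> fixed_points X f"
proof -
  note eq = equiv_asymptotic[unfolded equiv_def]
  have "(f \<circ> \<rho>, \<rho>) \<in> asymptotic X"
    using isometry_ray[OF isometryD(2,3)[OF f] \<rho>] \<rho> bd by (auto simp: asymptotic_def)
  then have f\<rho>: "(\<rho>, f \<circ> \<rho>) \<in> asymptotic X" using eq by (auto dest: symD)
  have "boundary_action X f (asymptotic X `` {\<rho>}) = asymptotic X `` {\<rho>}"
  proof (intro Set.set_eqI iffI)
    fix \<tau> assume "\<tau> \<in> boundary_action X f (asymptotic X `` {\<rho>})"
    then obtain \<rho>' where "(\<rho>, \<rho>') \<in> asymptotic X" "(f \<circ> \<rho>', \<tau>) \<in> asymptotic X"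
      by (auto simp: boundary_action_def)
    then show "\<tau> \<in> asymptotic X `` {\<rho>}"
      using asymptotic_isometry[OF isometryD(2,3)[OF f]] f\<rho> eq by (meson ImageI insertI1 transD)
  next
    fix \<tau> assume "\<tau> \<in> asymptotic X `` {\<rho>}"
    then have "(f \<circ> \<rho>, \<tau>) \<in> asymptotic X" using f\<rho> eq by (meson Image_singleton_iff symD transD)
    moreover have "(\<rho>, \<rho>) \<in> asymptotic X" using f\<rho> eq by (meson symD transD)
    ultimately show "\<tau> \<in> boundary_action X f (asymptotic X `` {\<rho>})"
      by (auto simp: boundary_action_def)
  qed
  moreover have "asymptotic X `` {\<rho>} \<in> boundary X"
    unfolding boundary_def using \<rho> by (intro quotientI) simp
  ultimately show ?thesis by (simp add: fixed_points_def)
qed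

context rank_one_axis
begin

lemmas funpow_in = funpow_isometry(1)[OF isometry]
lemmas funpow_dist = funpow_isometry(2)[OF isometry]

lemma foot_funpow: "x \<in> M \<Longrightarrow> foot ((f ^^ n) x) = foot x + real n * l"
  by (induction n) (simp_all add: foot_shift funpow_in algebra_simps)

text \<open>Independence concerns \<open>f\<close> itself, while the arguments below produce powers. A high
multiple of the power moves the projection of \<open>\<rho> t\<close> by more than the contraction
constant, so the geodesic from \<open>\<rho> t\<close> to its image, which has bounded length,
passes near the axis. Therefore \<open>\<rho> t\<close> stays near the axis, where
\<open>f\<close> has small displacement.\<close>

lemma bounded_displacement_of_power:
  assumes j: "0 < j" and \<rho>: "\<And>t. 0 \<le> t \<Longrightarrow> \<rho> t \<in> M"
    and bd: "\<And>t. 0 \<le> t \<Longrightarrow> d ((f ^^ j) (\<rho> t)) (\<rho> t) \<le> C"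
  shows "\<exists>C'. \<forall>t\<ge>0. d (f (\<rho> t)) (\<rho> t) \<le> C'"
proof -
  obtain T c where T: "0 < T" "0 < c" and contr: "\<And>x y m. \<lbrakk>x \<in> M; y \<in> M; foot x \<le> m - T; m + T \<le> foot y\<rbrakk> \<Longrightarrow>
    \<exists>k\<in>{0..1}. d (\<sigma> m) (pt x y k) \<le> c" using axis_contracting by metis
  define n where "n = nat \<lceil>2 * T / l\<rceil>"
  have "2 * T / l \<le> real n" unfolding n_def by linarith
  then have "2 * T \<le> real n * l" using l_pos by (simp add: pos_divide_le_eq)
  also have "\<dots> \<le> real (j * n) * l"
  proof (rule mult_right_mono)
    have "1 * n \<le> j * n" using j by (intro mult_le_mono1) simp
    then show "real n \<le> real (j * n)" by (simp only: of_nat_le_iff mult_1)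
  qed (use l_pos in simp)
  finally have nT: "2 * T \<le> real (j * n) * l" .
  have iter: "d ((f ^^ (j * n)) (\<rho> t)) (\<rho> t) \<le> real n * C" if t: "0 \<le> t" for t n
  proof (induction n)
    case (Suc n)
    let ?u = "(f ^^ (j * n)) (\<rho> t)"
    have "(f ^^ (j * Suc n)) (\<rho> t) = (f ^^ j) ?u" by (simp add: funpow_add)
    then have "d ((f ^^ (j * Suc n)) (\<rho> t)) (\<rho> t) \<le> d ((f ^^ j) ?u) ((f ^^ j) (\<rho> t)) + d ((f ^^ j) (\<rho> t)) (\<rho> t)"
      using \<rho>[OF t] triangle by (simp add: funpow_in)
    also have "d ((f ^^ j) ?u) ((f ^^ j) (\<rho> t)) = d ?u (\<rho> t)" using \<rho>[OF t] by (intro funpow_dist funpow_in)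
    finally show ?case using Suc bd[OF t] by (simp add: algebra_simps)
  qed (use \<rho>[OF t] in simp)
  have "d (f (\<rho> t)) (\<rho> t) \<le> 2 * (real n * C + c) + l" if t: "0 \<le> t" for t
  proof -
    let ?x = "\<rho> t" and ?y = "(f ^^ (j * n)) (\<rho> t)"
    have xy: "?x \<in> M" "?y \<in> M" using \<rho>[OF t] funpow_in by auto
    define m where "m = foot ?x + T"
    have "foot ?y = foot ?x + real (j * n) * l" using xy by (intro foot_funpow)
    then obtain k where k: "k \<in> {0..1}" "d (\<sigma> m) (pt ?x ?y k) \<le> c"
      using contr[of ?x ?y m] xy nT by (auto simp: m_def)
    have p: "pt ?x ?y k \<in> M" using xy k by (intro pt_in) auto
    have "d ?x (pt ?x ?y k) \<le> d ?x ?y" using pt_dist1[of ?x ?y k] xy k by (simp add: mult_left_le_one_le)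
    also have "\<dots> \<le> real n * C" using iter[OF t, of n] by (simp add: mdist_commute)
    finally have x\<sigma>: "d ?x (\<sigma> m) \<le> real n * C + c"
      using triangle[of ?x "pt ?x ?y k" "\<sigma> m"] xy p k by (simp add: mdist_commute)
    have "d (f ?x) ?x \<le> d (f ?x) (\<sigma> (m + l)) + d (\<sigma> (m + l)) (\<sigma> m) + d (\<sigma> m) ?x"
      using triangle[of "f ?x" "\<sigma> (m + l)" ?x] triangle[of "\<sigma> (m + l)" "\<sigma> m" ?x] xy by force
    then show ?thesis using x\<sigma> dist_shift[OF xy(1), of m] l_pos by (simp add: mdist_commute)
  qed
  then show ?thesis by blast
qed

text \<open>A geodesic from a point of the ray that projects far in the negative direction back to
\<open>\<rho> 0\<close> runs along the axis, by contraction.\<close>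

lemma asymptotic_to_negative_end:
  assumes \<rho>: "geodesic_ray X \<rho>" and unb: "\<And>B. \<exists>t\<ge>0. foot (\<rho> t) < B"
  shows "\<exists>C. \<forall>t\<ge>0. d (\<rho> t) (\<sigma> (- t)) \<le> C"
proof -
  obtain T c where T: "0 < T" "0 < c" and contr: "\<And>x y m. \<lbrakk>x \<in> M; y \<in> M; foot x \<le> m - T; m + T \<le> foot y\<rbrakk> \<Longrightarrow>
    \<exists>k\<in>{0..1}. d (\<sigma> m) (pt x y k) \<le> c" using axis_contracting by metis
  note \<rho>in = geodesic_rayD(1)[OF \<rho>]
  define e where "e = d (\<rho> 0) (\<sigma> 0)"
  \<comment> \<open>For \<open>t \<ge> t0\<close> the point \<open>\<sigma> (- t)\<close> lies
    before the projection of \<open>\<rho> 0\<close> by at least the contraction constant.\<close>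
  define t0 where "t0 = max 0 (T - foot (\<rho> 0))"
  have "d (\<rho> t) (\<sigma> (- t)) \<le> 2 * c + e + 2 * t0" if t: "0 \<le> t" for t
  proof (cases "t0 \<le> t")
    case True
    obtain t' where t': "t' \<ge> 0" "foot (\<rho> t') < - t - T" using unb by blast
    have "\<exists>k\<in>{0..1}. d (\<sigma> (- t)) (pt (\<rho> t') (\<rho> 0) k) \<le> c"
      using t' True \<rho>in by (intro contr) (auto simp: t0_def)
    then obtain k where k: "k \<in> {0..1}" "d (\<sigma> (- t)) (pt (\<rho> t') (\<rho> 0) k) \<le> c" by blast
    define u where "u = (1 - k) * t'"
    have "pt (\<rho> t') (\<rho> 0) k = \<rho> u"
      using ray_pt[OF \<rho>, of 0 t' "1 - k"] k t' pt_swap[of "\<rho> t'" "\<rho> 0" k] \<rho>in by (simp add: u_def)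
    then have u: "u \<ge> 0" "d (\<sigma> (- t)) (\<rho> u) \<le> c" using k t' by (auto simp: u_def)
    have "u = d (\<rho> 0) (\<rho> u)" "t = d (\<sigma> 0) (\<sigma> (- t))"
      using geodesic_rayD(2)[OF \<rho>, of 0 u] u t by auto
    moreover have "d (\<rho> 0) (\<rho> u) \<le> d (\<rho> 0) (\<sigma> 0) + d (\<sigma> 0) (\<sigma> (- t)) + d (\<sigma> (- t)) (\<rho> u)"
      using triangle[of "\<rho> 0" "\<sigma> 0" "\<rho> u"] triangle[of "\<sigma> 0" "\<sigma> (- t)" "\<rho> u"] \<rho>in u(1) by force
    moreover have "d (\<sigma> 0) (\<sigma> (- t)) \<le> d (\<rho> 0) (\<sigma> 0) + d (\<rho> 0) (\<rho> u) + d (\<sigma> (- t)) (\<rho> u)"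
      using triangle[of "\<sigma> 0" "\<rho> 0" "\<sigma> (- t)"] triangle[of "\<rho> 0" "\<rho> u" "\<sigma> (- t)"] \<rho>in u(1)
      by (force simp: mdist_commute)
    ultimately have "\<bar>t - u\<bar> \<le> c + e" using u(2) unfolding e_def by linarith
    then have "d (\<rho> t) (\<rho> u) \<le> c + e" using geodesic_rayD(2)[OF \<rho> t u(1)] by simp
    moreover have "d (\<rho> t) (\<sigma> (- t)) \<le> d (\<rho> t) (\<rho> u) + d (\<sigma> (- t)) (\<rho> u)"
      using triangle[of "\<rho> t" "\<rho> u" "\<sigma> (- t)"] \<rho>in t u(1) by (simp add: mdist_commute)
    moreover have "0 \<le> t0" by (simp add: t0_def)
    ultimately show ?thesis using u(2) by linarith
  next
    case False
    have "d (\<rho> t) (\<sigma> (- t)) \<le> d (\<rho> t) (\<rho> 0) + d (\<rho> 0) (\<sigma> 0) + d (\<sigma> 0) (\<sigma> (- t))"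
      using triangle[of "\<rho> t" "\<rho> 0" "\<sigma> (- t)"] triangle[of "\<rho> 0" "\<sigma> 0" "\<sigma> (- t)"] \<rho>in t by force
    then show ?thesis using geodesic_rayD(2)[OF \<rho>, of t 0] t False T by (simp add: e_def)
  qed
  then show ?thesis by blast
qed

text \<open>Let \<open>y\<close> and \<open>G y\<close> both project beyond \<open>\<sigma> t\<close>. The
geodesics from \<open>\<sigma> 0\<close> to \<open>y\<close> and to \<open>G y\<close> pass near
\<open>\<sigma> t\<close>, and so does the image under \<open>G\<close> of the former, which ends
at \<open>G y\<close> and starts at a fixed distance from \<open>\<sigma> 0\<close>. Comparing the
positions on these geodesics shows that \<open>G\<close> moves \<open>\<sigma> t\<close> by a
bounded amount.\<close>

lemma bounded_displacement_of_positive_end: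
  assumes iso: "\<And>x. x \<in> M \<Longrightarrow> G x \<in> M" "\<And>x y. x \<in> M \<Longrightarrow> y \<in> M \<Longrightarrow> d (G x) (G y) = d x y"
    and unb: "\<And>B. \<exists>y\<in>M. B < foot y \<and> B < foot (G y)"
  shows "\<exists>C. \<forall>t\<ge>0. d (G (\<sigma> t)) (\<sigma> t) \<le> C"
proof -
  obtain T c where T: "0 < T" "0 < c" and contr: "\<And>x y m. \<lbrakk>x \<in> M; y \<in> M; foot x \<le> m - T; m + T \<le> foot y\<rbrakk> \<Longrightarrow>
    \<exists>k\<in>{0..1}. d (\<sigma> m) (pt x y k) \<le> c" using axis_contracting by metis
  define o' where "o' = \<sigma> 0"
  define e where "e = d o' (G o')"
  have o: "o' \<in> M" "G o' \<in> M" using iso(1) by (auto simp: o'_def)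
  have far: "d (G (\<sigma> t)) (\<sigma> t) \<le> 4 * c + 3 * e" if t: "T \<le> t" for t
  proof -
    obtain y where y: "y \<in> M" "t + T < foot y" "t + T < foot (G y)" using unb by blast
    have Gy: "G y \<in> M" using iso(1) y by simp
    have fo: "foot o' \<le> t - T" using t by (simp add: o'_def)
    obtain k1 where k1: "0 \<le> k1" "k1 \<le> 1" "d (\<sigma> t) (pt o' y k1) \<le> c"
      using contr[of o' y t] o y fo by auto
    obtain k2 where k2: "0 \<le> k2" "k2 \<le> 1" "d (\<sigma> t) (pt o' (G y) k2) \<le> c"
      using contr[of o' "G y" t] o y Gy fo by auto
    let ?v = "pt o' y k1" and ?u = "pt (G o') (G y) k1" and ?u' = "pt o' (G y) k1" and ?u'' = "pt o' (G y) k2"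
    have in_M: "?v \<in> M" "?u \<in> M" "?u' \<in> M" "?u'' \<in> M" "\<sigma> t \<in> M" "G (\<sigma> t) \<in> M"
      using o y Gy k1 k2 iso(1) by (auto intro: pt_in)
    have Gv: "G ?v = ?u" by (rule isometry_pt[OF iso o(1) y(1) k1(1,2)])
    have 1: "d (G (\<sigma> t)) ?u \<le> c" using iso(2)[of "\<sigma> t" ?v] in_M k1(3) by (simp add: Gv)
    have "d ?u ?u' \<le> (1 - k1) * d (G o') o'" using dist_pt_common_end[of "G y" "G o'" o' k1] o Gy k1 by simp
    also have "\<dots> \<le> 1 * d (G o') o'" using k1 by (intro mult_right_mono) auto
    finally have 2: "d ?u ?u' \<le> e" by (simp add: e_def mdist_commute)
    have ov: "d (G o') ?u = d o' ?v" using iso(2)[of o' ?v] o in_M by (simp add: Gv)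
    have ot: "d o' (\<sigma> t) = t" using t T by (simp add: o'_def)
    have "\<bar>d o' ?v - t\<bar> \<le> c"
      using mdist_reverse_triangle[of o' ?v "\<sigma> t"] triangle[of o' ?v "\<sigma> t"] triangle[of o' "\<sigma> t" ?v] o in_M k1(3) ot
      by (simp add: mdist_commute abs_le_iff)
    moreover have "\<bar>d o' ?u'' - t\<bar> \<le> c"
      using triangle[of o' ?u'' "\<sigma> t"] triangle[of o' "\<sigma> t" ?u''] o in_M k2(3) ot
      by (simp add: mdist_commute abs_le_iff)
    moreover have "\<bar>d o' ?u' - d (G o') ?u\<bar> \<le> 2 * e"
    proof -
      have "d o' ?u' \<le> d o' (G o') + d (G o') ?u + d ?u ?u'"
        using triangle[of o' "G o'" ?u'] triangle[of "G o'" ?u ?u'] o in_M by force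
      moreover have "d (G o') ?u \<le> d (G o') o' + d o' ?u' + d ?u' ?u"
        using triangle[of "G o'" o' ?u] triangle[of o' ?u' ?u] o in_M by force
      ultimately show ?thesis using 2 by (simp add: e_def mdist_commute abs_le_iff)
    qed
    ultimately have "\<bar>d o' ?u' - d o' ?u''\<bar> \<le> 2 * c + 2 * e" using ov by linarith
    moreover have "d ?u' ?u'' = \<bar>d o' ?u' - d o' ?u''\<bar>"
    proof -
      have "d o' ?u' - d o' ?u'' = (k1 - k2) * d o' (G y)"
        using pt_dist1[OF o(1) Gy] k1 k2 by (simp add: left_diff_distrib)
      then show ?thesis using dist_same_segment[OF o(1) Gy k1(1,2) k2(1,2)] by (simp add: abs_mult)
    qed
    moreover have "d (G (\<sigma> t)) (\<sigma> t) \<le> d (G (\<sigma> t)) ?u + d ?u ?u' + d ?u' ?u'' + d ?u'' (\<sigma> t)"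
      using triangle[of "G (\<sigma> t)" ?u "\<sigma> t"] triangle[of ?u ?u' "\<sigma> t"] triangle[of ?u' ?u'' "\<sigma> t"] in_M by force
    ultimately show ?thesis using 1 2 k2(3) mdist_commute[of X ?u'' "\<sigma> t"] by linarith
  qed
  have e0: "0 \<le> e" by (simp add: e_def)
  have "d (G (\<sigma> t)) (\<sigma> t) \<le> 4 * c + 3 * e + 2 * T" if t: "0 \<le> t" for t
  proof (cases "T \<le> t")
    case True then show ?thesis using far[OF True] T by simp
  next
    case False
    have "d (G (\<sigma> t)) (\<sigma> t) \<le> d (G (\<sigma> t)) (G (\<sigma> T)) + d (G (\<sigma> T)) (\<sigma> T) + d (\<sigma> T) (\<sigma> t)"
      using triangle[of "G (\<sigma> t)" "G (\<sigma> T)" "\<sigma> t"] triangle[of "G (\<sigma> T)" "\<sigma> T" "\<sigma> t"] iso(1) by force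
    then show ?thesis using iso(2)[of "\<sigma> t" "\<sigma> T"] far[of T] False t by simp
  qed
  then show ?thesis by blast
qed

end

text \<open>What is used of a pair of independent rank one isometries, in terms of the projection
\<open>F\<close> to the axis \<open>\<sigma>\<close> of \<open>h\<close>. The last two axioms
record independence: a nontrivial power of \<open>g\<close> takes no points near the positive end
to points near that end, and for no ray do two different powers of \<open>g\<close> both take it
to the negative end. \<open>F_stays\<close> says that a ray which has moved far in the positive
direction does not come back.\<close>

locale contracting_coordinate = proper_cn_space X for X :: "'a metric" +
  fixes g h :: "'a \<Rightarrow> 'a" and F :: "'a \<Rightarrow> real" and \<sigma> :: "real \<Rightarrow> 'a" and l T c K :: real
  assumes pos: "0 < l" "0 < T" "0 < c" "0 \<le> K"
    and g_iso: "g \<in> carrier (isometry_group X)" and h_iso: "h \<in> carrier (isometry_group X)"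
    and \<sigma>_in [simp]: "\<sigma> m \<in> mspace X" and F_\<sigma>: "F (\<sigma> m) = m"
    and F_shift: "x \<in> mspace X \<Longrightarrow> F (h x) = F x + l"
    and F_lipschitz: "x \<in> mspace X \<Longrightarrow> y \<in> mspace X \<Longrightarrow> \<bar>F x - F y\<bar> \<le> mdist X x y"
    and contracting: "\<lbrakk>x \<in> mspace X; y \<in> mspace X; F x \<le> m - T; m + T \<le> F y\<rbrakk> \<Longrightarrow>
      \<exists>k\<in>{0..1}. mdist X (\<sigma> m) (pt x y k) \<le> c"
    and F_stays: "\<lbrakk>geodesic_ray X \<rho>; F (\<rho> 0) \<le> a; 0 \<le> t0; a + K \<le> F (\<rho> t0); t0 \<le> t\<rbrakk> \<Longrightarrow> a \<le> F (\<rho> t)"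
    and F_points: "0 < j \<Longrightarrow> \<exists>B. \<forall>y\<in>mspace X. F y \<le> B \<or> F ((g ^^ j) y) \<le> B"
    and F_rays: "\<lbrakk>geodesic_ray X \<rho>; j < k\<rbrakk> \<Longrightarrow>
      (\<exists>B. \<forall>t\<ge>0. B \<le> F ((g ^^ j) (\<rho> t))) \<or> (\<exists>B. \<forall>t\<ge>0. B \<le> F ((g ^^ k) (\<rho> t)))"

text \<open>If one of the last two axioms fails, then a power of \<open>g\<close> has bounded displacement
along one half of the axis of \<open>h\<close>, and \<open>g\<close> and \<open>h\<close> have a
common fixed point at infinity.\<close>

lemma contracting_coordinate_exists:
  assumes X: "proper_cn_space X" and ind: "independent_rank_one X g h"
  shows "\<exists>F \<sigma> l T c K. contracting_coordinate X g h F \<sigma> l T c K"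
proof -
  interpret proper_cn_space X by (rule X)
  obtain l \<sigma> where h: "h \<in> carrier (isometry_group X)" "is_axis X h l \<sigma>" "\<not> bounds_flat_half_plane X \<sigma>"
    using ind by (auto simp: independent_rank_one_def rank_one_isometry_def)
  obtain lg \<tau> where g: "g \<in> carrier (isometry_group X)" "is_axis X g lg \<tau>" "\<not> bounds_flat_half_plane X \<tau>"
    using ind by (auto simp: independent_rank_one_def rank_one_isometry_def)
  have disj: "fixed_points X g \<inter> fixed_points X h = {}" using ind by (simp add: independent_rank_one_def)
  interpret H: rank_one_axis X h l \<sigma> by unfold_locales (use h in auto)
  interpret G: rank_one_axis X g lg \<tau> by unfold_locales (use g in auto)
  obtain T c where T: "0 < T" "0 < c" and contr: "\<And>x y m. \<lbrakk>x \<in> M; y \<in> M; H.foot x \<le> m - T; m + T \<le> H.foot y\<rbrakk> \<Longrightarrow>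
    \<exists>k\<in>{0..1}. d (\<sigma> m) (pt x y k) \<le> c" using H.axis_contracting by metis
  define K where "K = 2 * T + 3 * c + 1"
  have no_common: False
    if \<rho>: "geodesic_ray X \<rho>" and bd_h: "\<And>t. 0 \<le> t \<Longrightarrow> d (h (\<rho> t)) (\<rho> t) \<le> l"
      and j: "0 < j" and bd_g: "\<exists>C. \<forall>t\<ge>0. d ((g ^^ j) (\<rho> t)) (\<rho> t) \<le> C" for \<rho> j
  proof -
    obtain C where "\<And>t. 0 \<le> t \<Longrightarrow> d ((g ^^ j) (\<rho> t)) (\<rho> t) \<le> C" using bd_g by blast
    then obtain C' where "\<And>t. 0 \<le> t \<Longrightarrow> d (g (\<rho> t)) (\<rho> t) \<le> C'"
      using G.bounded_displacement_of_power[OF j, of \<rho> C] geodesic_rayD(1)[OF \<rho>] by blast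
    then have "Inr (asymptotic X `` {\<rho>}) \<in> fixed_points X g"
      using fixed_point_of_bounded_displacement[OF g(1) \<rho>] by blast
    moreover have "Inr (asymptotic X `` {\<rho>}) \<in> fixed_points X h"
      using fixed_point_of_bounded_displacement[OF h(1) \<rho>] bd_h by blast
    ultimately show False using disj by blast
  qed
  \<comment> \<open>A ray that returned would pass near \<open>\<sigma> (a + T)\<close> twice,
    before and after \<open>t0\<close>, hence within a short time, although \<open>\<rho> t0\<close>
    is at distance at least \<open>K - T\<close> from there.\<close>
  have stays: "a \<le> H.foot (\<rho> t)"
    if \<rho>: "geodesic_ray X \<rho>" and a: "H.foot (\<rho> 0) \<le> a" and t: "0 \<le> t0" "a + K \<le> H.foot (\<rho> t0)" "t0 \<le> t" for \<rho> a t0 t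
  proof (rule ccontr)
    assume "\<not> ?thesis"
    then have low: "H.foot (\<rho> t) < a" by simp
    note \<rho>in = geodesic_rayD(1)[OF \<rho>]
    define m where "m = a + T"
    have hi: "m + T \<le> H.foot (\<rho> t0)" using t(2) T by (simp add: m_def K_def)
    obtain k1 where k1: "k1 \<in> {0..1}" "d (\<sigma> m) (pt (\<rho> 0) (\<rho> t0) k1) \<le> c"
      using contr[of "\<rho> 0" "\<rho> t0" m] \<rho>in t(1) a hi by (auto simp: m_def)
    obtain k2 where k2: "k2 \<in> {0..1}" "d (\<sigma> m) (pt (\<rho> t) (\<rho> t0) k2) \<le> c"
      using contr[of "\<rho> t" "\<rho> t0" m] \<rho>in t low hi by (auto simp: m_def)
    define t1 where "t1 = k1 * t0"
    define t2 where "t2 = k2 * t0 + (1 - k2) * t"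
    have p1: "pt (\<rho> 0) (\<rho> t0) k1 = \<rho> t1" using ray_pt[OF \<rho>, of 0 t0 k1] k1 t by (simp add: t1_def)
    have p2: "pt (\<rho> t) (\<rho> t0) k2 = \<rho> t2"
      using ray_pt[OF \<rho>, of t0 t "1 - k2"] k2 t pt_swap[of "\<rho> t" "\<rho> t0" k2] \<rho>in by (simp add: t2_def)
    have t1: "0 \<le> t1" "t1 \<le> t0" using k1 t by (auto simp: t1_def mult_left_le_one_le)
    have "(1 - k2) * t0 \<le> (1 - k2) * t" using k2 t by (intro mult_left_mono) auto
    then have t2: "t0 \<le> t2" by (simp add: t2_def algebra_simps)
    have near: "d (\<sigma> m) (\<rho> t1) \<le> c" "d (\<sigma> m) (\<rho> t2) \<le> c" using k1 k2 by (auto simp: p1 p2)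
    have "d (\<rho> t1) (\<rho> t2) \<le> d (\<sigma> m) (\<rho> t1) + d (\<sigma> m) (\<rho> t2)"
      using triangle[of "\<rho> t1" "\<sigma> m" "\<rho> t2"] \<rho>in t1 t2 by (simp add: mdist_commute)
    then have "t0 - t1 \<le> 2 * c" using geodesic_rayD(2)[OF \<rho>, of t1 t2] t1 t2 near by simp
    then have "d (\<rho> t0) (\<rho> t1) \<le> 2 * c" using geodesic_rayD(2)[OF \<rho>, of t0 t1] t1 t by simp
    then have "d (\<rho> t0) (\<sigma> m) \<le> 3 * c"
      using triangle[of "\<rho> t0" "\<rho> t1" "\<sigma> m"] \<rho>in t1 t near by (simp add: mdist_commute)
    moreover have "H.foot (\<rho> t0) - m \<le> d (\<rho> t0) (\<sigma> m)"
      using abs_le_D1[OF H.foot_near[of "\<rho> t0" m]] \<rho>in[of t0] t by simp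
    ultimately show False using t(2) T(1) unfolding m_def K_def by linarith
  qed
  have "contracting_coordinate X g h H.foot \<sigma> l T c K"
  proof
    show "0 < l" "0 < T" "0 < c" "0 \<le> K" using H.l_pos T by (auto simp: K_def)
    show "g \<in> carrier (isometry_group X)" "h \<in> carrier (isometry_group X)" using g h by auto
    show "\<exists>B. \<forall>y\<in>M. H.foot y \<le> B \<or> H.foot ((g ^^ j) y) \<le> B" if j: "0 < j" for j
    proof (rule ccontr)
      assume "\<not> ?thesis"
      then have "\<exists>y\<in>M. B < H.foot y \<and> B < H.foot ((g ^^ j) y)" for B by (meson not_le)
      from H.bounded_displacement_of_positive_end[OF _ _ this] G.funpow_in G.funpow_dist
      have "\<exists>C. \<forall>t\<ge>0. d ((g ^^ j) (\<sigma> t)) (\<sigma> t) \<le> C" by blast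
      moreover have "geodesic_ray X \<sigma>" by (auto simp: geodesic_ray_def)
      moreover have "d (h (\<sigma> t)) (\<sigma> t) \<le> l" for t using H.shift H.l_pos by simp
      ultimately show False using no_common[OF _ _ j, of \<sigma>] by blast
    qed
    show "(\<exists>B. \<forall>t\<ge>0. B \<le> H.foot ((g ^^ j) (\<rho> t))) \<or> (\<exists>B. \<forall>t\<ge>0. B \<le> H.foot ((g ^^ k) (\<rho> t)))"
      if \<rho>: "geodesic_ray X \<rho>" and jk: "j < k" for \<rho> j k
    proof (rule ccontr)
      assume not: "\<not> ?thesis"
      note \<rho>in = geodesic_rayD(1)[OF \<rho>]
      have ray: "geodesic_ray X ((g ^^ n) \<circ> \<rho>)" for n
        by (rule isometry_ray[OF G.funpow_in G.funpow_dist \<rho>])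
      have "\<exists>C. \<forall>t\<ge>0. d (((g ^^ n) \<circ> \<rho>) t) (\<sigma> (- t)) \<le> C" if "n = j \<or> n = k" for n
      proof (rule H.asymptotic_to_negative_end[OF ray])
        fix B
        have "\<not> (\<forall>t\<ge>0. B \<le> H.foot ((g ^^ n) (\<rho> t)))" using not that by blast
        then show "\<exists>t\<ge>0. H.foot (((g ^^ n) \<circ> \<rho>) t) < B" by (simp add: not_le)
      qed
      then obtain C1 C2 where C: "\<And>t. 0 \<le> t \<Longrightarrow> d ((g ^^ j) (\<rho> t)) (\<sigma> (- t)) \<le> C1"
        "\<And>t. 0 \<le> t \<Longrightarrow> d ((g ^^ k) (\<rho> t)) (\<sigma> (- t)) \<le> C2" by (metis comp_apply)
      have "d ((g ^^ (k - j)) (\<sigma> (- t))) (\<sigma> (- t)) \<le> C1 + C2" if t: "0 \<le> t" for t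
      proof -
        have k: "(g ^^ (k - j)) ((g ^^ j) (\<rho> t)) = (g ^^ k) (\<rho> t)"
          using jk funpow_add[of "k - j" j g] by (simp add: o_def fun_eq_iff)
        have "d ((g ^^ (k - j)) (\<sigma> (- t))) (\<sigma> (- t)) \<le>
          d ((g ^^ (k - j)) (\<sigma> (- t))) ((g ^^ (k - j)) ((g ^^ j) (\<rho> t))) + d ((g ^^ k) (\<rho> t)) (\<sigma> (- t))"
          unfolding k by (intro triangle G.funpow_in \<rho>in t) auto
        also have "d ((g ^^ (k - j)) (\<sigma> (- t))) ((g ^^ (k - j)) ((g ^^ j) (\<rho> t))) = d (\<sigma> (- t)) ((g ^^ j) (\<rho> t))"
          by (intro G.funpow_dist G.funpow_in \<rho>in t) auto
        finally show ?thesis using C[OF t] by (simp add: mdist_commute)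
      qed
      then have "\<exists>C. \<forall>t\<ge>0. d ((g ^^ (k - j)) (\<sigma> (- t))) (\<sigma> (- t)) \<le> C" by blast
      moreover have "geodesic_ray X (\<lambda>t. \<sigma> (- t))" by (auto simp: geodesic_ray_def)
      moreover have "d (h (\<sigma> (- t))) (\<sigma> (- t)) \<le> l" for t using H.shift H.l_pos by simp
      ultimately show False using no_common[of "\<lambda>t. \<sigma> (- t)" "k - j"] jk by fastforce
    qed
  qed (use H.foot_shift H.foot_lipschitz contr stays in auto)
  then show ?thesis by blast
qed

section \<open>Boundary topology\<close>

context cn_space
begin

lemma asymptotic_refl: "geodesic_ray X \<rho> \<Longrightarrow> (\<rho>, \<rho>) \<in> asymptotic X"
  using equiv_asymptotic by (auto simp: equiv_def refl_on_def)

lemma asymptotic_sym: "(\<rho>, \<rho>') \<in> asymptotic X \<Longrightarrow> (\<rho>', \<rho>) \<in> asymptotic X"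
  using equiv_asymptotic by (auto simp: equiv_def dest: symD)

lemma asymptotic_trans:
  "(\<rho>, \<rho>') \<in> asymptotic X \<Longrightarrow> (\<rho>', \<rho>'') \<in> asymptotic X \<Longrightarrow> (\<rho>, \<rho>'') \<in> asymptotic X"
  using equiv_asymptotic by (auto simp: equiv_def dest: transD)

lemma boundaryD:
  assumes "\<xi> \<in> boundary X"
  shows boundary_nonempty: "\<exists>\<rho>. \<rho> \<in> \<xi>" and boundary_ray: "\<rho> \<in> \<xi> \<Longrightarrow> geodesic_ray X \<rho>"
    and boundary_asymptotic: "\<rho> \<in> \<xi> \<Longrightarrow> \<rho>' \<in> \<xi> \<Longrightarrow> (\<rho>, \<rho>') \<in> asymptotic X"
    and boundary_closed: "\<rho> \<in> \<xi> \<Longrightarrow> (\<rho>, \<rho>') \<in> asymptotic X \<Longrightarrow> \<rho>' \<in> \<xi>"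
proof -
  obtain \<rho>0 where \<rho>0: "geodesic_ray X \<rho>0" "\<xi> = asymptotic X `` {\<rho>0}"
    using assms by (auto simp: boundary_def elim!: quotientE)
  show "\<exists>\<rho>. \<rho> \<in> \<xi>" using \<rho>0 asymptotic_refl by auto
  show "\<rho> \<in> \<xi> \<Longrightarrow> geodesic_ray X \<rho>" using \<rho>0 asymptoticD(2) by auto
  show "\<rho> \<in> \<xi> \<Longrightarrow> \<rho>' \<in> \<xi> \<Longrightarrow> (\<rho>, \<rho>') \<in> asymptotic X"
    using asymptotic_trans[OF asymptotic_sym, of \<rho>0 \<rho> \<rho>'] \<rho>0(2) by simp
  show "\<rho> \<in> \<xi> \<Longrightarrow> (\<rho>, \<rho>') \<in> asymptotic X \<Longrightarrow> \<rho>' \<in> \<xi>"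
    using asymptotic_trans[of \<rho>0 \<rho> \<rho>'] \<rho>0(2) by simp
qed

lemma boundary_eq_class:
  assumes "\<xi> \<in> boundary X" "\<rho> \<in> \<xi>" shows "\<xi> = asymptotic X `` {\<rho>}"
  using boundary_asymptotic[OF assms] boundary_closed[OF assms] by auto

lemma class_in_boundary: "geodesic_ray X \<rho> \<Longrightarrow> asymptotic X `` {\<rho>} \<in> boundary X"
  unfolding boundary_def by (intro quotientI) simp

lemma boundary_action_eq:
  assumes iso: "\<And>x. x \<in> M \<Longrightarrow> f x \<in> M" "\<And>x y. x \<in> M \<Longrightarrow> y \<in> M \<Longrightarrow> d (f x) (f y) = d x y"
    and \<xi>: "\<xi> \<in> boundary X" and \<rho>: "\<rho> \<in> \<xi>"
  shows "boundary_action X f \<xi> = asymptotic X `` {f \<circ> \<rho>}" and "f \<circ> \<rho> \<in> boundary_action X f \<xi>"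
    and "boundary_action X f \<xi> \<in> boundary X"
proof -
  have ray: "geodesic_ray X (f \<circ> \<rho>)" using isometry_ray[OF iso boundary_ray[OF \<xi> \<rho>]] .
  show eq: "boundary_action X f \<xi> = asymptotic X `` {f \<circ> \<rho>}"
  proof (intro Set.set_eqI iffI)
    fix \<tau> assume "\<tau> \<in> boundary_action X f \<xi>"
    then obtain \<rho>' where r: "\<rho>' \<in> \<xi>" "(f \<circ> \<rho>', \<tau>) \<in> asymptotic X" by (auto simp: boundary_action_def)
    then have "(f \<circ> \<rho>, f \<circ> \<rho>') \<in> asymptotic X"
      using asymptotic_isometry[OF iso] boundary_asymptotic[OF \<xi> \<rho>] by blast
    then show "\<tau> \<in> asymptotic X `` {f \<circ> \<rho>}" using asymptotic_trans r(2) by blast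
  qed (use \<rho> in \<open>auto simp: boundary_action_def\<close>)
  show "f \<circ> \<rho> \<in> boundary_action X f \<xi>" unfolding eq using asymptotic_refl[OF ray] by simp
  show "boundary_action X f \<xi> \<in> boundary X" unfolding eq by (rule class_in_boundary[OF ray])
qed

lemma boundary_action_inverse:
  assumes iso: "\<And>x. x \<in> M \<Longrightarrow> f x \<in> M" "\<And>x y. x \<in> M \<Longrightarrow> y \<in> M \<Longrightarrow> d (f x) (f y) = d x y"
    and iso': "\<And>x. x \<in> M \<Longrightarrow> f' x \<in> M" "\<And>x y. x \<in> M \<Longrightarrow> y \<in> M \<Longrightarrow> d (f' x) (f' y) = d x y"
    and inv: "\<And>x. x \<in> M \<Longrightarrow> f' (f x) = x" and \<xi>: "\<xi> \<in> boundary X"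
  shows "boundary_action X f' (boundary_action X f \<xi>) = \<xi>"
proof -
  obtain \<rho> where \<rho>: "\<rho> \<in> \<xi>" using boundary_nonempty[OF \<xi>] by blast
  note ray = boundary_ray[OF \<xi> \<rho>]
  note 1 = boundary_action_eq[OF iso \<xi> \<rho>]
  have "geodesic_ray X (f' \<circ> (f \<circ> \<rho>))" by (rule isometry_ray[OF iso' isometry_ray[OF iso ray]])
  then have "(f' \<circ> (f \<circ> \<rho>), \<rho>) \<in> asymptotic X"
    using ray geodesic_rayD(1)[OF ray] inv by (auto simp: asymptotic_def intro!: exI[of _ 0])
  then have "f' \<circ> (f \<circ> \<rho>) \<in> \<xi>" using boundary_closed[OF \<xi> \<rho>] asymptotic_sym by blast
  from boundary_eq_class[OF \<xi> this] have "\<xi> = asymptotic X `` {f' \<circ> (f \<circ> \<rho>)}" .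
  then show ?thesis using boundary_action_eq(1)[OF iso' 1(3,2)] by (simp only:)
qed

lemma openin_boundary_topology:
  "openin (boundary_topology X) U \<longleftrightarrow> (\<exists>V. openin (cone_topology X) V \<and> U = Inr -` V \<inter> boundary X)"
  by (simp add: boundary_topology_def openin_pullback_topology)

lemma openin_cone_nbhd:
  assumes "geodesic_ray X c" "0 < R" "0 < e"
  shows "openin (cone_topology X) (cone_nbhd X c R e)"
  unfolding cone_topology_def by (rule topology_generated_by_Basis) (use assms in blast)

lemma Inr_in_cone_nbhd:
  "Inr \<xi> \<in> cone_nbhd X c R e \<longleftrightarrow> \<xi> \<in> boundary X \<and> (\<exists>\<rho>\<in>\<xi>. \<rho> 0 = c 0 \<and> d (\<rho> R) (c R) < e)"
  by (auto simp: cone_nbhd_def)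

lemma topspace_boundary_topology: "topspace (boundary_topology X) = boundary X"
proof -
  have "Inr \<xi> \<in> topspace (cone_topology X)" if \<xi>: "\<xi> \<in> boundary X" for \<xi>
  proof -
    obtain \<rho> where \<rho>: "\<rho> \<in> \<xi>" using boundary_nonempty[OF \<xi>] by blast
    note ray = boundary_ray[OF \<xi> \<rho>]
    have "d (\<rho> 1) (\<rho> 1) = 0" using geodesic_rayD(2)[OF ray, of 1 1] by simp
    then have "Inr \<xi> \<in> cone_nbhd X \<rho> 1 1" unfolding Inr_in_cone_nbhd using \<xi> \<rho> by auto
    then show ?thesis using openin_subset[OF openin_cone_nbhd[OF ray, of 1 1]] by auto
  qed
  then show ?thesis by (auto simp: boundary_topology_def topspace_pullback_topology)
qed

lemma cone_topology_induct [consumes 1, case_names empty Int Union ball cone_nbhd]: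
  assumes U: "openin (cone_topology X) U"
    and "P {}" "\<And>A B. P A \<Longrightarrow> P B \<Longrightarrow> P (A \<inter> B)" "\<And>K. (\<And>A. A \<in> K \<Longrightarrow> P A) \<Longrightarrow> P (\<Union>K)"
    and "\<And>x r. P (Inl ` mball_of X x r)"
    and "\<And>c R e. geodesic_ray X c \<Longrightarrow> 0 < R \<Longrightarrow> 0 < e \<Longrightarrow> P (cone_nbhd X c R e)"
  shows "P U"
proof -
  have "generate_topology_on ({Inl ` mball_of X x r |x r. x \<in> M \<and> 0 < r} \<union>
      {cone_nbhd X c R e |c R e. geodesic_ray X c \<and> 0 < R \<and> 0 < e}) U"
    using U unfolding cone_topology_def openin_topology_generated_by_iff .
  then show ?thesis by induction (use assms in auto)
qed

text \<open>The preimage of the cone neighbourhood about a ray \<open>c\<close> is the cone neighbourhood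
about the preimage of \<open>c\<close>. Cone neighbourhoods with arbitrary base points generate
the topology, and this makes the isometries act by homeomorphisms without a change of base point.\<close>

lemma openin_boundary_action_vimage:
  assumes iso: "\<And>x. x \<in> M \<Longrightarrow> f x \<in> M" "\<And>x y. x \<in> M \<Longrightarrow> y \<in> M \<Longrightarrow> d (f x) (f y) = d x y"
    and iso': "\<And>x. x \<in> M \<Longrightarrow> f' x \<in> M" "\<And>x y. x \<in> M \<Longrightarrow> y \<in> M \<Longrightarrow> d (f' x) (f' y) = d x y"
    and inv: "\<And>x. x \<in> M \<Longrightarrow> f' (f x) = x" "\<And>x. x \<in> M \<Longrightarrow> f (f' x) = x"
    and U: "openin (boundary_topology X) U"
  shows "openin (boundary_topology X) {\<xi> \<in> boundary X. boundary_action X f \<xi> \<in> U}"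
proof -
  let ?b = "boundary_action X f"
  have in_b: "?b \<xi> \<in> boundary X" if "\<xi> \<in> boundary X" for \<xi>
    using boundary_action_eq(3)[OF iso that] boundary_nonempty[OF that] by blast
  obtain V where V: "openin (cone_topology X) V" "U = Inr -` V \<inter> boundary X"
    using U by (auto simp: openin_boundary_topology)
  have "openin (boundary_topology X) {\<xi> \<in> boundary X. Inr (?b \<xi>) \<in> V}"
    using V(1)
  proof (induction rule: cone_topology_induct)
    case (Int A B)
    have "{\<xi> \<in> boundary X. Inr (?b \<xi>) \<in> A \<inter> B} = {\<xi> \<in> boundary X. Inr (?b \<xi>) \<in> A} \<inter> {\<xi> \<in> boundary X. Inr (?b \<xi>) \<in> B}" by auto
    then show ?case using Int by (simp add: openin_Int)
  next
    case (Union K)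
    have "{\<xi> \<in> boundary X. Inr (?b \<xi>) \<in> \<Union>K} = (\<Union>A\<in>K. {\<xi> \<in> boundary X. Inr (?b \<xi>) \<in> A})" by auto
    then show ?case using Union by auto
  next
    case (ball x r)
    have "{\<xi> \<in> boundary X. Inr (?b \<xi>) \<in> (Inl ` mball_of X x r :: ('a + (real \<Rightarrow> 'a) set) set)} = {}" by auto
    then show ?case by (simp only: openin_empty)
  next
    case (cone_nbhd c R e)
    have cin: "c 0 \<in> M" "c R \<in> M" using geodesic_rayD(1)[OF cone_nbhd(1)] cone_nbhd(2) by auto
    have "{\<xi> \<in> boundary X. Inr (?b \<xi>) \<in> cone_nbhd X c R e} = Inr -` cone_nbhd X (f' \<circ> c) R e \<inter> boundary X"
    proof (intro Set.set_eqI iffI)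
      fix \<xi> assume "\<xi> \<in> {\<xi> \<in> boundary X. Inr (?b \<xi>) \<in> cone_nbhd X c R e}"
      then obtain \<tau> where \<xi>: "\<xi> \<in> boundary X" and \<tau>: "\<tau> \<in> ?b \<xi>" "\<tau> 0 = c 0" "d (\<tau> R) (c R) < e"
        by (auto simp: Inr_in_cone_nbhd)
      have "f' \<circ> \<tau> \<in> \<xi>"
        using boundary_action_eq(2)[OF iso' in_b[OF \<xi>] \<tau>(1)] boundary_action_inverse[OF iso iso' inv(1) \<xi>] by simp
      moreover have "\<tau> R \<in> M" using geodesic_rayD(1)[OF boundary_ray[OF in_b[OF \<xi>] \<tau>(1)]] cone_nbhd(2) by simp
      ultimately show "\<xi> \<in> Inr -` cone_nbhd X (f' \<circ> c) R e \<inter> boundary X"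
        using \<xi> \<tau> iso'(2) cin by (auto simp: Inr_in_cone_nbhd intro!: bexI[of _ "f' \<circ> \<tau>"])
    next
      fix \<xi> assume "\<xi> \<in> Inr -` cone_nbhd X (f' \<circ> c) R e \<inter> boundary X"
      then obtain \<rho> where \<xi>: "\<xi> \<in> boundary X" and \<rho>: "\<rho> \<in> \<xi>" "\<rho> 0 = f' (c 0)" "d (\<rho> R) (f' (c R)) < e"
        by (auto simp: Inr_in_cone_nbhd)
      have "\<rho> R \<in> M" using geodesic_rayD(1)[OF boundary_ray[OF \<xi> \<rho>(1)]] cone_nbhd(2) by simp
      then have "d (f (\<rho> R)) (c R) < e" using iso(2)[of "\<rho> R" "f' (c R)"] inv(2) iso'(1) cin \<rho>(3) by simp
      then show "\<xi> \<in> {\<xi> \<in> boundary X. Inr (?b \<xi>) \<in> cone_nbhd X c R e}"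
        using \<xi> in_b[OF \<xi>] \<rho>(2) inv(2) cin boundary_action_eq(2)[OF iso \<xi> \<rho>(1)]
        by (auto simp: Inr_in_cone_nbhd intro!: bexI[of _ "f \<circ> \<rho>"])
    qed
    moreover have "geodesic_ray X (f' \<circ> c)" by (rule isometry_ray[OF iso' cone_nbhd(1)])
    ultimately show ?case using openin_cone_nbhd[of "f' \<circ> c" R e] cone_nbhd unfolding openin_boundary_topology by blast
  qed simp
  moreover have "{\<xi> \<in> boundary X. ?b \<xi> \<in> U} = {\<xi> \<in> boundary X. Inr (?b \<xi>) \<in> V}" using V(2) in_b by auto
  ultimately show ?thesis by simp
qed

end

lemma space_borel_of: "space (borel_of T) = topspace T"
  unfolding borel_of_def by (rule space_measure_of) (auto dest: openin_subset)

lemma openin_sets_borel_of: "openin T U \<Longrightarrow> U \<in> sets (borel_of T)"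
  unfolding borel_of_def by (subst sets_measure_of) (auto dest: openin_subset)

lemma (in cn_space) measurable_boundary_action:
  assumes "\<And>x. x \<in> M \<Longrightarrow> f x \<in> M" "\<And>x y. x \<in> M \<Longrightarrow> y \<in> M \<Longrightarrow> d (f x) (f y) = d x y"
    and "\<And>x. x \<in> M \<Longrightarrow> f' x \<in> M" "\<And>x y. x \<in> M \<Longrightarrow> y \<in> M \<Longrightarrow> d (f' x) (f' y) = d x y"
    and "\<And>x. x \<in> M \<Longrightarrow> f' (f x) = x" "\<And>x. x \<in> M \<Longrightarrow> f (f' x) = x"
  shows "boundary_action X f \<in> borel_of (boundary_topology X) \<rightarrow>\<^sub>M borel_of (boundary_topology X)"
proof -
  let ?T = "boundary_topology X"
  have space: "space (borel_of ?T) = boundary X" by (simp add: space_borel_of topspace_boundary_topology)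
  have "boundary_action X f \<in> borel_of ?T \<rightarrow>\<^sub>M sigma (topspace ?T) {U. openin ?T U}"
  proof (rule measurable_measure_of)
    show "{U. openin ?T U} \<subseteq> Pow (topspace ?T)" by (auto dest: openin_subset)
    show "boundary_action X f \<in> space (borel_of ?T) \<rightarrow> topspace ?T"
      unfolding space topspace_boundary_topology
      using boundary_action_eq(3)[of f] assms(1,2) boundary_nonempty by blast
    fix U assume "U \<in> {U. openin ?T U}"
    then have "openin ?T {\<xi> \<in> boundary X. boundary_action X f \<xi> \<in> U}"
      using openin_boundary_action_vimage[OF assms] by simp
    moreover have "{\<xi> \<in> boundary X. boundary_action X f \<xi> \<in> U} = boundary_action X f -` U \<inter> boundary X" by auto
    ultimately show "boundary_action X f -` U \<inter> space (borel_of ?T) \<in> sets (borel_of ?T)"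
      unfolding space using openin_sets_borel_of by metis
  qed
  then show ?thesis by (simp only: borel_of_def)
qed

context proper_cn_space
begin

lemma boundary_ray_from:
  assumes "\<xi> \<in> boundary X" "x \<in> M"
  obtains \<rho> where "\<rho> \<in> \<xi>" "\<rho> 0 = x"
proof -
  obtain \<rho>0 where \<rho>0: "\<rho>0 \<in> \<xi>" using boundary_nonempty[OF assms(1)] by blast
  obtain \<rho> where "(\<rho>, \<rho>0) \<in> asymptotic X" "\<rho> 0 = x"
    using asymptotic_ray_from[OF boundary_ray[OF assms(1) \<rho>0] assms(2)] by blast
  then show thesis using that boundary_closed[OF assms(1) \<rho>0] asymptotic_sym by blast
qed

text \<open>Boundary points are close if their rays from \<open>p\<close> are at distance less than
\<open>1\<close> at a sufficiently large time \<open>R\<close>. For the generating cone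
neighbourhoods, which are based at other points, compare with the rays from there: they stay at
distance at most \<open>d p (c 0)\<close> from the rays from \<open>p\<close>, and by convexity a
bounded distance at time \<open>R'\<close> shrinks to a multiple of \<open>R / R'\<close> at time
\<open>R\<close>.\<close>

lemma cone_neighbourhood_basis:
  assumes p: "p \<in> M" and U: "openin (boundary_topology X) U" and \<xi>: "\<xi> \<in> U"
  shows "\<exists>R0>0. \<forall>R\<ge>R0. \<forall>\<eta>\<in>boundary X. \<forall>\<rho>\<in>\<xi>. \<forall>\<tau>\<in>\<eta>. \<rho> 0 = p \<longrightarrow> \<tau> 0 = p \<longrightarrow> d (\<rho> R) (\<tau> R) < 1 \<longrightarrow> \<eta> \<in> U"
proof -
  define close where "close \<xi> \<eta> R \<longleftrightarrow> (\<exists>\<rho>\<in>\<xi>. \<exists>\<tau>\<in>\<eta>. \<rho> 0 = p \<and> \<tau> 0 = p \<and> d (\<rho> R) (\<tau> R) < 1)"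
    for \<xi> \<eta> :: "(real \<Rightarrow> 'a) set" and R
  obtain V where V: "openin (cone_topology X) V" "U = Inr -` V \<inter> boundary X"
    using U by (auto simp: openin_boundary_topology)
  have "\<forall>\<xi>\<in>boundary X. Inr \<xi> \<in> V \<longrightarrow> (\<exists>R0>0. \<forall>R\<ge>R0. \<forall>\<eta>\<in>boundary X. close \<xi> \<eta> R \<longrightarrow> Inr \<eta> \<in> V)"
    using V(1)
  proof (induction rule: cone_topology_induct)
    case (Int A B)
    show ?case
    proof (intro ballI impI)
      fix \<xi> assume \<xi>: "\<xi> \<in> boundary X" "Inr \<xi> \<in> A \<inter> B"
      obtain R1 where "R1 > 0" "\<forall>R\<ge>R1. \<forall>\<eta>\<in>boundary X. close \<xi> \<eta> R \<longrightarrow> Inr \<eta> \<in> A" using Int(1) \<xi> by blast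
      moreover obtain R2 where "R2 > 0" "\<forall>R\<ge>R2. \<forall>\<eta>\<in>boundary X. close \<xi> \<eta> R \<longrightarrow> Inr \<eta> \<in> B" using Int(2) \<xi> by blast
      ultimately show "\<exists>R0>0. \<forall>R\<ge>R0. \<forall>\<eta>\<in>boundary X. close \<xi> \<eta> R \<longrightarrow> Inr \<eta> \<in> A \<inter> B"
        by (intro exI[of _ "max R1 R2"]) auto
    qed
  next
    case (Union K)
    show ?case
    proof (intro ballI impI)
      fix \<xi> assume \<xi>: "\<xi> \<in> boundary X" "Inr \<xi> \<in> \<Union>K"
      then obtain A where A: "A \<in> K" "Inr \<xi> \<in> A" by blast
      then obtain R1 where "R1 > 0" "\<forall>R\<ge>R1. \<forall>\<eta>\<in>boundary X. close \<xi> \<eta> R \<longrightarrow> Inr \<eta> \<in> A" using Union \<xi> by blast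
      then show "\<exists>R0>0. \<forall>R\<ge>R0. \<forall>\<eta>\<in>boundary X. close \<xi> \<eta> R \<longrightarrow> Inr \<eta> \<in> \<Union>K" using A by blast
    qed
  next
    case (cone_nbhd c R e)
    show ?case
    proof (intro ballI impI)
      fix \<xi> assume \<xi>: "\<xi> \<in> boundary X" "Inr \<xi> \<in> cone_nbhd X c R e"
      then obtain \<rho>c where \<rho>c: "\<rho>c \<in> \<xi>" "\<rho>c 0 = c 0" "d (\<rho>c R) (c R) < e" by (auto simp: Inr_in_cone_nbhd)
      define e' where "e' = e - d (\<rho>c R) (c R)"
      \<comment> \<open>Bound for the distance at time \<open>R'\<close> of the two rays from
        \<open>c 0\<close>.\<close>
      define D where "D = 2 * d p (c 0) + 1"
      have D: "D > 0" unfolding D_def using nonneg[of p "c 0"] by linarith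
      have e': "e' > 0" using \<rho>c by (simp add: e'_def)
      define R0 where "R0 = R + R * D / e' + 1"
      have q: "c 0 \<in> M" "c R \<in> M" using geodesic_rayD(1)[OF cone_nbhd(1)] cone_nbhd(2) by auto
      have "Inr \<eta> \<in> cone_nbhd X c R e" if R': "R0 \<le> R'" and \<eta>: "\<eta> \<in> boundary X" and cl: "close \<xi> \<eta> R'" for R' \<eta>
      proof -
        obtain \<rho> \<tau> where \<rho>\<tau>: "\<rho> \<in> \<xi>" "\<tau> \<in> \<eta>" "\<rho> 0 = p" "\<tau> 0 = p" "d (\<rho> R') (\<tau> R') < 1"
          using cl by (auto simp: close_def)
        obtain \<tau>c where \<tau>c: "\<tau>c \<in> \<eta>" "\<tau>c 0 = c 0" using boundary_ray_from[OF \<eta> q(1)] by blast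
        have RDe: "0 \<le> R * D / e'" using cone_nbhd(2) D e' by simp
        have RR: "R \<le> R'" "0 < R'" "R * D / e' < R'" using R' RDe cone_nbhd(2) by (auto simp: R0_def)
        note rays = boundary_ray[OF \<xi>(1) \<rho>c(1)] boundary_ray[OF \<xi>(1) \<rho>\<tau>(1)] boundary_ray[OF \<eta> \<rho>\<tau>(2)] boundary_ray[OF \<eta> \<tau>c(1)]
        have in_M: "\<rho>c t \<in> M" "\<rho> t \<in> M" "\<tau> t \<in> M" "\<tau>c t \<in> M" if "0 \<le> t" for t
          using rays geodesic_rayD(1) that by blast+
        have "d (\<rho>c R') (\<rho> R') \<le> d p (c 0)"
          using asymptoticD(3)[OF boundary_asymptotic[OF \<xi>(1) \<rho>c(1) \<rho>\<tau>(1)], of R'] RR \<rho>c \<rho>\<tau> by (simp add: mdist_commute)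
        moreover have "d (\<tau> R') (\<tau>c R') \<le> d p (c 0)"
          using asymptoticD(3)[OF boundary_asymptotic[OF \<eta> \<rho>\<tau>(2) \<tau>c(1)], of R'] RR \<tau>c \<rho>\<tau> by simp
        moreover have "d (\<rho>c R') (\<tau>c R') \<le> d (\<rho>c R') (\<rho> R') + d (\<rho> R') (\<tau> R') + d (\<tau> R') (\<tau>c R')"
          using triangle[of "\<rho>c R'" "\<rho> R'" "\<tau>c R'"] triangle[of "\<rho> R'" "\<tau> R'" "\<tau>c R'"] in_M[of R'] RR by force
        ultimately have far: "d (\<rho>c R') (\<tau>c R') \<le> D" using \<rho>\<tau>(5) unfolding D_def by linarith
        have "\<rho>c R = pt (c 0) (\<rho>c R') (R / R')" "\<tau>c R = pt (c 0) (\<tau>c R') (R / R')"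
          using ray_point[OF rays(1), of R R'] ray_point[OF rays(4), of R R'] RR cone_nbhd(2) \<rho>c \<tau>c by auto
        then have "d (\<rho>c R) (\<tau>c R) \<le> R / R' * d (\<rho>c R') (\<tau>c R')"
          using dist_pt_common_start[of "c 0" "\<rho>c R'" "\<tau>c R'" "R / R'"] q in_M[of R'] RR cone_nbhd(2) by simp
        also have "\<dots> \<le> R / R' * D" using far cone_nbhd(2) RR by (intro mult_left_mono) auto
        also have "\<dots> < e'" using RR e' by (simp add: field_simps)
        finally have "d (\<tau>c R) (c R) < e"
          using triangle[of "\<tau>c R" "\<rho>c R" "c R"] in_M[of R] q cone_nbhd(2) by (simp add: e'_def mdist_commute)
        then show ?thesis using \<eta> \<tau>c by (auto simp: Inr_in_cone_nbhd)
      qed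
      moreover have "R0 > 0"
      proof -
        have "0 \<le> R * D / e'" using cone_nbhd(2) D e' by simp
        then show ?thesis using cone_nbhd(2) by (simp add: R0_def)
      qed
      ultimately show "\<exists>R0>0. \<forall>R'\<ge>R0. \<forall>\<eta>\<in>boundary X. close \<xi> \<eta> R' \<longrightarrow> Inr \<eta> \<in> cone_nbhd X c R e" by blast
    qed
  qed auto
  moreover have "\<xi> \<in> boundary X" "Inr \<xi> \<in> V" using \<xi> V(2) by auto
  ultimately obtain R0 where "R0 > 0" "\<forall>R\<ge>R0. \<forall>\<eta>\<in>boundary X. close \<xi> \<eta> R \<longrightarrow> Inr \<eta> \<in> V" by blast
  then show ?thesis unfolding close_def V(2) by (intro exI[of _ R0]) blast
qed

lemma countable_net:
  assumes p: "p \<in> M"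
  obtains Q where "countable Q" "Q \<subseteq> M" "\<And>x. x \<in> M \<Longrightarrow> \<exists>q\<in>Q. d q x < 1/2"
proof -
  have "\<exists>K. finite K \<and> K \<subseteq> M \<and> mcball p (real n) \<subseteq> (\<Union>k\<in>K. mball k (1/2))" for n
  proof -
    have "mtotally_bounded (mcball p (real n))" by (rule compactin_imp_mtotally_bounded[OF compact_mcball[OF p]])
    then obtain K where "finite K \<and> K \<subseteq> mcball p (real n) \<and> mcball p (real n) \<subseteq> (\<Union>k\<in>K. mball k (1/2))"
      unfolding mtotally_bounded_def by (meson half_gt_zero zero_less_one)
    then show ?thesis using mcball_subset_mspace by blast
  qed
  then obtain K where K: "\<And>n. finite (K n)" "\<And>n. K n \<subseteq> M" "\<And>n. mcball p (real n) \<subseteq> (\<Union>k\<in>K n. mball k (1/2))" by metis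
  show thesis
  proof (rule that[of "\<Union>n. K n"])
    show "countable (\<Union>n. K n)" using K(1) by (auto intro: countable_finite)
    show "(\<Union>n. K n) \<subseteq> M" using K(2) by auto
    fix x assume x: "x \<in> M"
    obtain n :: nat where "d p x \<le> real n" using real_arch_simple by blast
    then have "x \<in> mcball p (real n)" using x p by simp
    then obtain q where "q \<in> K n" "x \<in> mball q (1/2)" using K(3)[of n] by blast
    then show "\<exists>q\<in>\<Union>n. K n. d q x < 1/2" by (intro bexI[of _ q]) auto
  qed
qed

text \<open>A proper space has a countable net. By the previous lemma the sets of boundary points whose ray
from \<open>p\<close> is near a given point of the net at a given integral time are a countable
substitute for a basis.\<close>

lemma boundary_lindelof:
  assumes p: "p \<in> M" and N: "\<And>U. U \<in> \<N> \<Longrightarrow> openin (boundary_topology X) U"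
  obtains \<C> where "\<C> \<subseteq> \<N>" "countable \<C>" "\<Union>\<N> = \<Union>\<C>"
proof -
  obtain Q where Q: "countable Q" "Q \<subseteq> M" "\<And>x. x \<in> M \<Longrightarrow> \<exists>q\<in>Q. d q x < 1/2" using countable_net[OF p] by blast
  define B where "B z = {\<eta> \<in> boundary X. \<exists>\<tau>\<in>\<eta>. \<tau> 0 = p \<and> d (snd z) (\<tau> (real (fst z))) < 1/2}" for z :: "nat \<times> 'a"
  define Z where "Z = {z \<in> UNIV \<times> Q. \<exists>U\<in>\<N>. B z \<subseteq> U}"
  have "countable Z" unfolding Z_def using Q(1) by (intro countable_Collect) auto
  have "\<forall>z\<in>Z. \<exists>U. U \<in> \<N> \<and> B z \<subseteq> U" unfolding Z_def by blast
  from bchoice[OF this] obtain u where u: "\<And>z. z \<in> Z \<Longrightarrow> u z \<in> \<N> \<and> B z \<subseteq> u z" by blast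
  have "\<exists>z\<in>Z. \<xi> \<in> u z" if U: "U \<in> \<N>" "\<xi> \<in> U" for \<xi> U
  proof -
    have \<xi>: "\<xi> \<in> boundary X" using openin_subset[OF N[OF U(1)]] U(2) topspace_boundary_topology by auto
    obtain R0 where R0: "R0 > 0" "\<And>R \<eta> \<rho> \<tau>. \<lbrakk>R \<ge> R0; \<eta> \<in> boundary X; \<rho> \<in> \<xi>; \<tau> \<in> \<eta>; \<rho> 0 = p; \<tau> 0 = p; d (\<rho> R) (\<tau> R) < 1\<rbrakk> \<Longrightarrow> \<eta> \<in> U"
      using cone_neighbourhood_basis[OF p N[OF U(1)] U(2)] by blast
    obtain n :: nat where n: "R0 \<le> real n" using real_arch_simple by blast
    obtain \<rho> where \<rho>: "\<rho> \<in> \<xi>" "\<rho> 0 = p" using boundary_ray_from[OF \<xi> p] by blast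
    have \<rho>n: "\<rho> (real n) \<in> M" using geodesic_rayD(1)[OF boundary_ray[OF \<xi> \<rho>(1)]] by simp
    obtain q where q: "q \<in> Q" "d q (\<rho> (real n)) < 1/2" using Q(3)[OF \<rho>n] by blast
    have "B (n, q) \<subseteq> U"
    proof
      fix \<eta> assume "\<eta> \<in> B (n, q)"
      then obtain \<tau> where \<tau>: "\<eta> \<in> boundary X" "\<tau> \<in> \<eta>" "\<tau> 0 = p" "d q (\<tau> (real n)) < 1/2" by (auto simp: B_def)
      have "\<tau> (real n) \<in> M" using geodesic_rayD(1)[OF boundary_ray[OF \<tau>(1,2)]] by simp
      then have "d (\<rho> (real n)) (\<tau> (real n)) < 1"
        using triangle[of "\<rho> (real n)" q "\<tau> (real n)"] \<rho>n q Q(2) \<tau>(4) by (force simp: mdist_commute)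
      then show "\<eta> \<in> U" using R0(2)[OF n \<tau>(1) \<rho>(1) \<tau>(2) \<rho>(2) \<tau>(3)] by simp
    qed
    moreover have "\<xi> \<in> B (n, q)" using \<xi> \<rho> q by (auto simp: B_def)
    ultimately have "(n, q) \<in> Z" using U q by (auto simp: Z_def)
    then show ?thesis using u \<open>\<xi> \<in> B (n, q)\<close> by blast
  qed
  then have "\<Union>\<N> = \<Union>(u ` Z)" using u by blast
  then show thesis using that[of "u ` Z"] u \<open>countable Z\<close> by blast
qed

text \<open>The complement of the support is a union of open null sets, of which countably many suffice. Since
the value of the density in the transformation rule is prescribed on the support only, this makes
integration possible.\<close>

lemma msupport_full:
  assumes p: "p \<in> M" and \<mu>: "sets \<mu> = sets (borel_of (boundary_topology X))"
  shows "msupport (boundary_topology X) \<mu> \<in> sets \<mu>"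
    and "emeasure \<mu> (boundary X - msupport (boundary_topology X) \<mu>) = 0"
proof -
  let ?T = "boundary_topology X"
  define \<N> where "\<N> = {U. openin ?T U \<and> emeasure \<mu> U = 0}"
  have space: "space \<mu> = boundary X"
    using sets_eq_imp_space_eq[OF \<mu>] by (simp add: space_borel_of topspace_boundary_topology)
  have eq: "boundary X - msupport ?T \<mu> = \<Union>\<N>"
    using openin_subset[of ?T] by (auto simp: \<N>_def msupport_def topspace_boundary_topology)
  obtain \<C> where C: "\<C> \<subseteq> \<N>" "countable \<C>" "\<Union>\<N> = \<Union>\<C>"
    by (rule boundary_lindelof[OF p, of \<N>]) (auto simp: \<N>_def)
  have null: "U \<in> null_sets \<mu>" if "U \<in> \<N>" for U
    using that openin_sets_borel_of[of ?T U] by (auto simp: \<N>_def null_sets_def \<mu>)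
  have "\<Union>\<C> \<in> null_sets \<mu>" using null_sets_UN'[OF C(2), of "\<lambda>U. U" \<mu>] null C(1) by auto
  then have 1: "boundary X - msupport ?T \<mu> \<in> null_sets \<mu>" by (simp add: eq C(3))
  then show "emeasure \<mu> (boundary X - msupport ?T \<mu>) = 0" by auto
  have "msupport ?T \<mu> \<subseteq> boundary X" by (auto simp: msupport_def topspace_boundary_topology)
  then have "msupport ?T \<mu> = space \<mu> - (boundary X - msupport ?T \<mu>)" by (auto simp: space)
  then show "msupport ?T \<mu> \<in> sets \<mu>" using 1 by (metis null_setsD2 sets.compl_sets)
qed

end

section \<open>Busemann functions\<close>

lemma nonincreasing_bounded_converges:
  fixes f :: "real \<Rightarrow> real"
  assumes mono: "\<And>s t. 0 \<le> s \<Longrightarrow> s \<le> t \<Longrightarrow> f t \<le> f s" and bd: "\<And>s. 0 \<le> s \<Longrightarrow> L \<le> f s"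
  shows "\<exists>c. (f \<longlongrightarrow> c) at_top"
proof -
  define c where "c = Inf (f ` {0..})"
  have bdd: "bdd_below (f ` {0..})" using bd by (auto intro!: bdd_belowI[of _ L])
  have ge: "c \<le> f s" if "0 \<le> s" for s unfolding c_def using bdd that by (intro cInf_lower) auto
  have "(f \<longlongrightarrow> c) at_top"
  proof (rule order_tendstoI)
    fix a assume a: "a < c"
    show "\<forall>\<^sub>F s in at_top. a < f s"
      using eventually_ge_at_top[of 0] by eventually_elim (use ge a in force)
  next
    fix a assume "c < a"
    then obtain s0 where s0: "0 \<le> s0" "f s0 < a"
      using cInf_less_iff[OF _ bdd, of a] unfolding c_def by auto
    show "\<forall>\<^sub>F s in at_top. f s < a"
      using eventually_ge_at_top[of s0] by eventually_elim (use mono[OF s0(1)] s0(2) in force)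
  qed
  then show ?thesis by blast
qed

context cn_space
begin

lemma ray_distance_converges:
  assumes \<rho>: "geodesic_ray X \<rho>" and x: "x \<in> M"
  shows "\<exists>c. ((\<lambda>s. d x (\<rho> s) - s) \<longlongrightarrow> c) at_top"
proof (rule nonincreasing_bounded_converges)
  note \<rho>in = geodesic_rayD(1)[OF \<rho>] and \<rho>d = geodesic_rayD(2)[OF \<rho>]
  show "d x (\<rho> t) - t \<le> d x (\<rho> s) - s" if "0 \<le> s" "s \<le> t" for s t
    using triangle[of x "\<rho> s" "\<rho> t"] x \<rho>in \<rho>d[of s t] that by simp
  show "- d x (\<rho> 0) \<le> d x (\<rho> s) - s" if "0 \<le> s" for s
    using triangle[of "\<rho> 0" x "\<rho> s"] x \<rho>in \<rho>d[of 0 s] that by (simp add: mdist_commute)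
qed

text \<open>Both differences converge, by monotonicity of \<open>s \<mapsto> d x (\<rho> s) - s\<close>. Up to
a factor that tends to \<open>1\<close>, the difference \<open>d x (\<rho> s) - d y (\<rho>
s)\<close> is the difference of squares divided by \<open>2 * s\<close>. By the quadrilateral
inequality for \<open>x\<close>, \<open>y\<close>, \<open>\<rho> s\<close>, \<open>\<rho>'
s\<close> the differences of squares for the two rays differ by a bounded amount, so the limits
agree.\<close>

lemma asymptotic_same_horofunction:
  assumes as: "(\<rho>, \<rho>') \<in> asymptotic X" and x: "x \<in> M" and y: "y \<in> M"
    and lim: "((\<lambda>s. d x (\<rho> s) - d y (\<rho> s)) \<longlongrightarrow> c) at_top"
  shows "((\<lambda>s. d x (\<rho>' s) - d y (\<rho>' s)) \<longlongrightarrow> c) at_top"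
proof -
  note rays = asymptoticD(1,2)[OF as]
  define C where "C = (d x y)\<^sup>2 + (d (\<rho> 0) (\<rho>' 0))\<^sup>2"
  have inf: "filterlim (\<lambda>s::real. 2 * s) at_infinity at_top"
    by (intro filterlim_at_top_imp_at_infinity filterlim_tendsto_pos_mult_at_top[OF tendsto_const _ filterlim_ident]) simp
  have quotient: "((\<lambda>s. ((d x (\<tau> s))\<^sup>2 - (d y (\<tau> s))\<^sup>2) / (2 * s)) \<longlongrightarrow> e) at_top"
    if \<tau>: "geodesic_ray X \<tau>" and e: "((\<lambda>s. d x (\<tau> s) - d y (\<tau> s)) \<longlongrightarrow> e) at_top" for \<tau> e
  proof -
    obtain A B where A: "((\<lambda>s. d x (\<tau> s) - s) \<longlongrightarrow> A) at_top" and B: "((\<lambda>s. d y (\<tau> s) - s) \<longlongrightarrow> B) at_top"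
      using ray_distance_converges[OF \<tau>] x y by blast
    have "((\<lambda>s. (d x (\<tau> s) - d y (\<tau> s)) * (1 + ((d x (\<tau> s) - s) + (d y (\<tau> s) - s)) / (2 * s))) \<longlongrightarrow> e * (1 + 0)) at_top"
      by (intro tendsto_intros e tendsto_divide_0[OF tendsto_add[OF A B] inf])
    moreover have "\<forall>\<^sub>F s in at_top. (d x (\<tau> s) - d y (\<tau> s)) * (1 + ((d x (\<tau> s) - s) + (d y (\<tau> s) - s)) / (2 * s))
        = ((d x (\<tau> s))\<^sup>2 - (d y (\<tau> s))\<^sup>2) / (2 * s)"
      using eventually_gt_at_top[of 0]
    proof eventually_elim
      case (elim s)
      then have "1 + ((d x (\<tau> s) - s) + (d y (\<tau> s) - s)) / (2 * s) = (d x (\<tau> s) + d y (\<tau> s)) / (2 * s)"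
        by (simp add: field_simps)
      then show ?case by (simp add: power2_eq_square algebra_simps)
    qed
    ultimately show ?thesis by (simp add: tendsto_cong)
  qed
  obtain A B where A: "((\<lambda>s. d x (\<rho>' s) - s) \<longlongrightarrow> A) at_top" and B: "((\<lambda>s. d y (\<rho>' s) - s) \<longlongrightarrow> B) at_top"
    using ray_distance_converges[OF rays(2)] x y by blast
  have lim': "((\<lambda>s. d x (\<rho>' s) - d y (\<rho>' s)) \<longlongrightarrow> A - B) at_top" using tendsto_diff[OF A B] by simp
  define u where "u s = ((d x (\<rho> s))\<^sup>2 - (d y (\<rho> s))\<^sup>2) / (2 * s) - ((d x (\<rho>' s))\<^sup>2 - (d y (\<rho>' s))\<^sup>2) / (2 * s)" for s
  have u1: "(u \<longlongrightarrow> c - (A - B)) at_top"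
    unfolding u_def by (intro tendsto_diff quotient rays lim lim')
  have "\<forall>\<^sub>F s in at_top. norm (u s) \<le> C / (2 * s)"
    using eventually_gt_at_top[of 0]
  proof eventually_elim
    case (elim s)
    have in_M: "\<rho> s \<in> M" "\<rho>' s \<in> M" using geodesic_rayD(1)[OF rays(1)] geodesic_rayD(1)[OF rays(2)] elim by auto
    have "(d (\<rho> s) (\<rho>' s))\<^sup>2 \<le> (d (\<rho> 0) (\<rho>' 0))\<^sup>2" using asymptoticD(3)[OF as, of s] elim by (intro power_mono) auto
    then have "\<bar>(d x (\<rho> s))\<^sup>2 - (d y (\<rho> s))\<^sup>2 - ((d x (\<rho>' s))\<^sup>2 - (d y (\<rho>' s))\<^sup>2)\<bar> \<le> C"
      using quadrilateral_ineq[OF x y in_M] quadrilateral_ineq[OF y x in_M]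
      by (simp only: C_def abs_le_iff mdist_commute[of X "\<rho>' s" x] mdist_commute[of X "\<rho>' s" y] mdist_commute[of X y x])
        linarith
    moreover have "u s = ((d x (\<rho> s))\<^sup>2 - (d y (\<rho> s))\<^sup>2 - ((d x (\<rho>' s))\<^sup>2 - (d y (\<rho>' s))\<^sup>2)) / (2 * s)"
      unfolding u_def by (simp only: diff_divide_distrib)
    ultimately show ?case using elim by (simp add: abs_divide divide_right_mono)
  qed
  moreover have "((\<lambda>s. C / (2 * s)) \<longlongrightarrow> 0) at_top" by (rule tendsto_divide_0[OF tendsto_const inf])
  ultimately have "(u \<longlongrightarrow> 0) at_top" by (rule Lim_null_comparison)
  from tendsto_unique[OF _ this u1] have "c = A - B" by simp
  then show ?thesis using lim' by simp
qed

text \<open>The Busemann function is defined by a unique description, which is meaningful because the limit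
does not depend on the ray.\<close>

lemma busemann_limit:
  assumes x: "x \<in> M" and y: "y \<in> M" and \<rho>: "\<rho> \<in> \<eta>" and as: "\<And>\<rho>'. \<rho>' \<in> \<eta> \<Longrightarrow> (\<rho>, \<rho>') \<in> asymptotic X"
  shows "((\<lambda>s. d x (\<rho> s) - d y (\<rho> s)) \<longlongrightarrow> busemann X \<eta> x y) at_top"
proof -
  note ray = asymptoticD(1)[OF as[OF \<rho>]]
  obtain A B where A: "((\<lambda>s. d x (\<rho> s) - s) \<longlongrightarrow> A) at_top" and B: "((\<lambda>s. d y (\<rho> s) - s) \<longlongrightarrow> B) at_top"
    using ray_distance_converges[OF ray] x y by blast
  have lim: "((\<lambda>s. d x (\<rho> s) - d y (\<rho> s)) \<longlongrightarrow> A - B) at_top" using tendsto_diff[OF A B] by simp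
  have "busemann X \<eta> x y = A - B" unfolding busemann_def
  proof (rule the_equality)
    show "\<forall>\<sigma>\<in>\<eta>. ((\<lambda>s. d x (\<sigma> s) - d y (\<sigma> s)) \<longlongrightarrow> A - B) at_top"
      using asymptotic_same_horofunction[OF as x y lim] by blast
    show "c = A - B" if "\<forall>\<sigma>\<in>\<eta>. ((\<lambda>s. d x (\<sigma> s) - d y (\<sigma> s)) \<longlongrightarrow> c) at_top" for c
      using tendsto_unique[OF _ _ lim] that \<rho> by simp
  qed
  then show ?thesis using lim by simp
qed

end

section \<open>Actions on products\<close>

lemma group_isometry_group: "group (isometry_group X)"
proof (rule groupI)
  let ?G = "isometry_group X" and ?S = "mspace X"
  have car: "f \<in> carrier ?G \<longleftrightarrow> f \<in> Bij ?S \<and> (\<forall>x\<in>?S. \<forall>y\<in>?S. mdist X (f x) (f y) = mdist X x y)" for f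
    by (simp add: isometry_group_def)
  have mult: "f \<otimes>\<^bsub>?G\<^esub> g = compose ?S f g" if "f \<in> carrier ?G" "g \<in> carrier ?G" for f g
    using that by (simp add: car) (simp add: isometry_group_def BijGroup_def)
  have one: "\<one>\<^bsub>?G\<^esub> = (\<lambda>x\<in>?S. x)" by (simp add: isometry_group_def BijGroup_def)
  have fs: "f x \<in> ?S" if "f \<in> carrier ?G" "x \<in> ?S" for f x using isometryD(2) that .
  show closed: "f \<otimes>\<^bsub>?G\<^esub> g \<in> carrier ?G" if "f \<in> carrier ?G" "g \<in> carrier ?G" for f g
    using that fs unfolding mult[OF that] by (auto simp: car compose_Bij compose_eq)
  show "\<one>\<^bsub>?G\<^esub> \<in> carrier ?G" unfolding one by (simp add: car id_Bij)
  show "f \<otimes>\<^bsub>?G\<^esub> g \<otimes>\<^bsub>?G\<^esub> k = f \<otimes>\<^bsub>?G\<^esub> (g \<otimes>\<^bsub>?G\<^esub> k)"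
    if "f \<in> carrier ?G" "g \<in> carrier ?G" "k \<in> carrier ?G" for f g k
  proof -
    have "k \<in> ?S \<rightarrow> ?S" using fs[OF that(3)] by blast
    then show ?thesis using that closed by (simp add: mult compose_assoc)
  qed
  show "\<one>\<^bsub>?G\<^esub> \<otimes>\<^bsub>?G\<^esub> f = f" if "f \<in> carrier ?G" for f
  proof -
    have "f \<in> ?S \<rightarrow> ?S" "f \<in> extensional ?S" using that by (auto simp: car Bij_imp_funcset Bij_imp_extensional)
    then have "compose ?S (\<lambda>x\<in>?S. x) f = f" by (rule Id_compose)
    moreover have "\<one>\<^bsub>?G\<^esub> \<in> carrier ?G" unfolding one by (simp add: car id_Bij)
    ultimately show ?thesis using that by (simp add: mult) (simp add: one)
  qed
  show "\<exists>k\<in>carrier ?G. k \<otimes>\<^bsub>?G\<^esub> f = \<one>\<^bsub>?G\<^esub>" if f: "f \<in> carrier ?G" for f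
  proof -
    let ?k = "restrict (inv_into ?S f) ?S"
    have b: "bij_betw f ?S ?S" by (rule isometryD(1)[OF f])
    have fk: "?k x \<in> ?S" "f (?k x) = x" if "x \<in> ?S" for x
      using that b by (auto simp: bij_betw_def inv_into_into f_inv_into_f)
    have "mdist X (?k x) (?k y) = mdist X x y" if "x \<in> ?S" "y \<in> ?S" for x y
      using isometryD(3)[OF f fk(1)[OF that(1)] fk(1)[OF that(2)]] fk(2) that by simp
    then have k: "?k \<in> carrier ?G" using f restrict_inv_into_Bij by (auto simp: car)
    have "?k \<otimes>\<^bsub>?G\<^esub> f = \<one>\<^bsub>?G\<^esub>" unfolding mult[OF k f] one using f by (intro Bij_compose_restrict_eq) (simp add: car)
    then show ?thesis using k by blast
  qed
qed

lemma isometry_group_mult_apply: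
  assumes "f \<in> carrier (isometry_group X)" "g \<in> carrier (isometry_group X)" "x \<in> mspace X"
  shows "(f \<otimes>\<^bsub>isometry_group X\<^esub> g) x = f (g x)"
proof -
  have "f \<in> Bij (mspace X)" "g \<in> Bij (mspace X)" using assms by (auto simp: isometry_group_def)
  then show ?thesis using assms(3) by (simp add: isometry_group_def BijGroup_def compose_eq)
qed

lemma isometry_group_inv_apply:
  assumes f: "f \<in> carrier (isometry_group X)" and x: "x \<in> mspace X"
  shows "(inv\<^bsub>isometry_group X\<^esub> f) (f x) = x" "f ((inv\<^bsub>isometry_group X\<^esub> f) x) = x"
proof -
  interpret group "isometry_group X" by (rule group_isometry_group)
  have one: "\<one>\<^bsub>isometry_group X\<^esub> x = x" using x by (simp add: isometry_group_def BijGroup_def)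
  show "(inv\<^bsub>isometry_group X\<^esub> f) (f x) = x"
    using isometry_group_mult_apply[OF inv_closed[OF f] f x] l_inv[OF f] one by simp
  show "f ((inv\<^bsub>isometry_group X\<^esub> f) x) = x"
    using isometry_group_mult_apply[OF f inv_closed[OF f] x] r_inv[OF f] one by simp
qed

lemma E_plusD:
  assumes "\<theta> \<in> E_plus"
  shows "0 < \<theta> $ i" "(\<Sum>i\<in>UNIV. (\<theta> $ i)\<^sup>2) = 1" "I_plus \<theta> = UNIV" "\<theta> \<in> E_slopes"
proof -
  show "0 < \<theta> $ i" "I_plus \<theta> = UNIV" using assms by (auto simp: E_plus_def I_plus_def)
  show "\<theta> \<in> E_slopes" using assms by (auto simp: E_plus_def E_slopes_def intro: less_imp_le)
  have "sqrt (\<Sum>i\<in>UNIV. (\<theta> $ i)\<^sup>2) = 1" using assms by (simp add: E_plus_def norm_vec_def L2_set_def)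
  then show "(\<Sum>i\<in>UNIV. (\<theta> $ i)\<^sup>2) = 1" by simp
qed

definition product_ray :: "('i \<Rightarrow> real \<Rightarrow> 'a) \<Rightarrow> real^'i::finite \<Rightarrow> real \<Rightarrow> 'i \<Rightarrow> 'a" where
  "product_ray \<rho> \<theta> = (\<lambda>t i. \<rho> i (t * \<theta> $ i))"

lemma geodesic_ray_product_ray:
  fixes X :: "'i::finite \<Rightarrow> 'a metric"
  assumes "\<And>i. geodesic_ray (X i) (\<rho> i)" "\<theta> \<in> E_plus"
  shows "geodesic_ray (product_metric X) (product_ray \<rho> \<theta>)"
  unfolding geodesic_ray_def
proof (intro conjI allI impI)
  note \<theta> = E_plusD[OF assms(2)]
  have nn: "0 \<le> t * \<theta> $ i" if "0 \<le> t" for t i using that \<theta>(1)[of i] by simp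
  show "product_ray \<rho> \<theta> ` {0..} \<subseteq> mspace (product_metric X)"
    using assms(1) nn by (auto simp: mspace_product_iff product_ray_def geodesic_ray_def image_subset_iff)
  fix s t :: real assume st: "0 \<le> s" "0 \<le> t"
  have "(mdist (X i) (product_ray \<rho> \<theta> s i) (product_ray \<rho> \<theta> t i))\<^sup>2 = (s - t)\<^sup>2 * (\<theta> $ i)\<^sup>2" for i
  proof -
    have "mdist (X i) (product_ray \<rho> \<theta> s i) (product_ray \<rho> \<theta> t i) = \<bar>s * \<theta> $ i - t * \<theta> $ i\<bar>"
      using assms(1)[of i] nn st by (simp add: product_ray_def geodesic_ray_def)
    then show ?thesis by (simp add: left_diff_distrib[symmetric] power_mult_distrib)
  qed
  then show "mdist (product_metric X) (product_ray \<rho> \<theta> s) (product_ray \<rho> \<theta> t) = \<bar>s - t\<bar>"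
    by (simp add: mdist_product_metric sum_distrib_left[symmetric] \<theta>(2))
qed

locale product_space =
  fixes X :: "'i::finite \<Rightarrow> 'a metric" and \<theta> :: "real^'i"
  assumes factor: "\<And>i. proper_cn_space (X i)" and slope: "\<theta> \<in> E_plus"
begin

sublocale P: proper_cn_space "product_metric X"
  by (rule proper_cn_space_product[OF factor])

lemma factor_cn: "cn_space (X i)" using factor proper_cn_space_def by blast

lemmas \<theta>_pos = E_plusD(1)[OF slope]

lemma \<theta>_nonneg: "0 \<le> t \<Longrightarrow> 0 \<le> t * \<theta> $ i" using \<theta>_pos[of i] by simp

text \<open>The distance in a factor is at most the distance in the product; the time change is by the
positive factor \<open>\<theta> $ i\<close>.\<close>

lemma components_asymptotic:
  assumes \<xi>: "\<xi> \<in> boundary (product_metric X)" and \<tau>: "\<tau> \<in> \<xi>" "\<tau>' \<in> \<xi>"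
    and \<rho>: "geodesic_ray (X i) \<rho>" "\<And>t. 0 \<le> t \<Longrightarrow> \<tau> t i = \<rho> (t * \<theta> $ i)"
    and \<rho>': "geodesic_ray (X i) \<rho>'" "\<And>t. 0 \<le> t \<Longrightarrow> \<tau>' t i = \<rho>' (t * \<theta> $ i)"
  shows "(\<rho>, \<rho>') \<in> asymptotic (X i)"
proof -
  have "mdist (X i) (\<rho> s) (\<rho>' s) \<le> mdist (product_metric X) (\<tau> 0) (\<tau>' 0)" if s: "0 \<le> s" for s
  proof -
    have t: "0 \<le> s / \<theta> $ i" "s / \<theta> $ i * \<theta> $ i = s" using s \<theta>_pos[of i] by auto
    have "mdist (X i) (\<tau> (s / \<theta> $ i) i) (\<tau>' (s / \<theta> $ i) i) \<le> mdist (product_metric X) (\<tau> (s / \<theta> $ i)) (\<tau>' (s / \<theta> $ i))"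
      by (rule mdist_component_le)
    also have "\<dots> \<le> mdist (product_metric X) (\<tau> 0) (\<tau>' 0)"
      by (rule P.asymptoticD(3)[OF P.boundary_asymptotic[OF \<xi> \<tau>] t(1)])
    finally show ?thesis using \<rho>(2)[OF t(1)] \<rho>'(2)[OF t(1)] t(2) by simp
  qed
  then show ?thesis using \<rho>(1) \<rho>'(1) by (auto simp: asymptotic_def)
qed

text \<open>The slope does not depend on the starting point: asymptotic rays in the factors combine to an
asymptotic ray in the product.\<close>

lemma slope_ray_from:
  assumes \<xi>: "\<xi> \<in> boundary_slope X \<theta>" and x: "x \<in> mspace (product_metric X)"
  obtains \<rho> where "\<And>i. geodesic_ray (X i) (\<rho> i)" "\<And>i. \<rho> i 0 = x i" "product_ray \<rho> \<theta> \<in> \<xi>"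
proof -
  obtain \<tau> where \<tau>: "\<tau> \<in> \<xi>" "has_slope X \<tau> \<theta>" and \<xi>b: "\<xi> \<in> boundary (product_metric X)"
    using \<xi> by (auto simp: boundary_slope_def)
  have "\<forall>i. \<exists>\<rho>. geodesic_ray (X i) \<rho> \<and> (\<forall>t\<ge>0. \<tau> t i = \<rho> (t * \<theta> $ i))"
    using \<tau>(2) E_plusD(3)[OF slope] by (auto simp: has_slope_def)
  then obtain \<rho>0 where \<rho>0: "\<And>i. geodesic_ray (X i) (\<rho>0 i)" "\<And>i t. 0 \<le> t \<Longrightarrow> \<tau> t i = \<rho>0 i (t * \<theta> $ i)" by metis
  have "\<forall>i. \<exists>\<rho>. (\<rho>, \<rho>0 i) \<in> asymptotic (X i) \<and> \<rho> 0 = x i"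
    using proper_cn_space.asymptotic_ray_from[OF factor \<rho>0(1)] x unfolding mspace_product_iff by metis
  then obtain \<rho> where \<rho>: "\<And>i. (\<rho> i, \<rho>0 i) \<in> asymptotic (X i)" "\<And>i. \<rho> i 0 = x i" by metis
  have rays: "geodesic_ray (X i) (\<rho> i)" for i using cn_space.asymptoticD(1)[OF factor_cn \<rho>(1)] .
  note pray = geodesic_ray_product_ray[OF rays slope]
  have "mdist (product_metric X) (\<tau> t) (product_ray \<rho> \<theta> t) \<le> sqrt (\<Sum>i\<in>UNIV. (mdist (X i) (\<rho> i 0) (\<rho>0 i 0))\<^sup>2)" if t: "0 \<le> t" for t
    unfolding mdist_product_metric
  proof (intro real_sqrt_le_mono sum_mono power_mono)
    fix i
    show "mdist (X i) (\<tau> t i) (product_ray \<rho> \<theta> t i) \<le> mdist (X i) (\<rho> i 0) (\<rho>0 i 0)"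
      using cn_space.asymptoticD(3)[OF factor_cn \<rho>(1)[of i] \<theta>_nonneg[OF t, of i]] \<rho>0(2)[OF t]
      by (simp add: product_ray_def mdist_commute)
  qed simp
  then have "(\<tau>, product_ray \<rho> \<theta>) \<in> asymptotic (product_metric X)"
    using pray P.boundary_ray[OF \<xi>b \<tau>(1)] by (auto simp: asymptotic_def)
  then have "product_ray \<rho> \<theta> \<in> \<xi>" by (rule P.boundary_closed[OF \<xi>b \<tau>(1)])
  then show thesis using that rays \<rho>(2) by blast
qed

lemma product_rays_asymptotic:
  assumes "\<xi> \<in> boundary (product_metric X)" "product_ray \<rho> \<theta> \<in> \<xi>" "product_ray \<rho>' \<theta> \<in> \<xi>"
    and "geodesic_ray (X i) (\<rho> i)" "geodesic_ray (X i) (\<rho>' i)"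
  shows "(\<rho> i, \<rho>' i) \<in> asymptotic (X i)"
  by (rule components_asymptotic[OF assms(1-3)]) (use assms in \<open>auto simp: product_ray_def\<close>)

lemma busemann_proj_limit:
  assumes \<xi>: "\<xi> \<in> boundary (product_metric X)" and \<rho>: "product_ray \<rho> \<theta> \<in> \<xi>" "\<And>i. geodesic_ray (X i) (\<rho> i)"
    and xy: "x \<in> mspace (X i)" "y \<in> mspace (X i)"
  shows "((\<lambda>s. mdist (X i) x (\<rho> i s) - mdist (X i) y (\<rho> i s)) \<longlongrightarrow> busemann (X i) (boundary_proj X \<theta> i \<xi>) x y) at_top"
proof (rule cn_space.busemann_limit[OF factor_cn xy])
  show "\<rho> i \<in> boundary_proj X \<theta> i \<xi>"
    using \<rho> by (auto simp: boundary_proj_def product_ray_def intro!: bexI[of _ "product_ray \<rho> \<theta>"])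
  show "(\<rho> i, \<rho>') \<in> asymptotic (X i)" if \<rho>': "\<rho>' \<in> boundary_proj X \<theta> i \<xi>" for \<rho>'
  proof -
    obtain \<tau> where \<tau>: "geodesic_ray (X i) \<rho>'" "\<tau> \<in> \<xi>" "\<And>t. 0 \<le> t \<Longrightarrow> \<tau> t i = \<rho>' (t * \<theta> $ i)"
      using \<rho>' by (auto simp: boundary_proj_def)
    show ?thesis
      by (rule components_asymptotic[OF \<xi> \<rho>(1) \<tau>(2) \<rho>(2) _ \<tau>(1,3)]) (simp_all add: product_ray_def)
  qed
qed

end

locale product_action = product_space X \<theta>
  for X :: "'i::finite \<Rightarrow> 'a metric" and \<theta> :: "real^'i" +
  fixes \<Gamma> :: "('i \<Rightarrow> 'a \<Rightarrow> 'a) set" and p :: "'i \<Rightarrow> 'a"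
  assumes subgroup: "subgroup \<Gamma> (product_group UNIV (\<lambda>i. isometry_group (X i)))"
    and discontinuous: "properly_discontinuous X \<Gamma>" and base: "p \<in> mspace (product_metric X)"
begin

lemma p_in [simp]: "p i \<in> mspace (X i)" using base by (simp add: mspace_product_iff)

lemma \<Gamma>_isometry: "\<gamma> \<in> \<Gamma> \<Longrightarrow> \<gamma> i \<in> carrier (isometry_group (X i))"
  using subgroup.subset[OF subgroup] by (auto simp: PiE_iff)

lemmas \<Gamma>_in = isometryD(2)[OF \<Gamma>_isometry]
lemmas \<Gamma>_dist = isometryD(3)[OF \<Gamma>_isometry]

text \<open>Multiplication in the isometry group is composition restricted to the space, so the group
operations are transferred to points of the space.\<close>

lemma \<Gamma>_mult:
  assumes "\<gamma> \<in> \<Gamma>" "\<delta> \<in> \<Gamma>"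
  shows "\<exists>\<epsilon>\<in>\<Gamma>. \<forall>i. \<forall>x\<in>mspace (X i). \<epsilon> i x = \<gamma> i (\<delta> i x)"
  using subgroup.m_closed[OF subgroup assms] isometry_group_mult_apply[OF \<Gamma>_isometry[OF assms(1)] \<Gamma>_isometry[OF assms(2)]]
  by (intro bexI[of _ "\<lambda>i\<in>UNIV. \<gamma> i \<otimes>\<^bsub>isometry_group (X i)\<^esub> \<delta> i"]) auto

lemma \<Gamma>_inv:
  assumes "\<gamma> \<in> \<Gamma>"
  shows "\<exists>\<epsilon>\<in>\<Gamma>. \<forall>i. \<forall>x\<in>mspace (X i). \<epsilon> i (\<gamma> i x) = x \<and> \<gamma> i (\<epsilon> i x) = x"
proof -
  have "\<gamma> \<in> (\<Pi>\<^sub>E i\<in>UNIV. carrier (isometry_group (X i)))" using \<Gamma>_isometry[OF assms] by auto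
  then have "inv\<^bsub>product_group UNIV (\<lambda>i. isometry_group (X i))\<^esub> \<gamma>
      = (\<lambda>i\<in>UNIV. inv\<^bsub>isometry_group (X i)\<^esub> \<gamma> i)"
    by (rule inv_product_group) (rule group_isometry_group)
  then have "(\<lambda>i. inv\<^bsub>isometry_group (X i)\<^esub> \<gamma> i) \<in> \<Gamma>"
    using subgroup.m_inv_closed[OF subgroup assms] by (simp add: restrict_UNIV)
  then show ?thesis using isometry_group_inv_apply[OF \<Gamma>_isometry[OF assms]]
    by (intro bexI[of _ "\<lambda>i. inv\<^bsub>isometry_group (X i)\<^esub> \<gamma> i"]) auto
qed

lemma \<Gamma>_funpow:
  assumes "\<gamma> \<in> \<Gamma>"
  shows "\<exists>\<epsilon>\<in>\<Gamma>. \<forall>i. \<forall>x\<in>mspace (X i). \<epsilon> i x = (\<gamma> i ^^ n) x"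
proof (induction n)
  case 0
  obtain \<delta> where \<delta>: "\<delta> \<in> \<Gamma>" "\<And>i x. x \<in> mspace (X i) \<Longrightarrow> \<delta> i (\<gamma> i x) = x" using \<Gamma>_inv[OF assms] by blast
  then show ?case using \<Gamma>_mult[OF \<delta>(1) assms] by auto
next
  case (Suc n)
  then obtain \<delta> where \<delta>: "\<delta> \<in> \<Gamma>" "\<And>i x. x \<in> mspace (X i) \<Longrightarrow> \<delta> i x = (\<gamma> i ^^ n) x" by blast
  then show ?case using \<Gamma>_mult[OF assms \<delta>(1)] by auto
qed

lemma \<Gamma>_ext:
  assumes "\<gamma> \<in> \<Gamma>" "\<delta> \<in> \<Gamma>" "\<And>i x. x \<in> mspace (X i) \<Longrightarrow> \<gamma> i x = \<delta> i x"
  shows "\<gamma> = \<delta>"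
proof
  fix i
  have "\<gamma> i \<in> extensional (mspace (X i))" "\<delta> i \<in> extensional (mspace (X i))"
    using \<Gamma>_isometry[OF assms(1), of i] \<Gamma>_isometry[OF assms(2), of i]
    by (auto simp: isometry_group_def Bij_imp_extensional)
  then show "\<gamma> i = \<delta> i" using assms(3) by (rule extensionalityI)
qed

lemma act_in: "\<gamma> \<in> \<Gamma> \<Longrightarrow> x \<in> mspace (product_metric X) \<Longrightarrow> act \<gamma> x \<in> mspace (product_metric X)"
  by (auto simp: mspace_product_iff act_def \<Gamma>_in)

lemma act_dist:
  "\<gamma> \<in> \<Gamma> \<Longrightarrow> x \<in> mspace (product_metric X) \<Longrightarrow> y \<in> mspace (product_metric X) \<Longrightarrow>
    mdist (product_metric X) (act \<gamma> x) (act \<gamma> y) = mdist (product_metric X) x y"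
  by (auto simp: mspace_product_iff act_def \<Gamma>_dist mdist_product_metric)

lemma finite_orbit: "finite {\<gamma> \<in> \<Gamma>. mdist (product_metric X) p (act \<gamma> p) \<le> C}"
proof -
  let ?K = "P.mcball p \<bar>C\<bar>"
  have K: "finite {\<gamma> \<in> \<Gamma>. act \<gamma> ` ?K \<inter> ?K \<noteq> {}}"
    using discontinuous P.compact_mcball[OF base] by (simp add: properly_discontinuous_def mtopology_of_def)
  have "p \<in> ?K" using base by simp
  then have "{\<gamma> \<in> \<Gamma>. mdist (product_metric X) p (act \<gamma> p) \<le> C} \<subseteq> {\<gamma> \<in> \<Gamma>. act \<gamma> ` ?K \<inter> ?K \<noteq> {}}"
    using act_in[OF _ base] base by fastforce
  then show ?thesis using K finite_subset by blast
qed

end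

section \<open>Pushing points behind and boundary points in front of the axes\<close>

text \<open>Every factor spoils at most one exponent, and there is one more exponent than factors.\<close>

lemma pigeonhole_exponent:
  fixes bad :: "'i::finite \<Rightarrow> nat \<Rightarrow> bool"
  assumes "\<And>i j k. j < k \<Longrightarrow> bad i j \<Longrightarrow> bad i k \<Longrightarrow> False"
  shows "\<exists>k\<le>CARD('i). \<forall>i. \<not> bad i k"
proof (rule ccontr)
  assume "\<not> ?thesis"
  then have "\<forall>k. \<exists>i. k \<le> CARD('i) \<longrightarrow> bad i k" by blast
  then obtain w where w: "\<And>k. k \<le> CARD('i) \<Longrightarrow> bad (w k) k" by metis
  have "inj_on w {..CARD('i)}"
  proof (rule inj_onI)
    fix j k assume "j \<in> {..CARD('i)}" "k \<in> {..CARD('i)}" and eq: "w j = w k"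
    then have "bad (w j) j" "bad (w j) k" using w[of j] w[of k] by auto
    then show "j = k" using assms[of j k "w j"] assms[of k j "w j"] by (cases j k rule: linorder_cases) auto
  qed
  then have "card {..CARD('i)} \<le> CARD('i)" using card_inj_on_le[of w "{..CARD('i)}" "UNIV :: 'i set"] by simp
  then show False by simp
qed

locale contracting_action = product_action X \<theta> \<Gamma> p
  for X :: "'i::finite \<Rightarrow> 'a metric" and \<theta> \<Gamma> p +
  fixes g h :: "'i \<Rightarrow> 'a \<Rightarrow> 'a" and F :: "'i \<Rightarrow> 'a \<Rightarrow> real" and \<sigma> :: "'i \<Rightarrow> real \<Rightarrow> 'a" and l T c K :: "'i \<Rightarrow> real"
  assumes g\<Gamma>: "g \<in> \<Gamma>" and h\<Gamma>: "h \<in> \<Gamma>"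
    and coord: "\<And>i. contracting_coordinate (X i) (g i) (h i) (F i) (\<sigma> i) (l i) (T i) (c i) (K i)"
begin

lemmas coord_pos = contracting_coordinate.pos[OF coord]
lemmas coord_\<sigma> [simp] = contracting_coordinate.\<sigma>_in[OF coord]
lemmas coord_shift = contracting_coordinate.F_shift[OF coord]
lemmas coord_lipschitz = contracting_coordinate.F_lipschitz[OF coord]
lemmas coord_contracting = contracting_coordinate.contracting[OF coord]
lemmas coord_stays = contracting_coordinate.F_stays[OF coord]
lemmas coord_points = contracting_coordinate.F_points[OF coord]
lemmas coord_rays = contracting_coordinate.F_rays[OF coord]

lemma coord_shift_funpow:
  "x \<in> mspace (X i) \<Longrightarrow> F i ((h i ^^ n) x) = F i x + real n * l i"
  by (induction n) (simp_all add: coord_shift funpow_isometry(1)[OF \<Gamma>_isometry[OF h\<Gamma>]] algebra_simps)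

text \<open>By independence the isometries \<open>g i ^^ k\<close> and \<open>g i ^^ j\<close> for \<open>j
\<noteq> k\<close> do not both take a point near the positive end of the axis of \<open>h
i\<close>, so one exponent \<open>k \<le> r\<close> is good for all factors. A fixed power
\<open>N\<close> of the inverse of \<open>h\<close> then moves the point behind the axes. It is
essential that finitely many elements suffice for all points.\<close>

lemma push_points:
  obtains \<Lambda> where "\<And>k. \<Lambda> k \<in> \<Gamma>"
    "\<And>y. y \<in> mspace (product_metric X) \<Longrightarrow> \<exists>k\<le>CARD('i). \<forall>i. F i (\<Lambda> k i (y i)) \<le> - T i"
proof -
  define B where "B i j = (SOME b. \<forall>y\<in>mspace (X i). F i y \<le> b \<or> F i ((g i ^^ j) y) \<le> b)" for i j
  have B: "F i y \<le> B i j \<or> F i ((g i ^^ j) y) \<le> B i j" if "0 < j" "y \<in> mspace (X i)" for i j y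
    using someI_ex[OF coord_points[OF that(1), of i]] that(2) unfolding B_def by blast
  \<comment> \<open>A common bound: above \<open>b\<close>, points of any factor count as near the
    positive end.\<close>
  define b where "b = Max ((\<lambda>(i, j). B i j) ` (UNIV \<times> {..CARD('i)}))"
  have b: "B i j \<le> b" if "j \<le> CARD('i)" for i j
  proof -
    have "(\<lambda>(i, j). B i j) (i, j) \<in> (\<lambda>(i, j). B i j) ` (UNIV \<times> {..CARD('i)})" using that by (intro imageI) auto
    then show ?thesis unfolding b_def by (intro Max_ge) auto
  qed
  define N where "N = nat \<lceil>Max (range (\<lambda>i. (b + T i) / l i))\<rceil>"
  have N: "b - real N * l i \<le> - T i" for i
  proof -
    have "(b + T i) / l i \<le> Max (range (\<lambda>i. (b + T i) / l i))" by (intro Max_ge) auto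
    also have "\<dots> \<le> real N" unfolding N_def by linarith
    finally show ?thesis using coord_pos(1)[of i] by (simp add: pos_divide_le_eq)
  qed
  obtain h' where h': "h' \<in> \<Gamma>" "\<And>i x. x \<in> mspace (X i) \<Longrightarrow> h i (h' i x) = x" using \<Gamma>_inv[OF h\<Gamma>] by blast
  have h'F: "F i ((h' i ^^ n) x) = F i x - real n * l i" if x: "x \<in> mspace (X i)" for i n x
  proof (induction n)
    case (Suc n)
    let ?u = "(h' i ^^ n) x"
    have u: "?u \<in> mspace (X i)" by (rule funpow_isometry(1)[OF \<Gamma>_isometry[OF h'(1)] x])
    have "F i (h i (h' i ?u)) = F i (h' i ?u) + l i" by (rule coord_shift[OF \<Gamma>_in[OF h'(1) u]])
    then show ?case using h'(2)[OF u] Suc by (simp add: algebra_simps)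
  qed simp
  obtain hN where hN: "hN \<in> \<Gamma>" "\<And>i x. x \<in> mspace (X i) \<Longrightarrow> hN i x = (h' i ^^ N) x"
    using \<Gamma>_funpow[OF h'(1), of N] by blast
  have "\<exists>\<epsilon>\<in>\<Gamma>. \<forall>i. \<forall>x\<in>mspace (X i). \<epsilon> i x = hN i ((g i ^^ k) x)" for k
  proof -
    obtain \<delta> where \<delta>: "\<delta> \<in> \<Gamma>" "\<And>i x. x \<in> mspace (X i) \<Longrightarrow> \<delta> i x = (g i ^^ k) x" using \<Gamma>_funpow[OF g\<Gamma>, of k] by blast
    then show ?thesis using \<Gamma>_mult[OF hN(1) \<delta>(1)] by auto
  qed
  then obtain \<Lambda> where \<Lambda>: "\<And>k. \<Lambda> k \<in> \<Gamma>" "\<And>k i x. x \<in> mspace (X i) \<Longrightarrow> \<Lambda> k i x = hN i ((g i ^^ k) x)" by metis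
  show thesis
  proof (rule that[of \<Lambda>])
    show "\<Lambda> k \<in> \<Gamma>" for k by (rule \<Lambda>(1))
    fix y assume y: "y \<in> mspace (product_metric X)"
    then have yi: "y i \<in> mspace (X i)" for i by (simp add: mspace_product_iff)
    have gy: "(g i ^^ k) (y i) \<in> mspace (X i)" for i k by (rule funpow_isometry(1)[OF \<Gamma>_isometry[OF g\<Gamma>] yi])
    have "\<exists>k\<le>CARD('i). \<forall>i. \<not> (k \<le> CARD('i) \<and> b < F i ((g i ^^ k) (y i)))"
    proof (rule pigeonhole_exponent)
      fix i j k assume jk: "j < k" and 1: "j \<le> CARD('i) \<and> b < F i ((g i ^^ j) (y i))"
        and 2: "k \<le> CARD('i) \<and> b < F i ((g i ^^ k) (y i))"
      have "(g i ^^ (k - j)) ((g i ^^ j) (y i)) = (g i ^^ k) (y i)"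
        using jk funpow_add[of "k - j" j "g i"] by (simp add: o_def fun_eq_iff)
      then show False using B[of "k - j" "(g i ^^ j) (y i)" i] gy jk 1 2 b[of "k - j" i] by force
    qed
    then obtain k where k: "k \<le> CARD('i)" "\<And>i. F i ((g i ^^ k) (y i)) \<le> b" by (auto simp: not_less)
    have "F i (\<Lambda> k i (y i)) \<le> - T i" for i
      using \<Lambda>(2)[OF yi, of k i] hN(2)[OF gy, of i k] h'F[OF gy, of i N k] k(2)[of i] N[of i] by simp
    then show "\<exists>k\<le>CARD('i). \<forall>i. F i (\<Lambda> k i (y i)) \<le> - T i" using k(1) by blast
  qed
qed

text \<open>The analogue for rays: some power of \<open>g\<close> takes the ray to a ray that does not tend to
the negative end in any factor, so that a power of \<open>h\<close> pushes it forward as far as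
desired.\<close>

lemma push_rays:
  assumes \<rho>: "\<And>i. geodesic_ray (X i) (\<rho> i)"
  shows "\<exists>\<delta>\<in>\<Gamma>. \<forall>i. \<forall>t\<ge>0. a i \<le> F i (\<delta> i (\<rho> i t))"
proof -
  have \<rho>in: "\<rho> i t \<in> mspace (X i)" if "0 \<le> t" for i t using cn_space.geodesic_rayD(1)[OF factor_cn \<rho> that] .
  have "\<exists>k\<le>CARD('i). \<forall>i. \<not> (\<not> (\<exists>B. \<forall>t\<ge>0. B \<le> F i ((g i ^^ k) (\<rho> i t))))"
    by (rule pigeonhole_exponent) (use coord_rays[OF \<rho>] in blast)
  then obtain k B where B: "\<And>i t. 0 \<le> t \<Longrightarrow> B i \<le> F i ((g i ^^ k) (\<rho> i t))" by metis
  define N where "N = nat \<lceil>Max (range (\<lambda>i. (a i - B i) / l i))\<rceil>"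
  have N: "a i \<le> B i + real N * l i" for i
  proof -
    have "(a i - B i) / l i \<le> Max (range (\<lambda>i. (a i - B i) / l i))" by (intro Max_ge) auto
    also have "\<dots> \<le> real N" unfolding N_def by linarith
    finally show ?thesis using coord_pos(1)[of i] by (simp add: pos_divide_le_eq)
  qed
  obtain gk where gk: "gk \<in> \<Gamma>" "\<And>i x. x \<in> mspace (X i) \<Longrightarrow> gk i x = (g i ^^ k) x" using \<Gamma>_funpow[OF g\<Gamma>, of k] by blast
  obtain hN where hN: "hN \<in> \<Gamma>" "\<And>i x. x \<in> mspace (X i) \<Longrightarrow> hN i x = (h i ^^ N) x" using \<Gamma>_funpow[OF h\<Gamma>, of N] by blast
  obtain \<delta> where \<delta>: "\<delta> \<in> \<Gamma>" "\<And>i x. x \<in> mspace (X i) \<Longrightarrow> \<delta> i x = hN i (gk i x)" using \<Gamma>_mult[OF hN(1) gk(1)] by blast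
  have "a i \<le> F i (\<delta> i (\<rho> i t))" if t: "0 \<le> t" for i t
  proof -
    have "gk i (\<rho> i t) \<in> mspace (X i)" by (rule \<Gamma>_in[OF gk(1) \<rho>in[OF t]])
    then have "F i (\<delta> i (\<rho> i t)) = F i (gk i (\<rho> i t)) + real N * l i"
      using \<delta>(2)[OF \<rho>in[OF t], of i] hN(2) coord_shift_funpow by simp
    then show ?thesis using gk(2)[OF \<rho>in[OF t], of i] B[OF t, of i] N[of i] by simp
  qed
  then show ?thesis using \<delta>(1) by blast
qed

text \<open>In every factor the geodesics from \<open>x i\<close> to far points of the ray \<open>\<rho>
i\<close> pass near \<open>\<sigma> i 0\<close>, by contraction. So do their limits, and the
distance from \<open>x i\<close> to far points of \<open>\<rho> i\<close> is the sum of the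
distances to and from a neighbourhood of \<open>p i\<close>, up to a constant. The second fact
determines the Busemann function.\<close>

lemma seen_from_behind:
  assumes \<eta>: "\<eta> \<in> boundary_slope X \<theta>" and \<rho>: "\<And>i. geodesic_ray (X i) (\<rho> i)" "\<And>i. \<rho> i 0 = p i" "product_ray \<rho> \<theta> \<in> \<eta>"
    and in_front: "\<And>i t. t0 \<le> t \<Longrightarrow> T i \<le> F i (\<rho> i t)"
    and x: "x \<in> mspace (product_metric X)" and behind: "\<And>i. F i (x i) \<le> - T i"
  shows ray_passes: "\<exists>\<tau>. (\<forall>i. geodesic_ray (X i) (\<tau> i) \<and> \<tau> i 0 = x i) \<and> product_ray \<tau> \<theta> \<in> \<eta>
      \<and> (\<forall>i. \<exists>s\<ge>0. mdist (X i) (\<sigma> i 0) (\<tau> i s) \<le> c i + 1)"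
    and busemann_estimate: "\<bar>busemann (X i) (boundary_proj X \<theta> i \<eta>) (p i) (x i) + mdist (X i) (p i) (x i)\<bar>
      \<le> 2 * c i + 2 * mdist (X i) (p i) (\<sigma> i 0)"
proof -
  have \<eta>b: "\<eta> \<in> boundary (product_metric X)" using \<eta> by (simp add: boundary_slope_def)
  have xi: "x i \<in> mspace (X i)" for i using x by (simp add: mspace_product_iff)
  have \<rho>in: "\<rho> i t \<in> mspace (X i)" if "0 \<le> t" for i t using cn_space.geodesic_rayD(1)[OF factor_cn \<rho>(1) that] .
  have near: "\<exists>k\<in>{0..1}. mdist (X i) (\<sigma> i 0) (cn_space.pt (X i) (x i) (\<rho> i t) k) \<le> c i"
    if "t0 \<le> t" "0 \<le> t" for i t
    using coord_contracting[OF xi \<rho>in[OF that(2)], of i 0] behind[of i] in_front[OF that(1), of i] by simp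
  obtain \<tau> where \<tau>: "\<And>i. geodesic_ray (X i) (\<tau> i)" "\<And>i. \<tau> i 0 = x i" "product_ray \<tau> \<theta> \<in> \<eta>"
    using slope_ray_from[OF \<eta> x] by metis
  have "\<exists>s\<ge>0. mdist (X i) (\<sigma> i 0) (\<tau> i s) \<le> c i + 1" for i
  proof -
    have as: "(\<tau> i, \<rho> i) \<in> asymptotic (X i)" by (rule product_rays_asymptotic[OF \<eta>b \<tau>(3) \<rho>(3) \<tau>(1) \<rho>(1)])
    define t where "t = max 0 (max t0 (mdist (X i) (\<tau> i 0) (\<rho> i 0) * (mdist (X i) (\<tau> i 0) (\<sigma> i 0) + c i + 1)))"
    have t: "0 \<le> t" "t0 \<le> t" "mdist (X i) (\<tau> i 0) (\<rho> i 0) * (mdist (X i) (\<tau> i 0) (\<sigma> i 0) + c i + 1) \<le> t"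
      unfolding t_def by simp_all
    obtain k where k: "k \<in> {0..1}" "mdist (X i) (\<sigma> i 0) (cn_space.pt (X i) (\<tau> i 0) (\<rho> i t) k) \<le> c i"
      using near[OF t(2,1), of i] unfolding \<tau>(2) by blast
    then show ?thesis
      by (intro cn_space.asymptotic_ray_passes[OF factor_cn as coord_\<sigma> _ _ k(2) t(3,1) coord_pos(3)]) auto
  qed
  then show "\<exists>\<tau>. (\<forall>i. geodesic_ray (X i) (\<tau> i) \<and> \<tau> i 0 = x i) \<and> product_ray \<tau> \<theta> \<in> \<eta>
      \<and> (\<forall>i. \<exists>s\<ge>0. mdist (X i) (\<sigma> i 0) (\<tau> i s) \<le> c i + 1)" using \<tau> by blast
  let ?d = "mdist (X i)" and ?e = "mdist (X i) (p i) (\<sigma> i 0)"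
  have lim: "((\<lambda>s. ?d (p i) (\<rho> i s) - ?d (x i) (\<rho> i s)) \<longlongrightarrow> busemann (X i) (boundary_proj X \<theta> i \<eta>) (p i) (x i)) at_top"
    by (rule busemann_proj_limit[OF \<eta>b \<rho>(3,1) p_in xi])
  have bounds: "\<forall>\<^sub>F s in at_top. - ?d (p i) (x i) \<le> ?d (p i) (\<rho> i s) - ?d (x i) (\<rho> i s) \<and>
      ?d (p i) (\<rho> i s) - ?d (x i) (\<rho> i s) \<le> - ?d (p i) (x i) + 2 * c i + 2 * ?e"
    using eventually_ge_at_top[of "max 0 t0"]
  proof eventually_elim
    case (elim s)
    then have s: "0 \<le> s" "t0 \<le> s" by auto
    obtain k where k: "k \<in> {0..1}" "?d (\<sigma> i 0) (cn_space.pt (X i) (x i) (\<rho> i s) k) \<le> c i" using near[OF s(2,1)] by blast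
    let ?w = "cn_space.pt (X i) (x i) (\<rho> i s) k"
    have w: "?w \<in> mspace (X i)" using cn_space.pt_in[OF factor_cn xi \<rho>in[OF s(1)]] k(1) by auto
    have "?d (x i) ?w + ?d ?w (\<rho> i s) = ?d (x i) (\<rho> i s)"
      using cn_space.pt_dist[OF factor_cn xi \<rho>in[OF s(1)], of k i] k(1) by (simp add: algebra_simps)
    moreover have "?d (p i) (x i) \<le> ?e + ?d (\<sigma> i 0) ?w + ?d (x i) ?w"
      using mdist_triangle[of "p i" "X i" "\<sigma> i 0" "x i"] mdist_triangle[of "\<sigma> i 0" "X i" ?w "x i"] w xi
      by (simp add: mdist_commute)
    moreover have "?d (p i) (\<rho> i s) \<le> ?e + ?d (\<sigma> i 0) ?w + ?d ?w (\<rho> i s)"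
      using mdist_triangle[of "p i" "X i" "\<sigma> i 0" "\<rho> i s"] mdist_triangle[of "\<sigma> i 0" "X i" ?w "\<rho> i s"] w xi \<rho>in[OF s(1)]
      by simp
    moreover have "?d (x i) (\<rho> i s) \<le> ?d (p i) (x i) + ?d (p i) (\<rho> i s)"
      using mdist_triangle[of "x i" "X i" "p i" "\<rho> i s"] xi \<rho>in[OF s(1)] by (simp add: mdist_commute)
    ultimately show ?case using k(2) by linarith
  qed
  have "- ?d (p i) (x i) \<le> busemann (X i) (boundary_proj X \<theta> i \<eta>) (p i) (x i)"
    by (rule tendsto_lowerbound[OF lim]) (use bounds in \<open>auto elim: eventually_mono\<close>)
  moreover have "busemann (X i) (boundary_proj X \<theta> i \<eta>) (p i) (x i) \<le> - ?d (p i) (x i) + 2 * c i + 2 * ?e"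
    by (rule tendsto_upperbound[OF lim]) (use bounds in \<open>auto elim: eventually_mono\<close>)
  moreover have "0 \<le> 2 * c i + 2 * ?e" using coord_pos(3)[of i] mdist_nonneg[of "X i" "p i" "\<sigma> i 0"] by linarith
  ultimately show "\<bar>busemann (X i) (boundary_proj X \<theta> i \<eta>) (p i) (x i) + ?d (p i) (x i)\<bar> \<le> 2 * c i + 2 * ?e"
    by (simp add: abs_le_iff)
qed

text \<open>The element \<open>\<delta>\<close> moves a ray of \<open>\<xi>\<close> far in front. The ray from
\<open>p\<close> to the image of \<open>\<xi>\<close> then passes near \<open>\<sigma> i (m
i)\<close> in every factor and hence remains in front of \<open>a' i\<close> after some time. A
cone neighbourhood of a large radius \<open>R\<close> inherits this with a loss of
\<open>1\<close>: its rays are in front of \<open>a i + K i\<close> at time \<open>R\<close>, and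
by \<open>F_stays\<close> they never return behind \<open>a i\<close>. The values \<open>a'
i\<close> and \<open>m i\<close> leave room for these losses.\<close>

lemma move_to_front:
  assumes \<xi>: "\<xi> \<in> boundary_slope X \<theta>"
  obtains \<delta> U t0 where "\<delta> \<in> \<Gamma>" "openin (boundary_topology (product_metric X)) U"
    "boundary_action (product_metric X) (act \<delta>) \<xi> \<in> U"
    "\<And>\<eta>. \<eta> \<in> U \<Longrightarrow> \<eta> \<in> boundary_slope X \<theta> \<Longrightarrow> \<exists>\<rho>. (\<forall>i. geodesic_ray (X i) (\<rho> i) \<and> \<rho> i 0 = p i)
        \<and> product_ray \<rho> \<theta> \<in> \<eta> \<and> (\<forall>i. \<forall>t\<ge>t0. T i \<le> F i (\<rho> i t))"
proof -
  let ?P = "product_metric X"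
  have \<xi>b: "\<xi> \<in> boundary ?P" using \<xi> by (simp add: boundary_slope_def)
  define a where "a i = max (T i) (F i (p i))" for i
  define a' where "a' i = a i + K i + 1" for i
  define m where "m i = a' i + K i + c i + 1 + T i" for i
  obtain \<rho>1 where \<rho>1: "\<And>i. geodesic_ray (X i) (\<rho>1 i)" "product_ray \<rho>1 \<theta> \<in> \<xi>" using slope_ray_from[OF \<xi> base] by metis
  obtain \<delta> where \<delta>: "\<delta> \<in> \<Gamma>" "\<And>i t. 0 \<le> t \<Longrightarrow> m i + T i \<le> F i (\<delta> i (\<rho>1 i t))"
    using push_rays[OF \<rho>1(1), of "\<lambda>i. m i + T i"] by blast
  note iso = act_in[OF \<delta>(1)] act_dist[OF \<delta>(1)]
  define \<xi>0 where "\<xi>0 = boundary_action ?P (act \<delta>) \<xi>"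
  define \<rho>2 where "\<rho>2 i = \<delta> i \<circ> \<rho>1 i" for i
  have \<xi>0b: "\<xi>0 \<in> boundary ?P" unfolding \<xi>0_def by (rule P.boundary_action_eq(3)[OF iso \<xi>b \<rho>1(2)])
  have r2: "geodesic_ray (X i) (\<rho>2 i)" for i
    unfolding \<rho>2_def by (rule cn_space.isometry_ray[OF factor_cn \<Gamma>_in[OF \<delta>(1)] \<Gamma>_dist[OF \<delta>(1)] \<rho>1(1)])
  have "act \<delta> \<circ> product_ray \<rho>1 \<theta> = product_ray \<rho>2 \<theta>" by (simp add: fun_eq_iff act_def product_ray_def \<rho>2_def)
  then have p2: "product_ray \<rho>2 \<theta> \<in> \<xi>0" using P.boundary_action_eq(2)[OF iso \<xi>b \<rho>1(2)] by (simp add: \<xi>0_def)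
  have "has_slope X (product_ray \<rho>2 \<theta>) \<theta>"
    using r2 E_plusD(3,4)[OF slope] by (auto simp: has_slope_def product_ray_def)
  then have \<xi>0s: "\<xi>0 \<in> boundary_slope X \<theta>" using \<xi>0b p2 by (auto simp: boundary_slope_def)
  obtain \<rho>0 where \<rho>0: "\<And>i. geodesic_ray (X i) (\<rho>0 i)" "\<And>i. \<rho>0 i 0 = p i" "product_ray \<rho>0 \<theta> \<in> \<xi>0"
    using slope_ray_from[OF \<xi>0s base] by metis
  have \<rho>0in: "\<rho>0 i t \<in> mspace (X i)" if "0 \<le> t" for i t using cn_space.geodesic_rayD(1)[OF factor_cn \<rho>0(1) that] .
  have \<rho>2in: "\<rho>2 i t \<in> mspace (X i)" if "0 \<le> t" for i t using cn_space.geodesic_rayD(1)[OF factor_cn r2 that] .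
  have "\<exists>s\<ge>0. \<forall>t\<ge>s. a' i \<le> F i (\<rho>0 i t)" for i
  proof -
    have as: "(\<rho>0 i, \<rho>2 i) \<in> asymptotic (X i)" by (rule product_rays_asymptotic[OF \<xi>0b \<rho>0(3) p2 \<rho>0(1) r2])
    define t where "t = max 0 (mdist (X i) (\<rho>0 i 0) (\<rho>2 i 0) * (mdist (X i) (\<rho>0 i 0) (\<sigma> i (m i)) + c i + 1))"
    have Fp: "F i (\<rho>0 i 0) \<le> m i - T i"
      using coord_pos(3,4)[of i] by (simp add: \<rho>0(2) m_def a'_def a_def)
    have t: "0 \<le> t" "mdist (X i) (\<rho>0 i 0) (\<rho>2 i 0) * (mdist (X i) (\<rho>0 i 0) (\<sigma> i (m i)) + c i + 1) \<le> t"
      unfolding t_def by simp_all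
    have "m i + T i \<le> F i (\<rho>2 i t)" using \<delta>(2)[OF t(1), of i] by (simp add: \<rho>2_def)
    then obtain k where k: "k \<in> {0..1}" "mdist (X i) (\<sigma> i (m i)) (cn_space.pt (X i) (\<rho>0 i 0) (\<rho>2 i t) k) \<le> c i"
      using coord_contracting[OF \<rho>0in[OF order_refl] \<rho>2in[OF t(1)] Fp] by blast
    obtain s where s: "s \<ge> 0" "mdist (X i) (\<sigma> i (m i)) (\<rho>0 i s) \<le> c i + 1"
      using cn_space.asymptotic_ray_passes[OF factor_cn as coord_\<sigma> _ _ k(2) t(2,1) coord_pos(3)] k(1) by auto
    have "m i - F i (\<rho>0 i s) \<le> c i + 1"
      using coord_lipschitz[of "\<sigma> i (m i)" i "\<rho>0 i s"] \<rho>0in[OF s(1), of i] s(2) contracting_coordinate.F_\<sigma>[OF coord]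
      by (simp add: abs_le_iff)
    then have big: "a' i + K i \<le> F i (\<rho>0 i s)" using coord_pos(2)[of i] by (simp add: m_def)
    have "F i (\<rho>0 i 0) \<le> a' i" using coord_pos(4)[of i] by (simp add: \<rho>0(2) a'_def a_def)
    then have "a' i \<le> F i (\<rho>0 i t)" if "s \<le> t" for t by (rule coord_stays[OF \<rho>0(1) _ s(1) big that])
    then show ?thesis using s(1) by blast
  qed
  then obtain s where s: "\<And>i. 0 \<le> s i" "\<And>i t. s i \<le> t \<Longrightarrow> a' i \<le> F i (\<rho>0 i t)" by metis
  \<comment> \<open>At time \<open>R\<close> of the product ray all factors have passed their
    times \<open>s i\<close>.\<close>
  define R where "R = 1 + Max (range (\<lambda>i. s i / \<theta> $ i))"
  have R: "0 < R" "s i \<le> R * \<theta> $ i" for i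
  proof -
    have "s i / \<theta> $ i \<le> Max (range (\<lambda>i. s i / \<theta> $ i))" for i by (intro Max_ge) auto
    then have *: "s i / \<theta> $ i \<le> R" for i unfolding R_def by (meson add_increasing le_numeral_extra(1))
    show "s i \<le> R * \<theta> $ i" using *[of i] \<theta>_pos[of i] by (simp add: pos_divide_le_eq)
    have "0 \<le> s i / \<theta> $ i" for i using s(1)[of i] \<theta>_pos[of i] by simp
    then have "0 \<le> Max (range (\<lambda>i. s i / \<theta> $ i))" by (subst Max_ge_iff) auto
    then show "0 < R" by (simp add: R_def)
  qed
  let ?c0 = "product_ray \<rho>0 \<theta>"
  have ray0: "geodesic_ray ?P ?c0" by (rule geodesic_ray_product_ray[OF \<rho>0(1) slope])
  have c0p: "?c0 0 = p" by (simp add: product_ray_def \<rho>0(2) fun_eq_iff)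
  define U where "U = Inr -` cone_nbhd ?P ?c0 R 1 \<inter> boundary ?P"
  define t0 where "t0 = R * Max (range (($) \<theta>))"
  show thesis
  proof (rule that[of \<delta> U t0])
    show "\<delta> \<in> \<Gamma>" by fact
    show "openin (boundary_topology ?P) U"
      unfolding U_def P.openin_boundary_topology using P.openin_cone_nbhd[OF ray0 R(1), of 1] by auto
    have "mdist ?P (?c0 R) (?c0 R) = 0" using P.geodesic_rayD(2)[OF ray0, of R R] R(1) by simp
    then have "\<xi>0 \<in> U" using \<xi>0b \<rho>0(3) by (auto simp: U_def P.Inr_in_cone_nbhd)
    then show "boundary_action ?P (act \<delta>) \<xi> \<in> U" by (simp add: \<xi>0_def)
    fix \<eta> assume \<eta>: "\<eta> \<in> U" "\<eta> \<in> boundary_slope X \<theta>"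
    then obtain \<tau> where \<tau>: "\<eta> \<in> boundary ?P" "\<tau> \<in> \<eta>" "\<tau> 0 = p" "mdist ?P (\<tau> R) (?c0 R) < 1"
      by (auto simp: U_def P.Inr_in_cone_nbhd c0p)
    obtain \<rho> where \<rho>: "\<And>i. geodesic_ray (X i) (\<rho> i)" "\<And>i. \<rho> i 0 = p i" "product_ray \<rho> \<theta> \<in> \<eta>"
      using slope_ray_from[OF \<eta>(2) base] by metis
    have "product_ray \<rho> \<theta> 0 = p" by (simp add: product_ray_def \<rho>(2) fun_eq_iff)
    \<comment> \<open>Rays from \<open>p\<close> in the same class coincide at nonnegative times,
      so the ray of the cone neighbourhood is the product ray.\<close>
    then have \<tau>R: "\<tau> R = product_ray \<rho> \<theta> R"
      using P.asymptotic_same_start[OF P.boundary_asymptotic[OF \<tau>(1,2) \<rho>(3)]] \<tau>(3) R(1) by simp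
    have "T i \<le> F i (\<rho> i t)" if t: "t0 \<le> t" for i t
    proof -
      let ?u = "R * \<theta> $ i"
      have u: "0 \<le> ?u" using R(1) \<theta>_pos[of i] by simp
      have "mdist (X i) (\<rho> i ?u) (\<rho>0 i ?u) \<le> mdist ?P (\<tau> R) (?c0 R)"
        unfolding \<tau>R using mdist_component_le[of X i "product_ray \<rho> \<theta> R" "?c0 R"] by (simp add: product_ray_def)
      then have "mdist (X i) (\<rho> i ?u) (\<rho>0 i ?u) < 1" using \<tau>(4) by simp
      then have "F i (\<rho>0 i ?u) - 1 \<le> F i (\<rho> i ?u)"
        using coord_lipschitz[of "\<rho> i ?u" i "\<rho>0 i ?u"] \<rho>0in[OF u, of i] cn_space.geodesic_rayD(1)[OF factor_cn \<rho>(1) u, of i]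
        by (simp add: abs_le_iff)
      then have big: "a i + K i \<le> F i (\<rho> i ?u)" using s(2)[OF R(2), of i] by (simp add: a'_def)
      have "\<theta> $ i \<le> Max (range (($) \<theta>))" by (intro Max_ge) auto
      then have "?u \<le> t0" unfolding t0_def using R(1) by (intro mult_left_mono) auto
      then have "?u \<le> t" using t by simp
      moreover have "F i (\<rho> i 0) \<le> a i" by (simp add: \<rho>(2) a_def)
      ultimately have "a i \<le> F i (\<rho> i t)" using coord_stays[OF \<rho>(1) _ u big] by blast
      then show ?thesis by (simp add: a_def)
    qed
    then show "\<exists>\<rho>. (\<forall>i. geodesic_ray (X i) (\<rho> i) \<and> \<rho> i 0 = p i)
        \<and> product_ray \<rho> \<theta> \<in> \<eta> \<and> (\<forall>i. \<forall>t\<ge>t0. T i \<le> F i (\<rho> i t))" using \<rho> by blast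
  qed
qed

end

section \<open>The shadow lemma\<close>

context contracting_action
begin

abbreviation (input) "PX \<equiv> product_metric X"
abbreviation (input) "BT \<equiv> boundary_topology (product_metric X)"

lemma boundary_action_measurable:
  assumes "\<gamma> \<in> \<Gamma>"
  shows "boundary_action PX (act \<gamma>) \<in> borel_of BT \<rightarrow>\<^sub>M borel_of BT"
    and "openin BT V \<Longrightarrow> openin BT {\<xi> \<in> boundary PX. boundary_action PX (act \<gamma>) \<xi> \<in> V}"
proof -
  obtain \<gamma>' where \<gamma>': "\<gamma>' \<in> \<Gamma>" "\<And>i x. x \<in> mspace (X i) \<Longrightarrow> \<gamma>' i (\<gamma> i x) = x"
    "\<And>i x. x \<in> mspace (X i) \<Longrightarrow> \<gamma> i (\<gamma>' i x) = x" using \<Gamma>_inv[OF assms] by blast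
  have inv: "act \<gamma>' (act \<gamma> x) = x" "act \<gamma> (act \<gamma>' x) = x" if "x \<in> mspace PX" for x
    using that \<gamma>'(2,3) by (auto simp: act_def mspace_product_iff fun_eq_iff)
  show "boundary_action PX (act \<gamma>) \<in> borel_of BT \<rightarrow>\<^sub>M borel_of BT"
    by (rule P.measurable_boundary_action[OF act_in[OF assms] act_dist[OF assms] act_in[OF \<gamma>'(1)] act_dist[OF \<gamma>'(1)] inv])
  show "openin BT V \<Longrightarrow> openin BT {\<xi> \<in> boundary PX. boundary_action PX (act \<gamma>) \<xi> \<in> V}"
    by (rule P.openin_boundary_action_vimage[OF act_in[OF assms] act_dist[OF assms] act_in[OF \<gamma>'(1)] act_dist[OF \<gamma>'(1)] inv])
qed

text \<open>Fix an open set \<open>U\<close> of positive measure in front of the axes, intersected with the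
support of \<open>\<mu> p\<close> to form \<open>V\<close>. For given \<open>\<gamma>\<close>
choose one of finitely many elements \<open>\<Lambda> k\<close> that moves the inverse image of
\<open>p\<close> under \<open>\<gamma>\<close> behind the axes, and let \<open>\<epsilon>\<close>
be \<open>\<Lambda> k\<close> composed with the inverse of \<open>\<gamma>\<close>. The shadow is
the preimage of \<open>V\<close> under \<open>\<epsilon>\<close>. Its measure is \<open>\<mu> x
V\<close> for \<open>x = act \<epsilon> p\<close>, and for \<open>V\<close> in front and
\<open>x\<close> behind the density of \<open>\<mu> x\<close> is \<open>exp (- \<Sum>i. b $ i * d
i (p i) (x i))\<close> up to a constant factor, where the distances \<open>d i (p i) (x i)\<close>
and \<open>d i (p i) (\<gamma> i (p i))\<close> differ by at most \<open>D i\<close>. Rays from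
\<open>x\<close> to points of \<open>V\<close> pass near the axes, that is, near \<open>\<Lambda>
k\<close> applied to \<open>p\<close>; applying the inverse of \<open>\<epsilon>\<close> to them
yields rays from \<open>p\<close> that pass near \<open>\<gamma> i (p i)\<close>.\<close>

lemma shadow_lemma:
  assumes dens: "invariant_density X \<Gamma> p b \<theta> \<mu>"
  shows "\<exists>\<kappa>>0. \<exists>C\<ge>0. \<forall>\<gamma>\<in>\<Gamma>. \<exists>A\<in>sets (\<mu> p).
      ennreal (\<kappa> * exp (- (\<Sum>i\<in>UNIV. b $ i * mdist (X i) (p i) (\<gamma> i (p i))))) \<le> emeasure (\<mu> p) A \<and>
      (\<forall>\<zeta>\<in>A. \<zeta> \<in> boundary PX \<and> (\<exists>\<rho>. (\<forall>i. geodesic_ray (X i) (\<rho> i) \<and> \<rho> i 0 = p i)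
        \<and> product_ray \<rho> \<theta> \<in> \<zeta> \<and> (\<forall>i. \<exists>s\<ge>0. mdist (X i) (\<gamma> i (p i)) (\<rho> i s) \<le> C)))"
proof -
  let ?S = "msupport BT (\<mu> p)"
  have \<mu>: "sets (\<mu> x) = sets (borel_of BT)" "finite_measure (\<mu> x)" "msupport BT (\<mu> x) \<noteq> {}"
    "msupport BT (\<mu> x) \<subseteq> boundary_slope X \<theta>"
    "\<And>\<gamma>. \<gamma> \<in> \<Gamma> \<Longrightarrow> distr (\<mu> x) (borel_of BT) (boundary_action PX (act \<gamma>)) = \<mu> (act \<gamma> x)"
    "\<exists>f \<in> borel_measurable (\<mu> p). \<mu> x = density (\<mu> p) f \<and> (\<forall>\<xi> \<in> ?S. f \<xi> = ennreal (exp
        (\<Sum>i\<in>UNIV. b $ i * busemann (X i) (boundary_proj X \<theta> i \<xi>) (p i) (x i))))"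
    if "x \<in> mspace PX" for x
    using dens[unfolded invariant_density_def Let_def] that E_plusD(3)[OF slope] by auto
  note \<mu>p = \<mu>[OF base]
  interpret \<mu>p: finite_measure "\<mu> p" by (rule \<mu>p(2))
  have space: "space (\<mu> p) = boundary PX"
    using sets_eq_imp_space_eq[OF \<mu>p(1)] by (simp add: space_borel_of P.topspace_boundary_topology)
  have open_sets: "V \<in> sets (\<mu> p)" if "openin BT V" for V using openin_sets_borel_of[OF that] \<mu>p(1) by simp
  have vimage: "boundary_action PX (act \<gamma>) -` V \<inter> space (\<mu> p) \<in> sets (\<mu> p)"
    "emeasure (\<mu> (act \<gamma> p)) V = emeasure (\<mu> p) (boundary_action PX (act \<gamma>) -` V \<inter> space (\<mu> p))"
    if "\<gamma> \<in> \<Gamma>" "V \<in> sets (\<mu> p)" for \<gamma> V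
  proof -
    have m: "boundary_action PX (act \<gamma>) \<in> \<mu> p \<rightarrow>\<^sub>M borel_of BT"
      using boundary_action_measurable(1)[OF that(1)] measurable_cong_sets[OF \<mu>p(1) refl] by blast
    have V: "V \<in> sets (borel_of BT)" using that(2) \<mu>p(1) by simp
    show "boundary_action PX (act \<gamma>) -` V \<inter> space (\<mu> p) \<in> sets (\<mu> p)" by (rule measurable_sets[OF m V])
    show "emeasure (\<mu> (act \<gamma> p)) V = emeasure (\<mu> p) (boundary_action PX (act \<gamma>) -` V \<inter> space (\<mu> p))"
      using emeasure_distr[OF m V] \<mu>p(5)[OF that(1)] by simp
  qed
  obtain \<xi> where \<xi>: "\<xi> \<in> ?S" using \<mu>p(3) by blast
  have \<xi>b: "\<xi> \<in> boundary PX" using \<xi> by (simp add: msupport_def P.topspace_boundary_topology)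
  obtain \<delta> U t0 where \<delta>: "\<delta> \<in> \<Gamma>" and U: "openin BT U" "boundary_action PX (act \<delta>) \<xi> \<in> U"
    and front: "\<And>\<eta>. \<eta> \<in> U \<Longrightarrow> \<eta> \<in> boundary_slope X \<theta> \<Longrightarrow> \<exists>\<rho>. (\<forall>i. geodesic_ray (X i) (\<rho> i) \<and> \<rho> i 0 = p i)
        \<and> product_ray \<rho> \<theta> \<in> \<eta> \<and> (\<forall>i. \<forall>t\<ge>t0. T i \<le> F i (\<rho> i t))"
    using move_to_front[of \<xi>] \<mu>p(4) \<xi> by blast
  \<comment> \<open>The preimage of \<open>U\<close> under \<open>\<delta>\<close> is a
    neighbourhood of a point of the support, and the measures \<open>\<mu> x\<close> are absolutely
    continuous with respect to \<open>\<mu> p\<close>.\<close>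
  have "0 < emeasure (\<mu> p) U"
  proof (rule ccontr)
    assume "\<not> ?thesis"
    then have "U \<in> null_sets (\<mu> p)" using open_sets[OF U(1)] by auto
    moreover obtain f where "f \<in> borel_measurable (\<mu> p)" "\<mu> (act \<delta> p) = density (\<mu> p) f"
      using \<mu>(6)[OF act_in[OF \<delta> base]] by blast
    ultimately have "U \<in> null_sets (\<mu> (act \<delta> p))"
      using absolutely_continuousI_density[of f "\<mu> p"] by (auto simp: absolutely_continuous_def)
    then have "emeasure (\<mu> p) (boundary_action PX (act \<delta>) -` U \<inter> space (\<mu> p)) = 0"
      using vimage(2)[OF \<delta> open_sets[OF U(1)]] by auto
    moreover have "boundary_action PX (act \<delta>) -` U \<inter> space (\<mu> p) = {\<xi> \<in> boundary PX. boundary_action PX (act \<delta>) \<xi> \<in> U}"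
      by (auto simp: space)
    moreover have "0 < emeasure (\<mu> p) {\<xi> \<in> boundary PX. boundary_action PX (act \<delta>) \<xi> \<in> U}"
      using \<xi> \<xi>b U(2) boundary_action_measurable(2)[OF \<delta> U(1)] unfolding msupport_def by blast
    ultimately show False by simp
  qed
  note S = P.msupport_full[OF base \<mu>p(1)]
  define V where "V = U \<inter> ?S"
  have V: "V \<in> sets (\<mu> p)" unfolding V_def using open_sets[OF U(1)] S(1) by (rule sets.Int)
  have "emeasure (\<mu> p) U \<le> emeasure (\<mu> p) (V \<union> (boundary PX - ?S))"
    using openin_subset[OF U(1)] V S(1) sets.top[of "\<mu> p"]
    by (intro emeasure_mono) (auto simp: V_def P.topspace_boundary_topology space)
  also have "\<dots> \<le> emeasure (\<mu> p) V + emeasure (\<mu> p) (boundary PX - ?S)"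
    using V S(1) sets.top[of "\<mu> p"] by (intro emeasure_subadditive) (auto simp: space)
  finally have "0 < emeasure (\<mu> p) V" using \<open>0 < emeasure (\<mu> p) U\<close> S(2) by simp
  then have m0: "0 < measure (\<mu> p) V" "emeasure (\<mu> p) V = ennreal (measure (\<mu> p) V)"
    by (simp_all add: \<mu>p.emeasure_eq_measure)
  obtain \<Lambda> where \<Lambda>: "\<And>k. \<Lambda> k \<in> \<Gamma>"
    "\<And>y. y \<in> mspace PX \<Longrightarrow> \<exists>k\<le>CARD('i). \<forall>i. F i (\<Lambda> k i (y i)) \<le> - T i" using push_points by blast
  define D where "D i = Max ((\<lambda>k. mdist (X i) (p i) (\<Lambda> k i (p i))) ` {..CARD('i)})" for i
  have D: "mdist (X i) (p i) (\<Lambda> k i (p i)) \<le> D i" if "k \<le> CARD('i)" for i k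
    unfolding D_def using that by (intro Max_ge) auto
  define C1 where "C1 i = 2 * c i + 2 * mdist (X i) (p i) (\<sigma> i 0) + D i" for i
  define C where "C = (\<Sum>i\<in>UNIV. D i + mdist (X i) (p i) (\<sigma> i 0) + c i + 1)"
  have D0: "0 \<le> D i" for i using D[of 0 i] mdist_nonneg[of "X i" "p i" "\<Lambda> 0 i (p i)"] by linarith
  have Cterm: "0 \<le> D i + mdist (X i) (p i) (\<sigma> i 0) + c i + 1" for i
    using D0[of i] coord_pos(3)[of i] mdist_nonneg[of "X i" "p i" "\<sigma> i 0"] by linarith
  have Ci: "D i + mdist (X i) (p i) (\<sigma> i 0) + c i + 1 \<le> C" for i
    unfolding C_def using Cterm by (intro member_le_sum) auto
  have C0: "0 \<le> C" unfolding C_def using Cterm by (intro sum_nonneg) auto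
  define \<kappa> where "\<kappa> = exp (- (\<Sum>i\<in>UNIV. \<bar>b $ i\<bar> * C1 i)) * measure (\<mu> p) V"
  have \<kappa>: "0 < \<kappa>" using m0 by (simp add: \<kappa>_def)
  have "\<exists>A\<in>sets (\<mu> p).
      ennreal (\<kappa> * exp (- (\<Sum>i\<in>UNIV. b $ i * mdist (X i) (p i) (\<gamma> i (p i))))) \<le> emeasure (\<mu> p) A \<and>
      (\<forall>\<zeta>\<in>A. \<zeta> \<in> boundary PX \<and> (\<exists>\<rho>. (\<forall>i. geodesic_ray (X i) (\<rho> i) \<and> \<rho> i 0 = p i)
        \<and> product_ray \<rho> \<theta> \<in> \<zeta> \<and> (\<forall>i. \<exists>s\<ge>0. mdist (X i) (\<gamma> i (p i)) (\<rho> i s) \<le> C)))" if \<gamma>: "\<gamma> \<in> \<Gamma>" for \<gamma>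
  proof -
    obtain \<gamma>' where \<gamma>': "\<gamma>' \<in> \<Gamma>" "\<And>i x. x \<in> mspace (X i) \<Longrightarrow> \<gamma>' i (\<gamma> i x) = x" using \<Gamma>_inv[OF \<gamma>] by blast
    obtain k where k: "k \<le> CARD('i)" "\<And>i. F i (\<Lambda> k i (\<gamma>' i (p i))) \<le> - T i"
      using \<Lambda>(2)[OF act_in[OF \<gamma>'(1) base]] by (auto simp: act_def)
    obtain \<epsilon> where \<epsilon>: "\<epsilon> \<in> \<Gamma>" "\<And>i x. x \<in> mspace (X i) \<Longrightarrow> \<epsilon> i x = \<Lambda> k i (\<gamma>' i x)"
      using \<Gamma>_mult[OF \<Lambda>(1) \<gamma>'(1)] by blast
    obtain \<epsilon>' where \<epsilon>': "\<epsilon>' \<in> \<Gamma>" "\<And>i x. x \<in> mspace (X i) \<Longrightarrow> \<epsilon>' i (\<epsilon> i x) = x" using \<Gamma>_inv[OF \<epsilon>(1)] by blast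
    define x where "x = act \<epsilon> p"
    have x: "x \<in> mspace PX" unfolding x_def by (rule act_in[OF \<epsilon>(1) base])
    have xi: "x i = \<epsilon> i (p i)" "x i \<in> mspace (X i)" for i
      using x by (auto simp: x_def act_def mspace_product_iff)
    have behind: "F i (x i) \<le> - T i" for i using k(2)[of i] \<epsilon>(2)[OF p_in] by (simp add: xi)
    let ?r = "\<lambda>i. mdist (X i) (p i) (\<gamma> i (p i))"
    have px: "\<bar>mdist (X i) (p i) (x i) - ?r i\<bar> \<le> D i" for i
    proof -
      let ?y = "\<gamma>' i (p i)" and ?L = "\<Lambda> k i"
      have y: "?y \<in> mspace (X i)" by (rule \<Gamma>_in[OF \<gamma>'(1) p_in])
      have xL: "x i = ?L ?y" using \<epsilon>(2)[OF p_in] by (simp add: xi)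
      have 1: "mdist (X i) (?L (p i)) (?L ?y) = mdist (X i) (p i) ?y" by (rule \<Gamma>_dist[OF \<Lambda>(1) p_in y])
      have 2: "mdist (X i) (p i) ?y = ?r i"
        using \<Gamma>_dist[OF \<gamma>'(1) \<Gamma>_in[OF \<gamma> p_in] p_in, of i] \<gamma>'(2)[OF p_in] by (simp add: mdist_commute)
      have L: "?L (p i) \<in> mspace (X i)" by (rule \<Gamma>_in[OF \<Lambda>(1) p_in])
      show ?thesis
        using mdist_triangle[of "p i" "X i" "?L (p i)" "x i"] mdist_triangle[of "?L (p i)" "X i" "p i" "x i"]
          L xi(2)[of i] D[OF k(1), of i] 1 2 unfolding xL by (simp add: mdist_commute abs_le_iff)
    qed
    define A where "A = boundary_action PX (act \<epsilon>) -` V \<inter> space (\<mu> p)"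
    have A: "A \<in> sets (\<mu> p)" unfolding A_def by (rule vimage(1)[OF \<epsilon>(1) V])
    define q where "q = exp (- (\<Sum>i\<in>UNIV. \<bar>b $ i\<bar> * C1 i)) * exp (- (\<Sum>i\<in>UNIV. b $ i * ?r i))"
    obtain f where f: "f \<in> borel_measurable (\<mu> p)" "\<mu> x = density (\<mu> p) f"
      "\<And>\<eta>. \<eta> \<in> ?S \<Longrightarrow> f \<eta> = ennreal (exp (\<Sum>i\<in>UNIV. b $ i * busemann (X i) (boundary_proj X \<theta> i \<eta>) (p i) (x i)))"
      using \<mu>(6)[OF x] by blast
    have fq: "ennreal q \<le> f \<eta>" if \<eta>: "\<eta> \<in> V" for \<eta>
    proof -
      have \<eta>S: "\<eta> \<in> ?S" "\<eta> \<in> boundary_slope X \<theta>" "\<eta> \<in> U" using \<eta> \<mu>p(4) by (auto simp: V_def)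
      obtain \<rho> where \<rho>: "\<And>i. geodesic_ray (X i) (\<rho> i)" "\<And>i. \<rho> i 0 = p i" "product_ray \<rho> \<theta> \<in> \<eta>"
        "\<And>i t. t0 \<le> t \<Longrightarrow> T i \<le> F i (\<rho> i t)" using front[OF \<eta>S(3,2)] by blast
      let ?\<beta> = "\<lambda>i. busemann (X i) (boundary_proj X \<theta> i \<eta>) (p i) (x i)"
      have "- (\<bar>b $ i\<bar> * C1 i) - b $ i * ?r i \<le> b $ i * ?\<beta> i" for i
      proof -
        have "\<bar>?\<beta> i + mdist (X i) (p i) (x i)\<bar> \<le> 2 * c i + 2 * mdist (X i) (p i) (\<sigma> i 0)"
          by (rule busemann_estimate[OF \<eta>S(2) \<rho> x behind])
        then have "\<bar>?\<beta> i + ?r i\<bar> \<le> C1 i" using px[of i] unfolding C1_def by linarith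
        then have "\<bar>b $ i\<bar> * \<bar>?\<beta> i + ?r i\<bar> \<le> \<bar>b $ i\<bar> * C1 i" by (intro mult_left_mono) auto
        then have "- (b $ i * (?\<beta> i + ?r i)) \<le> \<bar>b $ i\<bar> * C1 i" unfolding abs_mult[symmetric] by linarith
        then show ?thesis by (simp add: distrib_left)
      qed
      then have "(\<Sum>i\<in>UNIV. - (\<bar>b $ i\<bar> * C1 i) - b $ i * ?r i) \<le> (\<Sum>i\<in>UNIV. b $ i * ?\<beta> i)" by (intro sum_mono)
      then have "q \<le> exp (\<Sum>i\<in>UNIV. b $ i * ?\<beta> i)"
        unfolding q_def exp_add[symmetric] by (simp add: sum_subtractf sum_negf)
      then show ?thesis unfolding f(3)[OF \<eta>S(1)] by (rule ennreal_leI)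
    qed
    have "ennreal (q * measure (\<mu> p) V) = ennreal q * emeasure (\<mu> p) V"
      unfolding m0(2) by (simp add: ennreal_mult q_def)
    also have "\<dots> = (\<integral>\<^sup>+ \<eta>. ennreal q * indicator V \<eta> \<partial>\<mu> p)" using V by (simp add: nn_integral_cmult_indicator)
    also have "\<dots> \<le> (\<integral>\<^sup>+ \<eta>. f \<eta> * indicator V \<eta> \<partial>\<mu> p)"
      using fq by (intro nn_integral_mono) (auto simp: indicator_def)
    also have "\<dots> = emeasure (\<mu> x) V" unfolding f(2) using f(1) V by (simp add: emeasure_density)
    also have "\<dots> = emeasure (\<mu> p) A" unfolding x_def A_def by (rule vimage(2)[OF \<epsilon>(1) V])
    finally have meas: "ennreal (\<kappa> * exp (- (\<Sum>i\<in>UNIV. b $ i * ?r i))) \<le> emeasure (\<mu> p) A"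
      by (simp add: q_def \<kappa>_def mult_ac)
    have "\<exists>\<rho>. (\<forall>i. geodesic_ray (X i) (\<rho> i) \<and> \<rho> i 0 = p i)
        \<and> product_ray \<rho> \<theta> \<in> \<zeta> \<and> (\<forall>i. \<exists>s\<ge>0. mdist (X i) (\<gamma> i (p i)) (\<rho> i s) \<le> C)" if \<zeta>: "\<zeta> \<in> A" for \<zeta>
    proof -
      define \<eta> where "\<eta> = boundary_action PX (act \<epsilon>) \<zeta>"
      have \<zeta>b: "\<zeta> \<in> boundary PX" and \<eta>V: "\<eta> \<in> V" using \<zeta> by (auto simp: A_def space \<eta>_def)
      then have \<eta>S: "\<eta> \<in> boundary_slope X \<theta>" "\<eta> \<in> U" using \<mu>p(4) by (auto simp: V_def)
      have \<eta>b: "\<eta> \<in> boundary PX" using \<eta>S by (simp add: boundary_slope_def)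
      obtain \<rho> where \<rho>: "\<And>i. geodesic_ray (X i) (\<rho> i)" "\<And>i. \<rho> i 0 = p i" "product_ray \<rho> \<theta> \<in> \<eta>"
        "\<And>i t. t0 \<le> t \<Longrightarrow> T i \<le> F i (\<rho> i t)" using front[OF \<eta>S(2,1)] by blast
      obtain \<tau> where \<tau>: "\<And>i. geodesic_ray (X i) (\<tau> i)" "\<And>i. \<tau> i 0 = x i" "product_ray \<tau> \<theta> \<in> \<eta>"
        "\<And>i. \<exists>s\<ge>0. mdist (X i) (\<sigma> i 0) (\<tau> i s) \<le> c i + 1" using ray_passes[OF \<eta>S(1) \<rho> x behind] by blast
      define \<rho>' where "\<rho>' i = \<epsilon>' i \<circ> \<tau> i" for i
      have "act \<epsilon>' (act \<epsilon> z) = z" if "z \<in> mspace PX" for z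
        using that \<epsilon>'(2) by (auto simp: act_def mspace_product_iff fun_eq_iff)
      then have "boundary_action PX (act \<epsilon>') \<eta> = \<zeta>" unfolding \<eta>_def
        by (intro P.boundary_action_inverse[OF act_in[OF \<epsilon>(1)] act_dist[OF \<epsilon>(1)] act_in[OF \<epsilon>'(1)] act_dist[OF \<epsilon>'(1)] _ \<zeta>b])
      then have "act \<epsilon>' \<circ> product_ray \<tau> \<theta> \<in> \<zeta>"
        using P.boundary_action_eq(2)[OF act_in[OF \<epsilon>'(1)] act_dist[OF \<epsilon>'(1)] \<eta>b \<tau>(3)] by simp
      moreover have "act \<epsilon>' \<circ> product_ray \<tau> \<theta> = product_ray \<rho>' \<theta>" by (simp add: fun_eq_iff act_def product_ray_def \<rho>'_def)
      moreover have "geodesic_ray (X i) (\<rho>' i)" for i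
        unfolding \<rho>'_def by (rule cn_space.isometry_ray[OF factor_cn \<Gamma>_in[OF \<epsilon>'(1)] \<Gamma>_dist[OF \<epsilon>'(1)] \<tau>(1)])
      moreover have "\<rho>' i 0 = p i" for i using \<epsilon>'(2)[OF p_in] by (simp add: \<rho>'_def \<tau>(2) xi)
      moreover have "\<exists>s\<ge>0. mdist (X i) (\<gamma> i (p i)) (\<rho>' i s) \<le> C" for i
      proof -
        obtain s where s: "s \<ge> 0" "mdist (X i) (\<sigma> i 0) (\<tau> i s) \<le> c i + 1" using \<tau>(4) by blast
        have \<tau>s: "\<tau> i s \<in> mspace (X i)" by (rule cn_space.geodesic_rayD(1)[OF factor_cn \<tau>(1) s(1)])
        have \<gamma>p: "\<gamma> i (p i) \<in> mspace (X i)" by (rule \<Gamma>_in[OF \<gamma> p_in])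
        have "\<epsilon> i (\<gamma> i (p i)) = \<Lambda> k i (p i)" using \<epsilon>(2)[OF \<gamma>p] \<gamma>'(2)[OF p_in] by simp
        then have "\<gamma> i (p i) = \<epsilon>' i (\<Lambda> k i (p i))" using \<epsilon>'(2)[OF \<gamma>p] by simp
        then have "mdist (X i) (\<gamma> i (p i)) (\<rho>' i s) = mdist (X i) (\<Lambda> k i (p i)) (\<tau> i s)"
          using \<Gamma>_dist[OF \<epsilon>'(1) \<Gamma>_in[OF \<Lambda>(1) p_in] \<tau>s] by (simp add: \<rho>'_def)
        also have "\<dots> \<le> mdist (X i) (p i) (\<Lambda> k i (p i)) + mdist (X i) (p i) (\<sigma> i 0) + mdist (X i) (\<sigma> i 0) (\<tau> i s)"
          using mdist_triangle[of "\<Lambda> k i (p i)" "X i" "p i" "\<tau> i s"] mdist_triangle[of "p i" "X i" "\<sigma> i 0" "\<tau> i s"]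
            \<Gamma>_in[OF \<Lambda>(1) p_in, of k i] \<tau>s by (simp add: mdist_commute)
        also have "\<dots> \<le> C" using D[OF k(1), of i] s(2) Ci[of i] by linarith
        finally show ?thesis using s(1) by blast
      qed
      ultimately show ?thesis by (intro exI[of _ \<rho>']) auto
    qed
    moreover have "\<zeta> \<in> boundary PX" if "\<zeta> \<in> A" for \<zeta> using that by (simp add: A_def space)
    ultimately show ?thesis using A meas by blast
  qed
  then show ?thesis using \<kappa> C0 by blast
qed

text \<open>Let \<open>\<zeta>\<close> lie in the shadows of \<open>\<gamma>0\<close> and
\<open>\<gamma>\<close>. The ray from \<open>p\<close> to \<open>\<zeta>\<close> passes near both
orbit points, in each factor at nearly the same time because the distances have the same integral
part. So the inverse of \<open>\<gamma>0\<close> composed with \<open>\<gamma>\<close> moves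
\<open>p\<close> by at most \<open>4 * C + 1\<close> in every factor, and there are finitely many
such elements. Thus the shadows have bounded multiplicity, and the sum of their measures is at
most a multiple of the total mass.\<close>

lemma box_count:
  assumes dens: "invariant_density X \<Gamma> p b \<theta> \<mu>"
  obtains C2 where "0 < C2" "\<And>\<F> k. \<lbrakk>finite \<F>; \<F> \<subseteq> \<Gamma>; \<And>\<gamma> i. \<gamma> \<in> \<F> \<Longrightarrow> \<lfloor>mdist (X i) (p i) (\<gamma> i (p i))\<rfloor> = k i\<rbrakk>
      \<Longrightarrow> real (card \<F>) \<le> C2 * exp (\<Sum>i\<in>UNIV. b $ i * of_int (k i))"
proof -
  obtain \<kappa> C where \<kappa>: "0 < \<kappa>" and C: "0 \<le> C" and shadows: "\<forall>\<gamma>\<in>\<Gamma>. \<exists>A. A \<in> sets (\<mu> p) \<and>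
      ennreal (\<kappa> * exp (- (\<Sum>i\<in>UNIV. b $ i * mdist (X i) (p i) (\<gamma> i (p i))))) \<le> emeasure (\<mu> p) A \<and>
      (\<forall>\<zeta>\<in>A. \<zeta> \<in> boundary PX \<and> (\<exists>\<rho>. (\<forall>i. geodesic_ray (X i) (\<rho> i) \<and> \<rho> i 0 = p i)
        \<and> product_ray \<rho> \<theta> \<in> \<zeta> \<and> (\<forall>i. \<exists>s\<ge>0. mdist (X i) (\<gamma> i (p i)) (\<rho> i s) \<le> C)))"
    using shadow_lemma[OF dens] unfolding Bex_def[of "sets (\<mu> p)"] by blast
  from bchoice[OF shadows] obtain A where A_all: "\<forall>\<gamma>\<in>\<Gamma>. A \<gamma> \<in> sets (\<mu> p) \<and>
      ennreal (\<kappa> * exp (- (\<Sum>i\<in>UNIV. b $ i * mdist (X i) (p i) (\<gamma> i (p i))))) \<le> emeasure (\<mu> p) (A \<gamma>) \<and>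
      (\<forall>\<zeta>\<in>A \<gamma>. \<zeta> \<in> boundary PX \<and> (\<exists>\<rho>. (\<forall>i. geodesic_ray (X i) (\<rho> i) \<and> \<rho> i 0 = p i)
        \<and> product_ray \<rho> \<theta> \<in> \<zeta> \<and> (\<forall>i. \<exists>s\<ge>0. mdist (X i) (\<gamma> i (p i)) (\<rho> i s) \<le> C)))"
    by (elim exE)
  have A: "A \<gamma> \<in> sets (\<mu> p)"
    and big: "ennreal (\<kappa> * exp (- (\<Sum>i\<in>UNIV. b $ i * mdist (X i) (p i) (\<gamma> i (p i))))) \<le> emeasure (\<mu> p) (A \<gamma>)"
    if "\<gamma> \<in> \<Gamma>" for \<gamma>
    using bspec[OF A_all that] by simp_all
  have near: "\<zeta> \<in> boundary PX \<and> (\<exists>\<rho>. (\<forall>i. geodesic_ray (X i) (\<rho> i) \<and> \<rho> i 0 = p i)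
        \<and> product_ray \<rho> \<theta> \<in> \<zeta> \<and> (\<forall>i. \<exists>s\<ge>0. mdist (X i) (\<gamma> i (p i)) (\<rho> i s) \<le> C))"
    if "\<gamma> \<in> \<Gamma>" "\<zeta> \<in> A \<gamma>" for \<gamma> \<zeta>
    by (rule bspec[OF conjunct2[OF conjunct2[OF bspec[OF A_all that(1)]]] that(2)])
  have fin: "finite_measure (\<mu> p)" using dens base by (auto simp: invariant_density_def Let_def)
  interpret finite_measure "\<mu> p" by (rule fin)
  define C' where "C' = sqrt (\<Sum>i\<in>(UNIV::'i set). (4 * C + 1)\<^sup>2)"
  define \<N> where "\<N> = {\<gamma> \<in> \<Gamma>. mdist PX p (act \<gamma> p) \<le> C'}"
  have fN: "finite \<N>" unfolding \<N>_def by (rule finite_orbit)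
  define \<beta> where "\<beta> = (\<Sum>i\<in>UNIV. \<bar>b $ i\<bar>)"
  define C2 where "C2 = real (card \<N>) * measure (\<mu> p) (space (\<mu> p)) * exp \<beta> / \<kappa> + 1"
  have C2: "0 < C2" using \<kappa> by (simp add: C2_def add_nonneg_pos)
  show thesis
  proof (rule that[OF C2])
    fix \<F> k assume \<F>: "finite \<F>" "\<F> \<subseteq> \<Gamma>" and box: "\<And>\<gamma> i. \<gamma> \<in> \<F> \<Longrightarrow> \<lfloor>mdist (X i) (p i) (\<gamma> i (p i))\<rfloor> = k i"
    have mult: "card {\<gamma> \<in> \<F>. \<zeta> \<in> A \<gamma>} \<le> card \<N>" for \<zeta>
    proof (cases "{\<gamma> \<in> \<F>. \<zeta> \<in> A \<gamma>} = {}")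
      case False
      then obtain \<gamma>0 where \<gamma>0: "\<gamma>0 \<in> \<F>" "\<zeta> \<in> A \<gamma>0" by blast
      then have \<gamma>0\<Gamma>: "\<gamma>0 \<in> \<Gamma>" using \<F> by blast
      obtain \<gamma>0' where \<gamma>0': "\<gamma>0' \<in> \<Gamma>" "\<And>i x. x \<in> mspace (X i) \<Longrightarrow> \<gamma>0' i (\<gamma>0 i x) = x"
        "\<And>i x. x \<in> mspace (X i) \<Longrightarrow> \<gamma>0 i (\<gamma>0' i x) = x" using \<Gamma>_inv[OF \<gamma>0\<Gamma>] by blast
      have "\<exists>\<epsilon>. \<gamma> \<in> \<Gamma> \<longrightarrow> \<epsilon> \<in> \<Gamma> \<and> (\<forall>i. \<forall>x\<in>mspace (X i). \<epsilon> i x = \<gamma>0' i (\<gamma> i x))" for \<gamma>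
        using \<Gamma>_mult[OF \<gamma>0'(1), of \<gamma>] by blast
      then obtain w where w: "\<And>\<gamma>. \<gamma> \<in> \<Gamma> \<Longrightarrow> w \<gamma> \<in> \<Gamma>"
        "\<And>\<gamma> i x. \<gamma> \<in> \<Gamma> \<Longrightarrow> x \<in> mspace (X i) \<Longrightarrow> w \<gamma> i x = \<gamma>0' i (\<gamma> i x)" by metis
      obtain \<rho>0 where \<rho>0: "\<zeta> \<in> boundary PX" "\<And>i. geodesic_ray (X i) (\<rho>0 i)" "\<And>i. \<rho>0 i 0 = p i" "product_ray \<rho>0 \<theta> \<in> \<zeta>"
        "\<And>i. \<exists>s\<ge>0. mdist (X i) (\<gamma>0 i (p i)) (\<rho>0 i s) \<le> C" using near[OF \<gamma>0\<Gamma> \<gamma>0(2)] by blast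
      show ?thesis
      proof (rule card_inj_on_le[OF _ _ fN])
        show "inj_on w {\<gamma> \<in> \<F>. \<zeta> \<in> A \<gamma>}"
        proof (rule inj_onI)
          fix \<gamma> \<gamma>' assume "\<gamma> \<in> {\<gamma> \<in> \<F>. \<zeta> \<in> A \<gamma>}" "\<gamma>' \<in> {\<gamma> \<in> \<F>. \<zeta> \<in> A \<gamma>}" and eq: "w \<gamma> = w \<gamma>'"
          then have \<gamma>\<gamma>': "\<gamma> \<in> \<Gamma>" "\<gamma>' \<in> \<Gamma>" using \<F> by auto
          show "\<gamma> = \<gamma>'"
          proof (rule \<Gamma>_ext[OF \<gamma>\<gamma>'])
            fix i x assume x: "x \<in> mspace (X i)"
            have "\<gamma>0 i (w \<gamma> i x) = \<gamma>0 i (w \<gamma>' i x)" by (simp add: eq)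
            then show "\<gamma> i x = \<gamma>' i x"
              using w(2)[OF \<gamma>\<gamma>'(1) x] w(2)[OF \<gamma>\<gamma>'(2) x] \<gamma>0'(3) \<Gamma>_in[OF \<gamma>\<gamma>'(1) x] \<Gamma>_in[OF \<gamma>\<gamma>'(2) x] by simp
          qed
        qed
        show "w ` {\<gamma> \<in> \<F>. \<zeta> \<in> A \<gamma>} \<subseteq> \<N>"
        proof
          fix \<epsilon> assume "\<epsilon> \<in> w ` {\<gamma> \<in> \<F>. \<zeta> \<in> A \<gamma>}"
          then obtain \<gamma> where \<gamma>: "\<epsilon> = w \<gamma>" "\<gamma> \<in> \<F>" "\<zeta> \<in> A \<gamma>" by blast
          then have \<gamma>\<Gamma>: "\<gamma> \<in> \<Gamma>" using \<F> by blast
          obtain \<rho> where \<rho>: "\<And>i. geodesic_ray (X i) (\<rho> i)" "\<And>i. \<rho> i 0 = p i" "product_ray \<rho> \<theta> \<in> \<zeta>"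
            "\<And>i. \<exists>s\<ge>0. mdist (X i) (\<gamma> i (p i)) (\<rho> i s) \<le> C" using near[OF \<gamma>\<Gamma> \<gamma>(3)] by blast
          have "mdist (X i) (p i) (w \<gamma> i (p i)) \<le> 4 * C + 1" for i
          proof -
            let ?d = "mdist (X i)" and ?a = "\<gamma>0 i (p i)" and ?b = "\<gamma> i (p i)"
            have ab: "?a \<in> mspace (X i)" "?b \<in> mspace (X i)" using \<Gamma>_in[OF \<gamma>0\<Gamma> p_in] \<Gamma>_in[OF \<gamma>\<Gamma> p_in] by auto
            obtain s0 where s0: "s0 \<ge> 0" "?d ?a (\<rho>0 i s0) \<le> C" using \<rho>0(5) by blast
            obtain s where s: "s \<ge> 0" "?d ?b (\<rho> i s) \<le> C" using \<rho>(4) by blast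
            have as: "(\<rho> i, \<rho>0 i) \<in> asymptotic (X i)"
              by (rule product_rays_asymptotic[OF \<rho>0(1) \<rho>(3) \<rho>0(4) \<rho>(1) \<rho>0(2)])
            have same: "\<rho> i s = \<rho>0 i s"
              using cn_space.asymptotic_same_start[OF factor_cn as _ s(1)] \<rho>(2) \<rho>0(3) by simp
            have in0: "\<rho>0 i t \<in> mspace (X i)" if "0 \<le> t" for t using cn_space.geodesic_rayD(1)[OF factor_cn \<rho>0(2) that] .
            have len: "?d (p i) (\<rho>0 i t) = t" if "0 \<le> t" for t
              using cn_space.geodesic_rayD(2)[OF factor_cn \<rho>0(2), of 0 t i] that by (simp add: \<rho>0(3))
            have "\<bar>?d (p i) ?a - s0\<bar> \<le> C"
              using mdist_triangle[of "p i" "X i" ?a "\<rho>0 i s0"] mdist_triangle[of "p i" "X i" "\<rho>0 i s0" ?a]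
                ab in0[OF s0(1)] len[OF s0(1)] s0(2) by (simp add: mdist_commute abs_le_iff)
            moreover have "\<bar>?d (p i) ?b - s\<bar> \<le> C"
              using mdist_triangle[of "p i" "X i" ?b "\<rho>0 i s"] mdist_triangle[of "p i" "X i" "\<rho>0 i s" ?b]
                ab in0[OF s(1)] len[OF s(1)] s(2) by (simp add: mdist_commute abs_le_iff same)
            moreover have "\<bar>?d (p i) ?a - ?d (p i) ?b\<bar> \<le> 1"
              using box[OF \<gamma>0(1), of i] box[OF \<gamma>(2), of i] by linarith
            ultimately have "\<bar>s0 - s\<bar> \<le> 2 * C + 1" by linarith
            then have "?d (\<rho>0 i s0) (\<rho>0 i s) \<le> 2 * C + 1"
              using cn_space.geodesic_rayD(2)[OF factor_cn \<rho>0(2) s0(1) s(1)] by simp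
            moreover have "?d ?a ?b \<le> ?d ?a (\<rho>0 i s0) + ?d (\<rho>0 i s0) (\<rho>0 i s) + ?d ?b (\<rho>0 i s)"
              using mdist_triangle[of ?a "X i" "\<rho>0 i s0" ?b] mdist_triangle[of "\<rho>0 i s0" "X i" "\<rho>0 i s" ?b]
                ab in0[OF s0(1)] in0[OF s(1)] by (simp add: mdist_commute)
            ultimately have "?d ?a ?b \<le> 4 * C + 1" using s0(2) s(2) same by simp
            moreover have "?d (p i) (w \<gamma> i (p i)) = ?d ?a ?b"
              using \<Gamma>_dist[OF \<gamma>0'(1) ab] \<gamma>0'(2)[OF p_in] w(2)[OF \<gamma>\<Gamma> p_in] by simp
            ultimately show ?thesis by simp
          qed
          then have "mdist PX p (act (w \<gamma>) p) \<le> C'"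
            unfolding mdist_product_metric C'_def act_def by (intro real_sqrt_le_mono sum_mono power_mono) auto
          then show "\<epsilon> \<in> \<N>" using w(1)[OF \<gamma>\<Gamma>] by (simp add: \<N>_def \<gamma>(1))
        qed
      qed
    qed (simp only: card.empty le0)
    define e where "e = \<kappa> * exp (- (\<Sum>i\<in>UNIV. b $ i * of_int (k i)) - \<beta>)"
    have e0: "0 < e" using \<kappa> by (simp add: e_def)
    have lower: "ennreal e \<le> emeasure (\<mu> p) (A \<gamma>)" if \<gamma>: "\<gamma> \<in> \<F>" for \<gamma>
    proof -
      have "b $ i * mdist (X i) (p i) (\<gamma> i (p i)) \<le> b $ i * of_int (k i) + \<bar>b $ i\<bar>" for i
      proof -
        let ?r = "mdist (X i) (p i) (\<gamma> i (p i))"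
        have "\<bar>?r - of_int (k i)\<bar> \<le> 1" using box[OF \<gamma>, of i] by linarith
        then have "\<bar>b $ i\<bar> * \<bar>?r - of_int (k i)\<bar> \<le> \<bar>b $ i\<bar> * 1" by (intro mult_left_mono) auto
        then have "b $ i * (?r - of_int (k i)) \<le> \<bar>b $ i\<bar>" unfolding abs_mult[symmetric] by linarith
        then show ?thesis by (simp add: right_diff_distrib)
      qed
      then have "(\<Sum>i\<in>UNIV. b $ i * mdist (X i) (p i) (\<gamma> i (p i))) \<le> (\<Sum>i\<in>UNIV. b $ i * of_int (k i) + \<bar>b $ i\<bar>)"
        by (intro sum_mono)
      then have "e \<le> \<kappa> * exp (- (\<Sum>i\<in>UNIV. b $ i * mdist (X i) (p i) (\<gamma> i (p i))))"
        using \<kappa> by (simp add: e_def \<beta>_def sum.distrib)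
      then show ?thesis using big[of \<gamma>] \<gamma> \<F> by (meson ennreal_leI order_trans subsetD)
    qed
    have "ennreal (real (card \<F>) * e) = (\<Sum>\<gamma>\<in>\<F>. ennreal e)"
      using e0 by (simp add: ennreal_mult ennreal_of_nat_eq_real_of_nat)
    also have "\<dots> \<le> (\<Sum>\<gamma>\<in>\<F>. emeasure (\<mu> p) (A \<gamma>))" using lower by (intro sum_mono) auto
    also have "\<dots> = (\<Sum>\<gamma>\<in>\<F>. \<integral>\<^sup>+ \<zeta>. indicator (A \<gamma>) \<zeta> \<partial>\<mu> p)"
      using A \<F> by (intro sum.cong) (auto simp: nn_integral_indicator)
    also have "\<dots> = (\<integral>\<^sup>+ \<zeta>. (\<Sum>\<gamma>\<in>\<F>. indicator (A \<gamma>) \<zeta>) \<partial>\<mu> p)"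
      using A \<F> by (intro nn_integral_sum[symmetric]) auto
    also have "\<dots> \<le> (\<integral>\<^sup>+ \<zeta>. of_nat (card \<N>) \<partial>\<mu> p)"
    proof (rule nn_integral_mono)
      fix \<zeta>
      have "(\<Sum>\<gamma>\<in>\<F>. indicator (A \<gamma>) \<zeta> :: ennreal) = of_nat (card {\<gamma> \<in> \<F>. \<zeta> \<in> A \<gamma>})"
        using \<F>(1) by (simp add: indicator_def sum.If_cases Int_def)
      also have "\<dots> \<le> of_nat (card \<N>)" using mult[of \<zeta>] by simp
      finally show "(\<Sum>\<gamma>\<in>\<F>. indicator (A \<gamma>) \<zeta> :: ennreal) \<le> of_nat (card \<N>)" .
    qed
    also have "\<dots> = ennreal (real (card \<N>) * measure (\<mu> p) (space (\<mu> p)))"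
      by (simp add: emeasure_eq_measure ennreal_mult ennreal_of_nat_eq_real_of_nat)
    finally have "real (card \<F>) * e \<le> real (card \<N>) * measure (\<mu> p) (space (\<mu> p))"
      by (subst (asm) ennreal_le_iff) auto
    then have "real (card \<F>) * e * (exp \<beta> / \<kappa>) \<le> real (card \<N>) * measure (\<mu> p) (space (\<mu> p)) * (exp \<beta> / \<kappa>)"
      using \<kappa> by (intro mult_right_mono) auto
    also have "\<dots> \<le> C2" by (simp add: C2_def)
    finally have "real (card \<F>) * e * (exp \<beta> / \<kappa>) \<le> C2" .
    moreover have "e * (exp \<beta> / \<kappa>) = exp (- (\<Sum>i\<in>UNIV. b $ i * of_int (k i)))"
      using \<kappa> by (simp add: e_def exp_diff)
    ultimately have "real (card \<F>) * exp (- (\<Sum>i\<in>UNIV. b $ i * of_int (k i))) \<le> C2" by (simp only: mult.assoc)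
    then show "real (card \<F>) \<le> C2 * exp (\<Sum>i\<in>UNIV. b $ i * of_int (k i))"
      by (simp add: exp_minus field_simps)
  qed
qed

text \<open>A cone neighbourhood of \<open>\<xi>\<close> of radius \<open>R\<close> contains an orbit point.
The geodesic from \<open>p\<close> to it has at time \<open>R\<close> components at distance
\<open>R / D * d i (p i) (\<gamma> i (p i))\<close> from \<open>p i\<close>, where
\<open>D\<close> is the distance of the orbit point, and the neighbourhood of width \<open>e *
R\<close> keeps them close to \<open>R * \<theta> $ i\<close>.\<close>

lemma orbit_approximates_slope:
  assumes \<xi>: "\<xi> \<in> limit_set X \<Gamma> p" "\<xi> \<in> boundary_slope X \<theta>" and R: "0 < R" and e: "0 < e"
  obtains \<gamma> where "\<gamma> \<in> \<Gamma>" "R < mdist PX p (act \<gamma> p)"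
    "\<And>i. \<bar>mdist (X i) (p i) (\<gamma> i (p i)) / mdist PX p (act \<gamma> p) - \<theta> $ i\<bar> < e"
proof -
  obtain \<rho> where \<rho>: "\<And>i. geodesic_ray (X i) (\<rho> i)" "\<And>i. \<rho> i 0 = p i" "product_ray \<rho> \<theta> \<in> \<xi>"
    using slope_ray_from[OF \<xi>(2) base] by metis
  let ?c = "product_ray \<rho> \<theta>"
  have ray: "geodesic_ray PX ?c" by (rule geodesic_ray_product_ray[OF \<rho>(1) slope])
  have c0: "?c 0 = p" by (simp add: product_ray_def \<rho>(2) fun_eq_iff)
  have eR: "0 < e * R" using e R by simp
  have \<xi>b: "\<xi> \<in> boundary PX" using \<xi>(2) by (simp add: boundary_slope_def)
  have "mdist PX (?c R) (?c R) = 0" using P.geodesic_rayD(2)[OF ray, of R R] R by simp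
  then have "Inr \<xi> \<in> cone_nbhd PX ?c R (e * R)" unfolding P.Inr_in_cone_nbhd using \<xi>b \<rho>(3) eR by auto
  moreover have "Inr \<xi> \<in> cone_topology PX closure_of (Inl ` (\<lambda>\<gamma>. act \<gamma> p) ` \<Gamma>)" using \<xi>(1) by (simp add: limit_set_def)
  ultimately obtain \<gamma> where \<gamma>: "\<gamma> \<in> \<Gamma>" "Inl (act \<gamma> p) \<in> cone_nbhd PX ?c R (e * R)"
    using P.openin_cone_nbhd[OF ray R eR] unfolding in_closure_of by blast
  let ?D = "mdist PX p (act \<gamma> p)"
  obtain g where D: "R < ?D" and g: "geodesic_segment PX p (act \<gamma> p) g" "mdist PX (g R) (?c R) < e * R"
    using \<gamma>(2) by (auto simp: cone_nbhd_def c0)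
  have l: "0 \<le> R / ?D" "R / ?D \<le> 1" using D R by auto
  define w where "w i = cn_space.pt (X i) (p i) (\<gamma> i (p i)) (R / ?D)" for i
  have \<gamma>p: "\<gamma> i (p i) \<in> mspace (X i)" for i by (rule \<Gamma>_in[OF \<gamma>(1) p_in])
  have w: "w i \<in> mspace (X i)" "mdist (X i) (p i) (w i) = R / ?D * mdist (X i) (p i) (\<gamma> i (p i))"
    "mdist (X i) (w i) (\<gamma> i (p i)) = (1 - R / ?D) * mdist (X i) (p i) (\<gamma> i (p i))" for i
    unfolding w_def using cn_space.pt_in[OF factor_cn p_in \<gamma>p l] cn_space.pt_dist[OF factor_cn p_in \<gamma>p l] by auto
  have wP: "w \<in> mspace PX" using w(1) by (simp add: mspace_product_iff)
  have "w = P.pt p (act \<gamma> p) (R / ?D)"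
  proof (rule P.pt_unique[OF base act_in[OF \<gamma>(1) base] l wP])
    have scale: "sqrt (r\<^sup>2 * S) = r * sqrt S" if "0 \<le> r" for r S :: real using that by (simp add: real_sqrt_mult)
    have D_eq: "?D = sqrt (\<Sum>i\<in>UNIV. (mdist (X i) (p i) (\<gamma> i (p i)))\<^sup>2)" by (simp add: mdist_product_metric act_def)
    have "mdist PX p w = sqrt ((R / ?D)\<^sup>2 * (\<Sum>i\<in>UNIV. (mdist (X i) (p i) (\<gamma> i (p i)))\<^sup>2))"
      unfolding mdist_product_metric[of X p w] by (simp only: w(2) power_mult_distrib sum_distrib_left)
    then show "mdist PX p w = R / ?D * ?D" unfolding scale[OF l(1)] D_eq[symmetric] .
    have "mdist PX w (act \<gamma> p) = sqrt (\<Sum>i\<in>UNIV. (mdist (X i) (w i) (\<gamma> i (p i)))\<^sup>2)"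
      by (simp add: mdist_product_metric act_def)
    also have "\<dots> = sqrt ((1 - R / ?D)\<^sup>2 * (\<Sum>i\<in>UNIV. (mdist (X i) (p i) (\<gamma> i (p i)))\<^sup>2))"
      by (simp only: w(3) power_mult_distrib sum_distrib_left)
    finally show "mdist PX w (act \<gamma> p) = (1 - R / ?D) * ?D"
      using l(2) scale[of "1 - R / ?D"] by (simp only: D_eq[symmetric] diff_ge_0_iff_ge)
  qed
  moreover have "g R = P.pt p (act \<gamma> p) (R / ?D)"
  proof (rule P.pt_unique[OF base act_in[OF \<gamma>(1) base] l])
    have "R \<in> {0..?D}" "0 \<in> {0..?D}" "?D \<in> {0..?D}" using R D by auto
    then have gR: "g R \<in> mspace PX" "mdist PX (g 0) (g R) = \<bar>0 - R\<bar>" "mdist PX (g R) (g ?D) = \<bar>R - ?D\<bar>"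
      using g(1) unfolding geodesic_segment_def by blast+
    have ends: "g 0 = p" "g ?D = act \<gamma> p" using g(1) by (auto simp: geodesic_segment_def)
    have abs: "\<bar>0 - R\<bar> = R" "\<bar>R - ?D\<bar> = ?D - R" using R D by auto
    have lD: "R / ?D * ?D = R" "(1 - R / ?D) * ?D = ?D - R" using D R by (auto simp: left_diff_distrib)
    show "g R \<in> mspace PX" by (rule gR(1))
    show "mdist PX p (g R) = R / ?D * ?D" using gR(2) by (simp only: ends abs lD)
    show "mdist PX (g R) (act \<gamma> p) = (1 - R / ?D) * ?D" using gR(3) by (simp only: ends abs lD)
  qed
  ultimately have close: "mdist PX w (?c R) < e * R" using g(2) by simp
  have "\<bar>mdist (X i) (p i) (\<gamma> i (p i)) / ?D - \<theta> $ i\<bar> < e" for i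
  proof -
    let ?u = "R * \<theta> $ i"
    have u: "0 \<le> ?u" using R \<theta>_pos[of i] by simp
    have ru: "\<rho> i ?u \<in> mspace (X i)" by (rule cn_space.geodesic_rayD(1)[OF factor_cn \<rho>(1) u])
    have pu: "mdist (X i) (p i) (\<rho> i ?u) = ?u"
      using cn_space.geodesic_rayD(2)[OF factor_cn \<rho>(1), of 0 ?u i] u by (simp add: \<rho>(2))
    have "mdist (X i) (w i) (\<rho> i ?u) \<le> mdist PX w (?c R)"
      using mdist_component_le[of X i w "?c R"] by (simp add: product_ray_def)
    then have "mdist (X i) (w i) (\<rho> i ?u) < e * R" using close by simp
    moreover have "\<bar>a - v\<bar> < E" if "a \<le> v + q" "v \<le> a + q" "q < E" for a v q E :: real using that by simp
    ultimately have "\<bar>mdist (X i) (p i) (w i) - mdist (X i) (p i) (\<rho> i ?u)\<bar> < e * R"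
      using mdist_triangle[OF p_in ru w(1)] mdist_triangle[OF p_in w(1) ru] mdist_commute[of "X i" "\<rho> i ?u" "w i"] by metis
    then have "\<bar>mdist (X i) (p i) (w i) - ?u\<bar> < e * R" unfolding pu .
    moreover have "mdist (X i) (p i) (w i) - ?u = R * (mdist (X i) (p i) (\<gamma> i (p i)) / ?D - \<theta> $ i)"
      unfolding w(2) by (simp add: right_diff_distrib)
    ultimately have "R * \<bar>mdist (X i) (p i) (\<gamma> i (p i)) / ?D - \<theta> $ i\<bar> < R * e" using R by (simp add: abs_mult mult.commute)
    then show ?thesis using R by (simp only: mult_less_cancel_left_pos)
  qed
  then show thesis using that \<gamma>(1) D by blast
qed

end

section \<open>Counting orbit points\<close>

context contracting_action
begin

definition slope_orbit :: "real \<Rightarrow> nat \<Rightarrow> ('i \<Rightarrow> 'a \<Rightarrow> 'a) set" where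
  "slope_orbit e n = {\<gamma> \<in> \<Gamma>. 0 < mdist PX p (act \<gamma> p) \<and> mdist PX p (act \<gamma> p) < real n \<and>
     (\<forall>i. \<bar>mdist (X i) (p i) (\<gamma> i (p i)) / mdist PX p (act \<gamma> p) - \<theta> $ i\<bar> < e)}"

lemma orbit_count_eq: "orbit_count X \<Gamma> p \<theta> e n = card (slope_orbit e n)"
  by (simp add: orbit_count_def slope_orbit_def)

lemma finite_slope_orbit: "finite (slope_orbit e n)"
  by (rule finite_subset[OF _ finite_orbit[of "real n"]]) (auto simp: slope_orbit_def)

lemma slope_orbit_mono: "e \<le> e' \<Longrightarrow> slope_orbit e n \<subseteq> slope_orbit e' n"
  by (auto simp: slope_orbit_def intro: less_le_trans)

lemma weighted_length_le:
  assumes "0 < D" "\<And>i. \<bar>r i / D - \<theta> $ i\<bar> < e"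
  shows "(\<Sum>i\<in>UNIV. b $ i * r i) \<le> D * ((\<Sum>i\<in>UNIV. b $ i * \<theta> $ i) + e * (\<Sum>i\<in>UNIV. \<bar>b $ i\<bar>))"
proof -
  have "b $ i * r i \<le> D * (b $ i * \<theta> $ i + e * \<bar>b $ i\<bar>)" for i
  proof -
    have "b $ i * (r i / D - \<theta> $ i) \<le> \<bar>b $ i\<bar> * \<bar>r i / D - \<theta> $ i\<bar>" unfolding abs_mult[symmetric] by simp
    also have "\<dots> \<le> \<bar>b $ i\<bar> * e" using assms(2)[of i] by (intro mult_left_mono) auto
    finally have "D * (b $ i * (r i / D)) \<le> D * (b $ i * \<theta> $ i + e * \<bar>b $ i\<bar>)"
      using assms(1) by (intro mult_left_mono) (auto simp: algebra_simps)
    then show ?thesis using assms(1) by simp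
  qed
  then have "(\<Sum>i\<in>UNIV. b $ i * r i) \<le> (\<Sum>i\<in>UNIV. D * (b $ i * \<theta> $ i + e * \<bar>b $ i\<bar>))" by (intro sum_mono)
  then show ?thesis by (simp add: sum.distrib sum_distrib_left distrib_left)
qed

lemma floor_weight_le:
  assumes "\<And>i. \<lfloor>r i\<rfloor> = k i"
  shows "(\<Sum>i\<in>UNIV. b $ i * of_int (k i)) \<le> (\<Sum>i\<in>UNIV. b $ i * r i) + (\<Sum>i\<in>UNIV. \<bar>b $ i\<bar> :: real)"
proof -
  have "b $ i * of_int (k i) \<le> b $ i * r i + \<bar>b $ i\<bar>" for i
  proof -
    have "\<bar>of_int (k i) - r i\<bar> \<le> 1" using assms[of i] by linarith
    then have "\<bar>b $ i\<bar> * \<bar>of_int (k i) - r i\<bar> \<le> \<bar>b $ i\<bar> * 1" by (intro mult_left_mono) auto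
    then have "b $ i * (of_int (k i) - r i) \<le> \<bar>b $ i\<bar>" unfolding abs_mult[symmetric] by linarith
    then show ?thesis by (simp add: right_diff_distrib)
  qed
  then have "(\<Sum>i\<in>UNIV. b $ i * of_int (k i)) \<le> (\<Sum>i\<in>UNIV. b $ i * r i + \<bar>b $ i\<bar>)" by (intro sum_mono)
  then show ?thesis by (simp add: sum.distrib)
qed

text \<open>The bound for boxes, applied to a single element, shows that the weighted lengths of orbit points
are bounded below. For distant orbit points with slope near \<open>\<theta>\<close> they are
nearly proportional to \<open>\<Sum>i. b $ i * \<theta> $ i\<close>, which excludes a negative
value.\<close>

lemma weight_nonneg:
  assumes dens: "invariant_density X \<Gamma> p b \<theta> \<mu>"
  shows "0 \<le> (\<Sum>i\<in>UNIV. b $ i * \<theta> $ i)"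
proof (rule ccontr)
  let ?q = "\<Sum>i\<in>UNIV. b $ i * \<theta> $ i" and ?\<beta> = "\<Sum>i\<in>UNIV. \<bar>b $ i\<bar>"
  assume "\<not> ?thesis"
  then have q: "?q < 0" by simp
  have \<beta>: "0 \<le> ?\<beta>" by (intro sum_nonneg) auto
  obtain \<xi> where \<xi>: "\<xi> \<in> limit_set X \<Gamma> p" "\<xi> \<in> boundary_slope X \<theta>"
    using dens base unfolding invariant_density_def Let_def by blast
  obtain C2 where C2: "0 < C2" and box: "\<And>\<F> k. \<lbrakk>finite \<F>; \<F> \<subseteq> \<Gamma>; \<And>\<gamma> i. \<gamma> \<in> \<F> \<Longrightarrow> \<lfloor>mdist (X i) (p i) (\<gamma> i (p i))\<rfloor> = k i\<rbrakk>
      \<Longrightarrow> real (card \<F>) \<le> C2 * exp (\<Sum>i\<in>UNIV. b $ i * of_int (k i))" using box_count[OF dens] by blast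
  \<comment> \<open>With this \<open>e\<close> the weighted length is at most half of \<open>?D *
    ?q\<close>, and \<open>R\<close> makes this smaller than the lower bound.\<close>
  define e where "e = - ?q / (2 * (?\<beta> + 1))"
  have \<beta>1: "0 < 2 * (?\<beta> + 1)" using add_nonneg_pos[OF \<beta> zero_less_one] by (rule mult_pos_pos[OF zero_less_numeral])
  have e: "0 < e" unfolding e_def by (rule divide_pos_pos[OF _ \<beta>1]) (use q in simp)
  have "e * (2 * (?\<beta> + 1)) = - ?q" unfolding e_def by (rule nonzero_eq_divide_eq[THEN iffD1, OF less_imp_neq[OF \<beta>1, symmetric] refl])
  then have e\<beta>: "?q + e * ?\<beta> \<le> ?q / 2" using e by (simp add: algebra_simps)
  define R where "R = 2 * (\<bar>ln C2\<bar> + ?\<beta> + 1) / (- ?q)"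
  have R: "0 < R" unfolding R_def
    using mult_pos_pos[OF zero_less_numeral add_nonneg_pos[OF add_nonneg_nonneg[OF abs_ge_zero \<beta>] zero_less_one]] q
    by (intro divide_pos_pos) simp_all
  have Rq: "R * (?q / 2) = - (\<bar>ln C2\<bar> + ?\<beta> + 1)" using q by (simp add: R_def field_simps)
  obtain \<gamma> where \<gamma>: "\<gamma> \<in> \<Gamma>" "R < mdist PX p (act \<gamma> p)"
    "\<And>i. \<bar>mdist (X i) (p i) (\<gamma> i (p i)) / mdist PX p (act \<gamma> p) - \<theta> $ i\<bar> < e"
    using orbit_approximates_slope[OF \<xi> R e] by blast
  let ?D = "mdist PX p (act \<gamma> p)" and ?r = "\<lambda>i. mdist (X i) (p i) (\<gamma> i (p i))"
  have "(\<Sum>i\<in>UNIV. b $ i * ?r i) \<le> ?D * (?q + e * ?\<beta>)" using \<gamma> R by (intro weighted_length_le) auto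
  also have "\<dots> \<le> ?D * (?q / 2)" using e\<beta> by (intro mult_left_mono) auto
  also have "\<dots> \<le> R * (?q / 2)" using \<gamma>(2) q by (intro mult_right_mono_neg) auto
  finally have "(\<Sum>i\<in>UNIV. b $ i * ?r i) \<le> - (\<bar>ln C2\<bar> + ?\<beta> + 1)" unfolding Rq .
  then have neg: "(\<Sum>i\<in>UNIV. b $ i * of_int \<lfloor>?r i\<rfloor>) \<le> - \<bar>ln C2\<bar> - 1"
    using floor_weight_le[of ?r "\<lambda>i. \<lfloor>?r i\<rfloor>" b] by linarith
  have "1 \<le> C2 * exp (\<Sum>i\<in>UNIV. b $ i * of_int \<lfloor>?r i\<rfloor>)"
    using box[of "{\<gamma>}" "\<lambda>i. \<lfloor>?r i\<rfloor>"] \<gamma>(1) by simp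
  also have "\<dots> = exp (ln C2 + (\<Sum>i\<in>UNIV. b $ i * of_int \<lfloor>?r i\<rfloor>))" using C2 by (simp add: exp_add)
  finally have "0 \<le> ln C2 + (\<Sum>i\<in>UNIV. b $ i * of_int \<lfloor>?r i\<rfloor>)" by simp
  then show False using neg by linarith
qed

text \<open>The orbit points are sorted into boxes by the integral parts of their distances in the factors.
Each box meeting the orbit obeys the bound of \<open>box_count\<close> with weight at most
\<open>n * (q + e * \<beta>)\<close>, where \<open>q = \<Sum>i. b $ i * \<theta> $ i\<close> and
\<open>\<beta> = \<Sum>i. \<bar>b $ i\<bar>\<close>; passing from the distance of the orbit point
to \<open>n\<close> relies on \<open>weight_nonneg\<close>. And there are at most \<open>(n + 1) ^
CARD('i)\<close> boxes.\<close>

lemma slope_orbit_card: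
  assumes dens: "invariant_density X \<Gamma> p b \<theta> \<mu>"
  obtains C where "0 < C" "\<And>e n. 0 < e \<Longrightarrow> real (card (slope_orbit e n)) \<le>
    real (n + 1) ^ CARD('i) * (C * exp (real n * ((\<Sum>i\<in>UNIV. b $ i * \<theta> $ i) + e * (\<Sum>i\<in>UNIV. \<bar>b $ i\<bar>))))"
proof -
  let ?q = "\<Sum>i\<in>UNIV. b $ i * \<theta> $ i" and ?\<beta> = "\<Sum>i\<in>UNIV. \<bar>b $ i\<bar>"
  have \<beta>: "0 \<le> ?\<beta>" by (intro sum_nonneg) auto
  have q: "0 \<le> ?q" by (rule weight_nonneg[OF dens])
  obtain C2 where C2: "0 < C2" and box: "\<And>\<F> k. \<lbrakk>finite \<F>; \<F> \<subseteq> \<Gamma>; \<And>\<gamma> i. \<gamma> \<in> \<F> \<Longrightarrow> \<lfloor>mdist (X i) (p i) (\<gamma> i (p i))\<rfloor> = k i\<rbrakk>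
      \<Longrightarrow> real (card \<F>) \<le> C2 * exp (\<Sum>i\<in>UNIV. b $ i * of_int (k i))" using box_count[OF dens] by blast
  show thesis
  proof (rule that[of "C2 * exp ?\<beta>"])
    show "0 < C2 * exp ?\<beta>" using C2 by simp
    fix e :: real and n :: nat assume e: "0 < e"
    let ?O = "slope_orbit e n"
    define k where "k \<gamma> = (\<lambda>i. \<lfloor>mdist (X i) (p i) (\<gamma> i (p i))\<rfloor>)" for \<gamma>
    define B where "B = C2 * exp ?\<beta> * exp (real n * (?q + e * ?\<beta>))"
    have B0: "0 \<le> B" using C2 by (simp add: B_def)
    have fiber: "real (card {\<gamma> \<in> ?O. k \<gamma> = v}) \<le> B" if v: "v \<in> k ` ?O" for v
    proof -
      obtain \<gamma> where \<gamma>: "\<gamma> \<in> ?O" "v = k \<gamma>" using v by blast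
      let ?D = "mdist PX p (act \<gamma> p)" and ?r = "\<lambda>i. mdist (X i) (p i) (\<gamma> i (p i))"
      have D: "0 < ?D" "?D \<le> real n" "\<And>i. \<bar>?r i / ?D - \<theta> $ i\<bar> < e" using \<gamma>(1) by (auto simp: slope_orbit_def)
      have "(\<Sum>i\<in>UNIV. b $ i * ?r i) \<le> ?D * (?q + e * ?\<beta>)" by (rule weighted_length_le[OF D(1,3)])
      also have "\<dots> \<le> real n * (?q + e * ?\<beta>)" using D(2) q e \<beta> by (intro mult_right_mono) auto
      finally have "(\<Sum>i\<in>UNIV. b $ i * of_int (v i)) \<le> real n * (?q + e * ?\<beta>) + ?\<beta>"
        using floor_weight_le[of ?r v b] by (simp add: \<gamma>(2) k_def)
      then have "exp (\<Sum>i\<in>UNIV. b $ i * of_int (v i)) \<le> exp (real n * (?q + e * ?\<beta>) + ?\<beta>)" by simp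
      then have "C2 * exp (\<Sum>i\<in>UNIV. b $ i * of_int (v i)) \<le> C2 * exp (real n * (?q + e * ?\<beta>) + ?\<beta>)"
        using C2 by (intro mult_left_mono) auto
      also have "\<dots> = B" by (simp add: B_def exp_add mult_ac)
      finally have "C2 * exp (\<Sum>i\<in>UNIV. b $ i * of_int (v i)) \<le> B" .
      moreover have "real (card {\<gamma> \<in> ?O. k \<gamma> = v}) \<le> C2 * exp (\<Sum>i\<in>UNIV. b $ i * of_int (v i))"
      proof (rule box)
        show "finite {\<gamma> \<in> ?O. k \<gamma> = v}" using finite_slope_orbit by simp
        show "{\<gamma> \<in> ?O. k \<gamma> = v} \<subseteq> \<Gamma>" by (auto simp: slope_orbit_def)
      qed (auto simp: k_def)
      ultimately show ?thesis by linarith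
    qed
    have "k ` ?O \<subseteq> (\<Pi>\<^sub>E i\<in>UNIV. {0..int n})"
    proof
      fix v assume "v \<in> k ` ?O"
      then obtain \<gamma> where \<gamma>: "\<gamma> \<in> ?O" "v = k \<gamma>" by blast
      have "mdist (X i) (p i) (\<gamma> i (p i)) \<le> real n" for i
        using mdist_component_le[of X i p "act \<gamma> p"] \<gamma>(1) by (simp add: slope_orbit_def act_def)
      then have "v i \<in> {0..int n}" for i
        using floor_mono[of "mdist (X i) (p i) (\<gamma> i (p i))" "real n" for i] by (auto simp: \<gamma>(2) k_def)
      then show "v \<in> (\<Pi>\<^sub>E i\<in>UNIV. {0..int n})" by (simp add: PiE_UNIV_domain)
    qed
    then have "card (k ` ?O) \<le> card (\<Pi>\<^sub>E i\<in>(UNIV::'i set). {0..int n})"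
      by (intro card_mono finite_PiE) auto
    also have "\<dots> = card {0..int n} ^ CARD('i)" by (simp add: card_PiE)
    also have "card {0..int n} = n + 1" by (simp add: nat_add_distrib)
    finally have "real (card (k ` ?O)) \<le> real ((n + 1) ^ CARD('i))" by (simp only: of_nat_le_iff)
    then have boxes: "real (card (k ` ?O)) \<le> real (n + 1) ^ CARD('i)" by (simp only: of_nat_power)
    have "card ?O = (\<Sum>v\<in>k ` ?O. card {\<gamma> \<in> ?O. k \<gamma> = v})"
      using sum.image_gen[OF finite_slope_orbit[of e n], of "\<lambda>_. 1 :: nat" k] by simp
    then have "real (card ?O) = (\<Sum>v\<in>k ` ?O. real (card {\<gamma> \<in> ?O. k \<gamma> = v}))" by simp
    also have "\<dots> \<le> (\<Sum>v\<in>k ` ?O. B)" by (intro sum_mono fiber)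
    also have "\<dots> = real (card (k ` ?O)) * B" by simp
    also have "\<dots> \<le> real (n + 1) ^ CARD('i) * B" using boxes B0 by (intro mult_right_mono)
    finally show "real (card ?O) \<le> real (n + 1) ^ CARD('i) * (C2 * exp ?\<beta> * exp (real n * (?q + e * ?\<beta>)))"
      by (simp only: B_def)
  qed
qed

definition growth_at :: "real \<Rightarrow> ereal" where
  "growth_at e = limsup (\<lambda>n. if orbit_count X \<Gamma> p \<theta> e n = 0 then -\<infinity>
     else ereal (ln (real (orbit_count X \<Gamma> p \<theta> e n)) / real n))"

text \<open>Monotonicity in the width \<open>e\<close> of the slope condition makes the limit for
\<open>e\<close> to \<open>0\<close> exist.\<close>

lemma growth_at_mono:
  assumes "e \<le> e'" shows "growth_at e \<le> growth_at e'"
  unfolding growth_at_def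
proof (rule Limsup_mono, rule always_eventually, rule allI)
  fix n
  have le: "orbit_count X \<Gamma> p \<theta> e n \<le> orbit_count X \<Gamma> p \<theta> e' n"
    unfolding orbit_count_eq by (rule card_mono[OF finite_slope_orbit slope_orbit_mono[OF assms]])
  show "(if orbit_count X \<Gamma> p \<theta> e n = 0 then -\<infinity> else ereal (ln (real (orbit_count X \<Gamma> p \<theta> e n)) / real n))
      \<le> (if orbit_count X \<Gamma> p \<theta> e' n = 0 then -\<infinity> else ereal (ln (real (orbit_count X \<Gamma> p \<theta> e' n)) / real n))"
  proof (cases "orbit_count X \<Gamma> p \<theta> e n = 0")
    case False
    then have "ln (real (orbit_count X \<Gamma> p \<theta> e n)) \<le> ln (real (orbit_count X \<Gamma> p \<theta> e' n))" using le by simp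
    then show ?thesis using False le by (auto intro: divide_right_mono)
  qed simp
qed

lemma growth_exponent_le_growth_at:
  assumes "0 < e" shows "growth_exponent X \<Gamma> p \<theta> \<le> growth_at e"
proof -
  define L where "L = (INF e\<in>{0<..}. growth_at e)"
  have "(growth_at \<longlongrightarrow> L) (at_right 0)"
  proof (rule order_tendstoI)
    fix a assume a: "a < L"
    have "L \<le> growth_at e" if "0 < e" for e unfolding L_def using that by (intro INF_lower) simp
    then show "\<forall>\<^sub>F e in at_right 0. a < growth_at e"
      using a unfolding eventually_at_right_field by (intro exI[of _ 1]) (auto intro: less_le_trans)
  next
    fix a assume "L < a"
    then obtain e0 where e0: "0 < e0" "growth_at e0 < a" unfolding L_def INF_less_iff by auto
    show "\<forall>\<^sub>F e in at_right 0. growth_at e < a"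
      unfolding eventually_at_right_field
      using e0 growth_at_mono by (intro exI[of _ e0]) (auto intro: le_less_trans less_imp_le)
  qed
  then have "Lim (at_right 0) growth_at = L" by (intro tendsto_Lim) auto
  then have "growth_exponent X \<Gamma> p \<theta> = L"
    unfolding growth_exponent_def growth_at_def[abs_def] .
  also have "L \<le> growth_at e" unfolding L_def using assms by (intro INF_lower) simp
  finally show ?thesis .
qed

lemma growth_at_le:
  assumes dens: "invariant_density X \<Gamma> p b \<theta> \<mu>" and e: "0 < e"
  shows "growth_at e \<le> ereal ((\<Sum>i\<in>UNIV. b $ i * \<theta> $ i) + e * (\<Sum>i\<in>UNIV. \<bar>b $ i\<bar>))"
proof -
  obtain C where C: "0 < C" and card_all: "\<And>e n. 0 < e \<Longrightarrow> real (card (slope_orbit e n)) \<le>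
    real (n + 1) ^ CARD('i) * (C * exp (real n * ((\<Sum>i\<in>UNIV. b $ i * \<theta> $ i) + e * (\<Sum>i\<in>UNIV. \<bar>b $ i\<bar>))))"
    by (rule slope_orbit_card[OF dens]) blast
  note card = card_all[OF e]
  define s where "s = (\<Sum>i\<in>UNIV. b $ i * \<theta> $ i) + e * (\<Sum>i\<in>UNIV. \<bar>b $ i\<bar>)"
  let ?r = "real CARD('i)"
  define u where "u n = (?r * ln 2 + ln C) / real n + ?r * (ln (real n) / real n) + s" for n
  have "growth_at e \<le> limsup (\<lambda>n. ereal (u n))" unfolding growth_at_def
  proof (rule Limsup_mono)
    show "\<forall>\<^sub>F n in sequentially. (if orbit_count X \<Gamma> p \<theta> e n = 0 then -\<infinity>
     else ereal (ln (real (orbit_count X \<Gamma> p \<theta> e n)) / real n)) \<le> ereal (u n)"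
      using eventually_gt_at_top[of 0]
    proof eventually_elim
      case (elim n)
      let ?N = "real (card (slope_orbit e n))"
      show ?case
      proof (cases "orbit_count X \<Gamma> p \<theta> e n = 0")
        case False
        then have N: "0 < ?N" by (simp add: orbit_count_eq)
        have n: "0 < real n" using elim by simp
        have "ln ?N \<le> ln (real (n + 1) ^ CARD('i) * (C * exp (real n * s)))"
          using card[of n] N by (intro ln_mono) (auto simp: s_def)
        also have "\<dots> = ?r * ln (real (n + 1)) + (ln C + real n * s)"
          using C by (simp add: ln_mult ln_realpow)
        also have "ln (real (n + 1)) \<le> ln (2 * real n)" using n by (intro ln_mono) auto
        also have "ln (2 * real n) = ln 2 + ln (real n)" using n by (simp add: ln_mult)
        finally have "ln ?N \<le> ?r * (ln 2 + ln (real n)) + (ln C + real n * s)" by simp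
        then have "ln ?N / real n \<le> (?r * (ln 2 + ln (real n)) + (ln C + real n * s)) / real n"
          using n by (intro divide_right_mono) auto
        also have "\<dots> = u n" using n by (simp add: u_def field_simps)
        finally show ?thesis using False by (simp add: orbit_count_eq)
      qed simp
    qed
  qed
  also have "limsup (\<lambda>n. ereal (u n)) = ereal s"
  proof (rule lim_imp_Limsup)
    have "u \<longlonglongrightarrow> 0 + ?r * 0 + s"
      unfolding u_def by (intro tendsto_intros lim_const_over_n lim_ln_over_n)
    then show "(\<lambda>n. ereal (u n)) \<longlonglongrightarrow> ereal s" by simp
  qed simp
  finally show ?thesis by (simp add: s_def)
qed

lemma growth_exponent_le:
  assumes dens: "invariant_density X \<Gamma> p b \<theta> \<mu>"
  shows "growth_exponent X \<Gamma> p \<theta> \<le> ereal (\<Sum>i\<in>UNIV. b $ i * \<theta> $ i)"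
proof (rule ereal_le_epsilon2)
  fix e :: real assume e: "0 < e"
  let ?\<beta> = "\<Sum>i\<in>UNIV. \<bar>b $ i\<bar>"
  have \<beta>: "0 \<le> ?\<beta>" by (intro sum_nonneg) auto
  define e' where "e' = e / (?\<beta> + 1)"
  have \<beta>1: "0 < ?\<beta> + 1" by (rule add_nonneg_pos[OF \<beta> zero_less_one])
  have e': "0 < e'" unfolding e'_def by (rule divide_pos_pos[OF e \<beta>1])
  have "e' * (?\<beta> + 1) = e" unfolding e'_def by (rule nonzero_eq_divide_eq[THEN iffD1, OF less_imp_neq[OF \<beta>1, symmetric] refl])
  then have e'e: "e' * ?\<beta> \<le> e" using e' by (simp add: distrib_left)
  have "growth_exponent X \<Gamma> p \<theta> \<le> ereal ((\<Sum>i\<in>UNIV. b $ i * \<theta> $ i) + e' * ?\<beta>)"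
    using growth_exponent_le_growth_at[OF e'] growth_at_le[OF dens e'] by (rule order_trans)
  also have "\<dots> \<le> ereal (\<Sum>i\<in>UNIV. b $ i * \<theta> $ i) + ereal e" using e'e by simp
  finally show "growth_exponent X \<Gamma> p \<theta> \<le> ereal (\<Sum>i\<in>UNIV. b $ i * \<theta> $ i) + ereal e" .
qed

end

theorem theoremC:
  fixes X :: "'i::finite \<Rightarrow> 'a metric"
    and \<Gamma> :: "('i \<Rightarrow> 'a \<Rightarrow> 'a) set"
    and h g :: "'i \<Rightarrow> 'a \<Rightarrow> 'a"
    and p :: "'i \<Rightarrow> 'a"
    and b \<theta> :: "real^'i"
    and \<mu> :: "('i \<Rightarrow> 'a) \<Rightarrow> (real \<Rightarrow> 'i \<Rightarrow> 'a) set measure"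
  assumes "\<And>i. hadamard (X i)"
    and "\<And>i. locally_compact_space (mtopology_of (X i))"
    and "subgroup \<Gamma> (product_group UNIV (\<lambda>i. isometry_group (X i)))"
    and "properly_discontinuous X \<Gamma>"
    and "h \<in> \<Gamma>" and "g \<in> \<Gamma>"
    and "\<And>i. independent_rank_one (X i) (g i) (h i)"
    and "p \<in> Ax (product_metric X) (act h)"
    and "\<theta> \<in> E_plus"
    and "invariant_density X \<Gamma> p b \<theta> \<mu>"
  shows "growth_exponent X \<Gamma> p \<theta> \<le> ereal (\<Sum>i\<in>UNIV. b $ i * \<theta> $ i)"
proof -
  have proper: "proper_cn_space (X i)" for i using assms(1,2) by (rule proper_cn_space_hadamard)
  define cc where "cc i z \<longleftrightarrow> (case z of (F, \<sigma>, l, T, c, K) \<Rightarrow> contracting_coordinate (X i) (g i) (h i) F \<sigma> l T c K)" for i z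
  have "\<forall>i. \<exists>z. cc i z"
  proof
    fix i
    obtain F \<sigma> l T c K where "contracting_coordinate (X i) (g i) (h i) F \<sigma> l T c K"
      using contracting_coordinate_exists[OF proper assms(7)] by blast
    then show "\<exists>z. cc i z" by (intro exI[of _ "(F, \<sigma>, l, T, c, K)"]) (simp add: cc_def)
  qed
  from choice[OF this] obtain z where z: "\<forall>i. cc i (z i)" by blast
  define F where "F i = fst (z i)" for i
  define \<sigma> where "\<sigma> i = fst (snd (z i))" for i
  define l where "l i = fst (snd (snd (z i)))" for i
  define T where "T i = fst (snd (snd (snd (z i))))" for i
  define c where "c i = fst (snd (snd (snd (snd (z i)))))" for i
  define K where "K i = snd (snd (snd (snd (snd (z i)))))" for i
  have cc: "contracting_coordinate (X i) (g i) (h i) (F i) (\<sigma> i) (l i) (T i) (c i) (K i)" for i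
    using spec[OF z, of i] by (simp add: cc_def F_def \<sigma>_def l_def T_def c_def K_def split_beta)
  have "product_space X \<theta>" using proper assms(9) by (rule product_space.intro)
  moreover have "p \<in> mspace (product_metric X)" using assms(8) by (simp add: Ax_def)
  ultimately have "product_action X \<theta> \<Gamma> p"
    using assms(3,4) by (intro product_action.intro product_action_axioms.intro)
  then interpret contracting_action X \<theta> \<Gamma> p g h F \<sigma> l T c K
    by (intro contracting_action.intro contracting_action_axioms.intro cc assms(5,6))
  show ?thesis by (rule growth_exponent_le[OF assms(10)])
qed

end
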